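(* Let $e\ge 2$ be an integer and let $F=\hat F_e$ be the free profinite group of rank $e$. Let $M_1,M_2$ be closed normal subgroups of $F$, and let $M$ be a closed subgroup of $F$ with $(F:M)=\infty$, $M_1\cap M_2\le M$, $M_1\not\le M$, and $M_2\not\le M$. Then $M\cong \hat F_\omega$.
   Context: $\hat F_m$ denotes the free profinite group of rank $m$; $\hat F_\omega$ is the free profinite group of countably infinite rank $\aleph_0$. *)

theory Defs
  imports "HOL-Analysis.Analysis" "HOL-Algebra.Product_Groups"
begin

text \<open>The abstract free group on a set \<open>X\<close>, realised by reduced words. The letter \<open>(True, x)\<close>
  stands for the generator \<open>x\<close> and \<open>(False, x)\<close> for its formal inverse.\<close>

definition inv_letter :: "bool \<times> 'x \<Rightarrow> bool \<times> 'x" where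
  "inv_letter a = (\<not> fst a, snd a)"

definition reduced :: "(bool \<times> 'x) list \<Rightarrow> bool" where
  "reduced w \<longleftrightarrow> successively (\<lambda>a b. b \<noteq> inv_letter a) w"

text \<open>The reduced form of \<open>a # w\<close>, for a reduced word \<open>w\<close>.\<close>

definition push :: "bool \<times> 'x \<Rightarrow> (bool \<times> 'x) list \<Rightarrow> (bool \<times> 'x) list" where
  "push a w = (if w \<noteq> [] \<and> hd w = inv_letter a then tl w else a # w)"

definition free_group :: "'x set \<Rightarrow> (bool \<times> 'x) list monoid" where
  "free_group X = \<lparr>carrier = {w. reduced w \<and> snd ` set w \<subseteq> X},
                   mult = \<lambda>u v. foldr push u v,
                   one = []\<rparr>"

text \<open>The free profinite group on a set \<open>X\<close> converging to 1: the inverse limit of the quotients of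
  the abstract free group on \<open>X\<close> by its normal subgroups of finite index containing all but
  finitely many elements of \<open>X\<close>. The last condition is void for finite \<open>X\<close>.\<close>

definition free_levels :: "'x set \<Rightarrow> (bool \<times> 'x) list set set" where
  "free_levels X = {N. N \<lhd> free_group X
                     \<and> finite (rcosets\<^bsub>free_group X\<^esub> N)
                     \<and> finite {x \<in> X. [(True, x)] \<notin> N}}"

text \<open>For \<open>N \<subseteq> N'\<close>, the canonical map from the quotient by \<open>N\<close> to the quotient by \<open>N'\<close> sends a
  coset of \<open>N\<close> to the unique coset of \<open>N'\<close> containing it, so the condition \<open>f N \<subseteq> f N'\<close> below
  says that the family \<open>f\<close> is compatible.\<close>

definition free_profinite_group ::
    "'x set \<Rightarrow> ((bool \<times> 'x) list set \<Rightarrow> (bool \<times> 'x) list set) monoid" where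
  "free_profinite_group X =
     (let P = product_group (free_levels X) (\<lambda>N. free_group X Mod N)
      in P\<lparr>carrier := {f \<in> carrier P.
           \<forall>N \<in> free_levels X. \<forall>N' \<in> free_levels X. N \<subseteq> N' \<longrightarrow> f N \<subseteq> f N'}\<rparr>)"

definition free_profinite_topology ::
    "'x set \<Rightarrow> ((bool \<times> 'x) list set \<Rightarrow> (bool \<times> 'x) list set) topology" where
  "free_profinite_topology X =
     subtopology (product_topology (\<lambda>N. discrete_topology (carrier (free_group X Mod N)))
                                   (free_levels X))
                 (carrier (free_profinite_group X))"

abbreviation "Fhat (e :: nat) \<equiv> free_profinite_group {..<e}"
abbreviation "Fhat_top (e :: nat) \<equiv> free_profinite_topology {..<e}"

abbreviation "Fhat_omega \<equiv> free_profinite_group (UNIV :: nat set)"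
abbreviation "Fhat_omega_top \<equiv> free_profinite_topology (UNIV :: nat set)"

text \<open>Isomorphism of topological groups, each given as a group together with a topology
  on its carrier.\<close>

definition top_group_iso ::
    "('a, 'm) monoid_scheme \<Rightarrow> 'a topology \<Rightarrow> ('b, 'n) monoid_scheme \<Rightarrow> 'b topology \<Rightarrow> bool" where
  "top_group_iso G S H T \<longleftrightarrow> (\<exists>h. h \<in> iso G H \<and> homeomorphic_map S T h)"

text \<open>The structures above satisfy the group axioms.\<close>

lemma inv_letter_inv_letter [simp]: "inv_letter (inv_letter a) = a"
  by (simp add: inv_letter_def)

lemma reduced_Cons:
  "reduced (a # w) \<longleftrightarrow> reduced w \<and> (w = [] \<or> hd w \<noteq> inv_letter a)"
  by (auto simp: reduced_def successively_Cons)

lemma reduced_push: "reduced w \<Longrightarrow> reduced (push a w)"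
  by (cases w) (auto simp: push_def reduced_Cons)

lemma push_push_inv: "reduced w \<Longrightarrow> push a (push (inv_letter a) w) = w"
  by (cases w) (auto simp: push_def reduced_Cons)

lemma reduced_foldr_push: "reduced w \<Longrightarrow> reduced (foldr push u w)"
  by (induction u) (auto intro: reduced_push)

lemma foldr_push_push:
  assumes "reduced w"
  shows "foldr push (push a u) w = push a (foldr push u w)"
  using push_push_inv[OF reduced_foldr_push[OF assms], of a "tl u"]
  by (cases u) (auto simp: push_def)

lemma foldr_push_assoc:
  "reduced w \<Longrightarrow> foldr push (foldr push u v) w = foldr push u (foldr push v w)"
  by (induction u) (auto simp: foldr_push_push)

lemma foldr_push_Nil: "reduced w \<Longrightarrow> foldr push w [] = w"
  by (induction w) (auto simp: push_def reduced_Cons)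

lemma snd_set_foldr_push: "snd ` set (foldr push u v) \<subseteq> snd ` set u \<union> snd ` set v"
proof (induction u)
  case (Cons a u)
  have "set (push a w) \<subseteq> insert a (set w)" for w
    by (cases w) (auto simp: push_def)
  then have "snd ` set (push a w) \<subseteq> insert (snd a) (snd ` set w)" for w
    by (metis image_insert image_mono)
  from order_trans[OF this insert_mono[OF Cons]] show ?case by simp
qed simp

lemma free_group_left_inverse:
  assumes "reduced w"
  shows "\<exists>v. reduced v \<and> snd ` set v \<subseteq> snd ` set w \<and> foldr push v w = []"
  using assms
proof (induction w)
  case Nil
  show ?case by (intro exI[of _ "[]"]) (simp add: reduced_def)
next
  case (Cons a w)
  then obtain v where v: "reduced v" "snd ` set v \<subseteq> snd ` set w" "foldr push v w = []"
    by (auto simp: reduced_Cons)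
  let ?v = "foldr push v [inv_letter a]"
  have "foldr push ?v (a # w) = foldr push v w"
    using Cons.prems by (simp add: foldr_push_assoc) (simp add: push_def)
  moreover have "snd ` set ?v \<subseteq> snd ` set (a # w)"
  proof -
    have "snd ` set ?v \<subseteq> snd ` set v \<union> {snd a}"
      using snd_set_foldr_push[of v "[inv_letter a]"] by (simp add: inv_letter_def)
    also have "\<dots> \<subseteq> snd ` set (a # w)" using v(2) by auto
    finally show ?thesis .
  qed
  moreover have "reduced ?v"
    by (rule reduced_foldr_push) (simp add: reduced_def)
  ultimately show ?case using v(3) by (intro exI[of _ ?v]) (simp only: simp_thms)
qed

lemma group_free_group: "group (free_group X)"
proof (rule groupI)
  fix u v assume "u \<in> carrier (free_group X)" "v \<in> carrier (free_group X)"
  then show "u \<otimes>\<^bsub>free_group X\<^esub> v \<in> carrier (free_group X)"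
    using order_trans[OF snd_set_foldr_push[of u v]] by (simp add: free_group_def reduced_foldr_push)
next
  fix w assume "w \<in> carrier (free_group X)"
  then have w: "reduced w" "snd ` set w \<subseteq> X"
    by (simp_all add: free_group_def)
  from free_group_left_inverse[OF w(1)]
  obtain v where "reduced v" "snd ` set v \<subseteq> snd ` set w" "foldr push v w = []"
    by blast
  with w(2) show "\<exists>v\<in>carrier (free_group X). v \<otimes>\<^bsub>free_group X\<^esub> w = \<one>\<^bsub>free_group X\<^esub>"
    by (intro bexI[of _ v]) (simp_all add: free_group_def)
qed (auto simp: free_group_def foldr_push_assoc reduced_def)

lemma subgroup_free_profinite_group:
  "subgroup (carrier (free_profinite_group X))
     (product_group (free_levels X) (\<lambda>N. free_group X Mod N))"
proof -
  let ?L = "free_levels X" and ?G = "free_group X"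
  let ?P = "product_group ?L (\<lambda>N. ?G Mod N)"
  have nml: "N \<lhd> ?G" if "N \<in> ?L" for N
    using that by (simp add: free_levels_def)
  have quot: "group (?G Mod N)" if "N \<in> ?L" for N
    using normal.factorgroup_is_group[OF nml[OF that]] .
  interpret P: group ?P using quot by simp
  have mem: "f \<in> carrier (free_profinite_group X) \<longleftrightarrow> f \<in> carrier ?P \<and>
      (\<forall>N \<in> ?L. \<forall>N' \<in> ?L. N \<subseteq> N' \<longrightarrow> f N \<subseteq> f N')" for f
    by (simp add: free_profinite_group_def Let_def)
  have carrD: "f \<in> carrier ?P" if "f \<in> carrier (free_profinite_group X)" for f
    using that unfolding mem by (rule conjunct1)
  have compatD: "f N \<subseteq> f N'"
    if "f \<in> carrier (free_profinite_group X)" "N \<in> ?L" "N' \<in> ?L" "N \<subseteq> N'" for f N N'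
    using that(1)[unfolded mem, THEN conjunct2, rule_format, OF that(2-4)] .
  have one: "\<one>\<^bsub>?P\<^esub> N = N" if "N \<in> ?L" for N
    using that by (simp add: FactGroup_def)
  have mlt: "(f \<otimes>\<^bsub>?P\<^esub> g) N = f N <#>\<^bsub>?G\<^esub> g N" if "N \<in> ?L" for f g N
    using that by (simp add: FactGroup_def)
  have inv: "(inv\<^bsub>?P\<^esub> f) N = set_inv\<^bsub>?G\<^esub> (f N)" if "f \<in> carrier ?P" "N \<in> ?L" for f N
  proof -
    have f: "f \<in> (\<Pi>\<^sub>E N\<in>?L. carrier (?G Mod N))"
      using that(1) by (simp only: carrier_product_group)
    have "f N \<in> carrier (?G Mod N)"
      using f that(2) by (rule PiE_mem)
    from normal.inv_FactGroup[OF nml[OF that(2)] this]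
    show ?thesis
      by (simp only: inv_product_group[OF f quot] restrict_apply that(2) if_True)
  qed
  have inv_mono: "set_inv\<^bsub>?G\<^esub> A \<subseteq> set_inv\<^bsub>?G\<^esub> B" if "A \<subseteq> B" for A B
    using that unfolding SET_INV_def by blast
  show ?thesis
  proof (rule P.subgroupI)
    show "carrier (free_profinite_group X) \<subseteq> carrier ?P"
      by (rule subsetI) (rule carrD)
    have "\<one>\<^bsub>?P\<^esub> \<in> carrier (free_profinite_group X)"
      unfolding mem
    proof (intro conjI ballI impI)
      fix N N' assume N: "N \<in> ?L" "N' \<in> ?L" "N \<subseteq> N'"
      then show "\<one>\<^bsub>?P\<^esub> N \<subseteq> \<one>\<^bsub>?P\<^esub> N'"
        by (simp only: one)
    qed (rule P.one_closed)
    then show "carrier (free_profinite_group X) \<noteq> {}" by blast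
  next
    fix f assume f: "f \<in> carrier (free_profinite_group X)"
    then have fP: "f \<in> carrier ?P" by (rule carrD)
    show "inv\<^bsub>?P\<^esub> f \<in> carrier (free_profinite_group X)"
      unfolding mem
    proof (intro conjI ballI impI)
      fix N N' assume N: "N \<in> ?L" "N' \<in> ?L" "N \<subseteq> N'"
      show "(inv\<^bsub>?P\<^esub> f) N \<subseteq> (inv\<^bsub>?P\<^esub> f) N'"
        unfolding inv[OF fP N(1)] inv[OF fP N(2)] by (rule inv_mono[OF compatD[OF f N]])
    qed (rule P.inv_closed[OF fP])
  next
    fix f g assume f: "f \<in> carrier (free_profinite_group X)"
      and g: "g \<in> carrier (free_profinite_group X)"
    then have fgP: "f \<in> carrier ?P" "g \<in> carrier ?P"
      by (simp_all only: carrD)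
    show "f \<otimes>\<^bsub>?P\<^esub> g \<in> carrier (free_profinite_group X)"
      unfolding mem
    proof (intro conjI ballI impI)
      fix N N' assume N: "N \<in> ?L" "N' \<in> ?L" "N \<subseteq> N'"
      show "(f \<otimes>\<^bsub>?P\<^esub> g) N \<subseteq> (f \<otimes>\<^bsub>?P\<^esub> g) N'"
        unfolding mlt[OF N(1)] mlt[OF N(2)] by (rule mono_set_mult[OF compatD[OF f N] compatD[OF g N]])
    qed (rule P.m_closed[OF fgP])
  qed
qed

lemma group_free_profinite_group: "group (free_profinite_group X)"
proof -
  let ?P = "product_group (free_levels X) (\<lambda>N. free_group X Mod N)"
  have P: "group ?P"
    by (rule product_group, rule normal.factorgroup_is_group) (simp add: free_levels_def)
  have "?P\<lparr>carrier := carrier (free_profinite_group X)\<rparr> = free_profinite_group X"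
    unfolding free_profinite_group_def Let_def by (simp del: carrier_product_group)
  with subgroup.subgroup_is_group[OF subgroup_free_profinite_group P]
  show ?thesis by (simp only:)
qed

end

theory Submission
  imports Defs "HOL-Algebra.SndIsomorphismGrp"
begin

text \<open>By Iwasawa's back-and-forth argument it suffices to solve every finite embedding problem
  \<open>\<phi> : M \<rightarrow> K\<close>, \<open>\<alpha> : H \<rightarrow> K\<close>, and one may assume that \<open>A = ker \<alpha>\<close> is a minimal normal subgroup of \<open>H\<close>.
  Extend \<open>\<phi>\<close> to a sufficiently small open subgroup \<open>E \<ge> M\<close>, and let \<open>F \<ge> E\<close> be open of large index; by
  Nielsen--Schreier \<open>F\<close> is free of large rank \<open>r\<close>. Lifts of \<open>\<phi>\<close> to \<open>E \<rightarrow> H\<close> come from cocycles on the coset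
  space \<open>T\<close> of \<open>E\<close> in \<open>F\<close>, that is, from arbitrary labels on the \<open>r * card T\<close> edges of the Schreier graph,
  so there are \<open>card A ^ (r * card T)\<close> of them.

  Two normal subgroups \<open>N1\<close>, \<open>N2\<close> of \<open>F\<close> with \<open>N1 \<inter> N2 \<le> M \<inter> ker \<phi>\<close> commute modulo \<open>N1 \<inter> N2\<close>. A surjective
  lift \<open>l\<close> either maps \<open>N1 \<inter> N2\<close> onto \<open>A\<close>, and then its restriction to \<open>M\<close> solves the embedding problem,
  or it kills \<open>N1 \<inter> N2\<close>. In the latter case the commutation relations between \<open>g \<in> N1\<close> and its conjugates
  on the one hand and a few elements of \<open>N2\<close> on the other determine the labels by their values at orbit
  representatives. As \<open>N2\<close> has large orbits on \<open>T\<close> and \<open>N1\<close> has no fixed points, few representatives suffice,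
  so these lifts are a minority; so are the lifts that are not surjective.\<close>

section \<open>Groups with a chain of normal subgroups of finite index\<close>

text \<open>The order of choices is \<open>F\<close> before \<open>E\<close>. The rank
  \<open>r\<close> depends on the index of \<open>F\<close> and has to beat constants that depend on
  \<open>H\<close>; afterwards \<open>E\<close> can still be shrunk, which enlarges \<open>T\<close>
  but not \<open>r\<close>, until \<open>N2\<close> meets 32 cosets of \<open>E\<close> and
  \<open>N1\<close> is not contained in \<open>E\<close>. All counts are then compared per point of
  \<open>T\<close>, in exponents of \<open>card A\<close>, where the total is \<open>r\<close>. A
  lift that kills \<open>N1 \<inter> N2\<close> is fixed by at most
  \<open>10 + 1/8 + r/8 + 3 r/4\<close> values per point: from 10 elements of \<open>N2\<close>, one
  element of \<open>N1\<close>, its \<open>r\<close> conjugates by the generators, and the labels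
  themselves. A lift into a proper subgroup loses a factor 2 for each of the \<open>r\<close> labels
  per point and gains back one element of \<open>A\<close>. Only cardinalities enter, so abelian and
  non-abelian \<open>A\<close> are treated alike. Minimality of \<open>A\<close> is used for
  surjective lifts, which send normal subgroups to normal subgroups. The obstacle in choosing
  \<open>F\<close> is that \<open>M1\<close>, say, may meet only finitely many cosets of
  \<open>M\<close>. Its orbits then stay bounded, and it can only serve as \<open>N1\<close>; a
  small open normal subgroup takes the place of \<open>N2\<close>.\<close>

lemma finite_group_nat_copy:
  fixes H :: "('a, 'b) monoid_scheme"
  assumes "group H" "finite (carrier H)"
  obtains Q :: "nat monoid" and h where "group Q" "finite (carrier Q)" "h \<in> iso H Q"
proof -
  interpret H: group H by fact
  obtain b :: "'a \<Rightarrow> nat" where b: "inj_on b (carrier H)"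
    using finite_imp_inj_to_nat_seg[OF assms(2)] by blast
  let ?c = "inv_into (carrier H) b"
  define Q where "Q = \<lparr>carrier = b ` carrier H,
    mult = (\<lambda>x y. b (?c x \<otimes>\<^bsub>H\<^esub> ?c y)), one = b \<one>\<^bsub>H\<^esub>\<rparr>"
  have inv: "?c (b x) = x" if "x \<in> carrier H" for x
    using b that by simp
  have iso: "b \<in> iso H Q"
    using b by (auto simp: iso_def hom_def Q_def bij_betw_def inv)
  have "group Q"
  proof (rule groupI)
    fix x assume "x \<in> carrier Q"
    then obtain a where a: "a \<in> carrier H" "x = b a" by (auto simp: Q_def)
    then show "\<exists>y\<in>carrier Q. y \<otimes>\<^bsub>Q\<^esub> x = \<one>\<^bsub>Q\<^esub>"
      by (intro bexI[of _ "b (inv\<^bsub>H\<^esub> a)"]) (auto simp: Q_def inv)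
  qed (auto simp: Q_def inv H.m_assoc)
  moreover have "finite (carrier Q)" using assms(2) by (simp add: Q_def)
  ultimately show ?thesis using iso that by blast
qed

lemma group_homI: "group G \<Longrightarrow> group H \<Longrightarrow> f \<in> hom G H \<Longrightarrow> group_hom G H f"
  by (simp add: group_hom_def group_hom_axioms_def)

text \<open>The subgroups \<open>U i\<close> play the role of a basis of neighbourhoods of \<open>1\<close>: \<open>chom\<close> consists of the
  homomorphisms that are continuous for the discrete topology of the target, and \<open>dense_in\<close> says that
  \<open>Z\<close> generates the group topologically. In \<open>free_on\<close> it is enough to test groups carried by \<open>nat\<close>,
  see \<open>free_on_chom\<close>.\<close>

locale chain_group = group G for G (structure) +
  fixes U :: "nat \<Rightarrow> 'a set"
  assumes U_normal: "U i \<lhd> G"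
    and finite_rcosets_U: "finite (rcosets U i)"
    and U_Suc: "U (Suc i) \<subseteq> U i"

definition chom :: "('a, 'm) monoid_scheme \<Rightarrow> (nat \<Rightarrow> 'a set) \<Rightarrow> ('b, 'n) monoid_scheme \<Rightarrow> ('a \<Rightarrow> 'b) set"
  where "chom G U H = {f \<in> hom G H. \<exists>i. \<forall>x\<in>U i. f x = \<one>\<^bsub>H\<^esub>}"

definition dense_in :: "('a, 'm) monoid_scheme \<Rightarrow> (nat \<Rightarrow> 'a set) \<Rightarrow> 'a set \<Rightarrow> bool"
  where "dense_in G U Z \<longleftrightarrow> (\<forall>i S. subgroup S G \<and> U i \<subseteq> S \<and> Z \<subseteq> S \<longrightarrow> carrier G \<subseteq> S)"

definition free_on :: "('a, 'm) monoid_scheme \<Rightarrow> (nat \<Rightarrow> 'a set) \<Rightarrow> 'i set \<Rightarrow> ('i \<Rightarrow> 'a) \<Rightarrow> bool"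
  where "free_on G U I z \<longleftrightarrow> z ` I \<subseteq> carrier G \<and> dense_in G U (z ` I) \<and>
    (\<forall>(H :: nat monoid) q. group H \<and> finite (carrier H) \<and> q ` I \<subseteq> carrier H
       \<and> finite {i \<in> I. q i \<noteq> \<one>\<^bsub>H\<^esub>} \<longrightarrow> (\<exists>f \<in> chom G U H. \<forall>i\<in>I. f (z i) = q i))"

lemma chom_hom: "f \<in> chom G U H \<Longrightarrow> f \<in> hom G H"
  by (simp add: chom_def)

lemma chom_compose:
  assumes "f \<in> chom G U H" "g \<in> hom H K" "group H" "group K"
  shows "(\<lambda>x. g (f x)) \<in> chom G U K"
proof -
  interpret g: group_hom H K g using assms by (simp add: group_homI)
  have "(\<lambda>x. g (f x)) \<in> hom G K"
    using assms(1,2) by (auto simp: chom_def hom_def Pi_iff)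
  moreover obtain i where "\<forall>x\<in>U i. f x = \<one>\<^bsub>H\<^esub>" using assms(1) by (auto simp: chom_def)
  then have "\<forall>x\<in>U i. g (f x) = \<one>\<^bsub>K\<^esub>" by simp
  ultimately show ?thesis unfolding chom_def by blast
qed

text \<open>The values are transported to a copy of \<open>H\<close> on natural numbers, where
  \<open>free_on\<close> applies, and the resulting homomorphism is carried back.\<close>

lemma free_on_chom:
  fixes H :: "('b, 'n) monoid_scheme"
  assumes free: "free_on G U I z" and "group G" and H: "group H" "finite (carrier H)"
    and q: "q ` I \<subseteq> carrier H" "finite {i \<in> I. q i \<noteq> \<one>\<^bsub>H\<^esub>}"
  obtains f where "f \<in> chom G U H" "\<And>i. i \<in> I \<Longrightarrow> f (z i) = q i"
proof -
  obtain Q :: "nat monoid" and h where Q: "group Q" "finite (carrier Q)" "h \<in> iso H Q"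
    using finite_group_nat_copy[OF H] by blast
  interpret h: group_hom H Q h using H Q by (simp add: group_homI iso_def)
  have hq: "(h \<circ> q) ` I \<subseteq> carrier Q" "finite {i \<in> I. (h \<circ> q) i \<noteq> \<one>\<^bsub>Q\<^esub>}"
  proof -
    show "(h \<circ> q) ` I \<subseteq> carrier Q" using q(1) by auto
    have "{i \<in> I. (h \<circ> q) i \<noteq> \<one>\<^bsub>Q\<^esub>} \<subseteq> {i \<in> I. q i \<noteq> \<one>\<^bsub>H\<^esub>}" by auto
    then show "finite {i \<in> I. (h \<circ> q) i \<noteq> \<one>\<^bsub>Q\<^esub>}" using q(2) finite_subset by blast
  qed
  have "\<exists>f \<in> chom G U Q. \<forall>i\<in>I. f (z i) = (h \<circ> q) i"
    using free Q(1,2) hq unfolding free_on_def by blast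
  then obtain f where f: "f \<in> chom G U Q" "\<And>i. i \<in> I \<Longrightarrow> f (z i) = h (q i)"
    by auto
  define k where "k = inv_into (carrier H) h"
  have k: "k \<in> iso Q H" unfolding k_def using group.iso_set_sym[OF H(1) Q(3)] .
  have kh: "k (h x) = x" if "x \<in> carrier H" for x
    using Q(3) that by (auto simp: k_def iso_def bij_betw_def)
  have "(\<lambda>x. k (f x)) \<in> chom G U H"
    using chom_compose[OF f(1) _ Q(1) H(1)] k by (simp add: iso_def)
  moreover have "k (f (z i)) = q i" if "i \<in> I" for i
    using f(2)[OF that] kh q(1) that by auto
  ultimately show ?thesis using that by blast
qed

section \<open>Continuous homomorphisms and density\<close>

context chain_group
begin

lemma U_subgroup: "subgroup (U i) G"
  by (rule normal_imp_subgroup[OF U_normal])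

lemma U_carrier: "x \<in> U i \<Longrightarrow> x \<in> carrier G"
  by (rule subgroup.mem_carrier[OF U_subgroup])

lemma U_anti: "i \<le> j \<Longrightarrow> U j \<subseteq> U i"
  by (induction rule: dec_induct) (use U_Suc in auto)

lemma U_conj: "x \<in> carrier G \<Longrightarrow> u \<in> U i \<Longrightarrow> x \<otimes> u \<otimes> inv x \<in> U i"
  using normal.inv_op_closed2[OF U_normal] .

text \<open>The equaliser is a subgroup that contains \<open>Z\<close> and, by continuity of both
  maps, some \<open>U (max i j)\<close>; density makes it everything.\<close>

lemma chom_eqI:
  assumes "f \<in> chom G U H" "g \<in> chom G U H" "group H" "dense_in G U Z" "Z \<subseteq> carrier G"
    and eq: "\<And>x. x \<in> Z \<Longrightarrow> f x = g x" and x: "x \<in> carrier G"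
  shows "f x = g x"
proof -
  interpret f: group_hom G H f using assms by (intro group_homI is_group) (simp_all add: chom_def)
  interpret g: group_hom G H g using assms by (intro group_homI is_group) (simp_all add: chom_def)
  let ?S = "{x \<in> carrier G. f x = g x}"
  obtain i j where "\<forall>x\<in>U i. f x = \<one>\<^bsub>H\<^esub>" "\<forall>x\<in>U j. g x = \<one>\<^bsub>H\<^esub>"
    using assms(1,2) by (auto simp: chom_def)
  then have "U (max i j) \<subseteq> ?S"
    using subsetD[OF U_anti[of i "max i j"]] subsetD[OF U_anti[of j "max i j"]] U_carrier by auto
  moreover have "subgroup ?S G" by (rule subgroupI) (auto simp: m_closed)
  moreover have "Z \<subseteq> ?S" using assms by auto
  ultimately have "carrier G \<subseteq> ?S" using assms(4) unfolding dense_in_def by blast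
  with x show ?thesis by auto
qed

end

lemma free_on_dense: "free_on G U I z \<Longrightarrow> dense_in G U (z ` I)"
  and free_on_carrier: "free_on G U I z \<Longrightarrow> i \<in> I \<Longrightarrow> z i \<in> carrier G"
  by (auto simp: free_on_def)

text \<open>The permutational wreath product \<open>H wr Sym T\<close>, with permutations acting from the right.\<close>

definition perm_wreath :: "'t set \<Rightarrow> ('b, 'n) monoid_scheme \<Rightarrow> (('t \<Rightarrow> 't) \<times> ('t \<Rightarrow> 'b)) monoid" where
  "perm_wreath T H = \<lparr>carrier = {s \<in> T \<rightarrow>\<^sub>E T. bij_betw s T T} \<times> (T \<rightarrow>\<^sub>E carrier H),
     mult = (\<lambda>(s, f) (s', f'). (\<lambda>t\<in>T. s' (s t), \<lambda>t\<in>T. f t \<otimes>\<^bsub>H\<^esub> f' (s t))),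
     one = (\<lambda>t\<in>T. t, \<lambda>t\<in>T. \<one>\<^bsub>H\<^esub>)\<rparr>"

lemma group_perm_wreath:
  assumes "group H"
  shows "group (perm_wreath T H)"
proof -
  interpret H: group H by fact
  have bij: "bij_betw (\<lambda>t\<in>T. s' (s t)) T T" if "bij_betw s T T" "bij_betw s' T T" for s s'
    using bij_betw_trans[OF that] by (simp add: comp_def cong: bij_betw_cong)
  have mem: "s t \<in> T" if "bij_betw s T T" "t \<in> T" for s t
    using that by (auto simp: bij_betw_def)
  show ?thesis
  proof (rule groupI)
    fix x assume "x \<in> carrier (perm_wreath T H)"
    then obtain s f where x: "x = (s, f)" "s \<in> T \<rightarrow>\<^sub>E T" "bij_betw s T T" "f \<in> T \<rightarrow>\<^sub>E carrier H"
      by (auto simp: perm_wreath_def)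
    \<comment> \<open>The left inverse permutes backwards, and its entry at \<open>t\<close> has to
      cancel the entry of \<open>f\<close> at the point that \<open>s\<close> sends to
      \<open>t\<close>.\<close>
    let ?s = "\<lambda>t\<in>T. inv_into T s t"
    let ?f = "\<lambda>t\<in>T. inv\<^bsub>H\<^esub> f (inv_into T s t)"
    have s1: "bij_betw ?s T T"
      using bij_betw_inv_into[OF x(3)] by (simp cong: bij_betw_cong)
    have s2: "inv_into T s t \<in> T" "s (inv_into T s t) = t" if "t \<in> T" for t
      using x(3) that by (auto simp: bij_betw_def inv_into_into f_inv_into_f)
    have "(?s, ?f) \<in> carrier (perm_wreath T H)"
      using s1 s2 x(4) by (auto simp: perm_wreath_def)
    moreover have "(?s, ?f) \<otimes>\<^bsub>perm_wreath T H\<^esub> x = \<one>\<^bsub>perm_wreath T H\<^esub>"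
      using s2 x(1,4) by (simp add: perm_wreath_def PiE_mem[OF x(4)] cong: restrict_cong)
    ultimately show "\<exists>y\<in>carrier (perm_wreath T H). y \<otimes>\<^bsub>perm_wreath T H\<^esub> x = \<one>\<^bsub>perm_wreath T H\<^esub>"
      by blast
  next
    fix x y z
    assume "x \<in> carrier (perm_wreath T H)" "y \<in> carrier (perm_wreath T H)"
      "z \<in> carrier (perm_wreath T H)"
    then obtain s1 f1 s2 f2 s3 f3 where
      x: "x = (s1, f1)" "s1 \<in> T \<rightarrow>\<^sub>E T" "f1 \<in> T \<rightarrow>\<^sub>E carrier H" and
      y: "y = (s2, f2)" "s2 \<in> T \<rightarrow>\<^sub>E T" "f2 \<in> T \<rightarrow>\<^sub>E carrier H" and
      z: "z = (s3, f3)" "s3 \<in> T \<rightarrow>\<^sub>E T" "f3 \<in> T \<rightarrow>\<^sub>E carrier H"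
      unfolding perm_wreath_def by auto
    show "x \<otimes>\<^bsub>perm_wreath T H\<^esub> y \<otimes>\<^bsub>perm_wreath T H\<^esub> z
        = x \<otimes>\<^bsub>perm_wreath T H\<^esub> (y \<otimes>\<^bsub>perm_wreath T H\<^esub> z)"
      unfolding x(1) y(1) z(1)
      by (simp add: perm_wreath_def PiE_mem[OF x(2)] PiE_mem[OF y(2)] PiE_mem[OF z(2)]
          PiE_mem[OF x(3)] PiE_mem[OF y(3)] PiE_mem[OF z(3)] H.m_assoc cong: restrict_cong)
  next
    fix x assume x: "x \<in> carrier (perm_wreath T H)"
    then obtain s f where x: "x = (s, f)" "s \<in> T \<rightarrow>\<^sub>E T" "f \<in> T \<rightarrow>\<^sub>E carrier H"
      by (auto simp: perm_wreath_def)
    have "(\<lambda>t\<in>T. s t) = s" "(\<lambda>t\<in>T. f t) = f"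
      using x by (auto intro: PiE_restrict)
    then show "\<one>\<^bsub>perm_wreath T H\<^esub> \<otimes>\<^bsub>perm_wreath T H\<^esub> x = x"
      unfolding x(1) by (simp add: perm_wreath_def PiE_mem[OF x(2)] PiE_mem[OF x(3)] cong: restrict_cong)
  next
    fix x y assume "x \<in> carrier (perm_wreath T H)" "y \<in> carrier (perm_wreath T H)"
    then obtain s1 f1 s2 f2 where
      x: "x = (s1, f1)" "s1 \<in> T \<rightarrow>\<^sub>E T" "f1 \<in> T \<rightarrow>\<^sub>E carrier H" "bij_betw s1 T T" and
      y: "y = (s2, f2)" "s2 \<in> T \<rightarrow>\<^sub>E T" "f2 \<in> T \<rightarrow>\<^sub>E carrier H" "bij_betw s2 T T"
      unfolding perm_wreath_def by auto
    show "x \<otimes>\<^bsub>perm_wreath T H\<^esub> y \<in> carrier (perm_wreath T H)"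
      unfolding x(1) y(1)
      by (simp add: perm_wreath_def bij[OF x(4) y(4), simplified] PiE_mem[OF x(2)] PiE_mem[OF y(2)]
          PiE_mem[OF x(3)] PiE_mem[OF y(3)])
  next
    have "bij_betw (\<lambda>t\<in>T. t) T T" by (simp add: bij_betw_def inj_on_def)
    then show "\<one>\<^bsub>perm_wreath T H\<^esub> \<in> carrier (perm_wreath T H)"
      by (simp add: perm_wreath_def)
  qed
qed

lemma finite_perm_wreath:
  assumes "finite T" "finite (carrier H)"
  shows "finite (carrier (perm_wreath T H))"
proof -
  have "carrier (perm_wreath T H) \<subseteq> (T \<rightarrow>\<^sub>E T) \<times> (T \<rightarrow>\<^sub>E carrier H)"
    by (simp add: perm_wreath_def Sigma_mono)
  moreover have "finite (T \<rightarrow>\<^sub>E T)" "finite (T \<rightarrow>\<^sub>E carrier H)"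
    using assms by (simp_all add: finite_PiE)
  ultimately show ?thesis by (metis finite_cartesian_product finite_subset)
qed

section \<open>Cocycles on coset spaces\<close>

text \<open>The identity says that \<open>x \<mapsto> (action of x, c _ x)\<close> is multiplicative
  into the wreath product over the coset space, see \<open>cocycle_hom\<close>. At the base point
  \<open>t = E\<close>, which \<open>E\<close> fixes, it becomes the homomorphism law, so a cocycle
  induces a homomorphism on \<open>E\<close>.\<close>

definition cocycle :: "('a, 'm) monoid_scheme \<Rightarrow> 'a set \<Rightarrow> ('b, 'n) monoid_scheme \<Rightarrow> ('a set \<Rightarrow> 'a \<Rightarrow> 'b) \<Rightarrow> bool"
  where "cocycle G E H c \<longleftrightarrow>
    (\<forall>t\<in>rcosets\<^bsub>G\<^esub> E. \<forall>x\<in>carrier G. c t x \<in> carrier H) \<and>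
    (\<forall>t\<in>rcosets\<^bsub>G\<^esub> E. \<forall>x\<in>carrier G. \<forall>y\<in>carrier G.
       c t (x \<otimes>\<^bsub>G\<^esub> y) = c t x \<otimes>\<^bsub>H\<^esub> c (t #>\<^bsub>G\<^esub> x) y)"

definition ccocycle :: "('a, 'm) monoid_scheme \<Rightarrow> (nat \<Rightarrow> 'a set) \<Rightarrow> 'a set \<Rightarrow> ('b, 'n) monoid_scheme \<Rightarrow> ('a set \<Rightarrow> 'a \<Rightarrow> 'b) \<Rightarrow> bool"
  where "ccocycle G U E H c \<longleftrightarrow>
    cocycle G E H c \<and> (\<exists>k. \<forall>x\<in>U k. \<forall>t\<in>rcosets\<^bsub>G\<^esub> E. c t x = \<one>\<^bsub>H\<^esub>)"

lemma ccocycle_cocycle: "ccocycle G U E H c \<Longrightarrow> cocycle G E H c"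
  by (simp add: ccocycle_def)

lemma cocycle_closed:
  "cocycle G E H c \<Longrightarrow> t \<in> rcosets\<^bsub>G\<^esub> E \<Longrightarrow> x \<in> carrier G \<Longrightarrow> c t x \<in> carrier H"
  by (simp add: cocycle_def)

lemma cocycle_mult:
  "cocycle G E H c \<Longrightarrow> t \<in> rcosets\<^bsub>G\<^esub> E \<Longrightarrow> x \<in> carrier G \<Longrightarrow> y \<in> carrier G \<Longrightarrow>
    c t (x \<otimes>\<^bsub>G\<^esub> y) = c t x \<otimes>\<^bsub>H\<^esub> c (t #>\<^bsub>G\<^esub> x) y"
  by (simp add: cocycle_def)

section \<open>The action of a group on right cosets\<close>

context group
begin

lemma rcosets_act:
  assumes "subgroup E G" "t \<in> rcosets E" "x \<in> carrier G"
  shows "t #> x \<in> rcosets E"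
proof -
  obtain a where a: "a \<in> carrier G" "t = E #> a" using assms(2) by (auto simp: RCOSETS_def)
  then have "t #> x = E #> (a \<otimes> x)"
    using assms by (simp add: coset_mult_assoc subgroup.subset)
  with a assms show ?thesis by (simp add: rcosetsI subgroup.subset)
qed

lemma rcosets_act_assoc:
  assumes "subgroup E G" "t \<in> rcosets E" "x \<in> carrier G" "y \<in> carrier G"
  shows "t #> x #> y = t #> (x \<otimes> y)"
  using coset_mult_assoc[OF subgroup.rcosets_carrier[OF assms(1) is_group assms(2)]] assms by blast

lemma rcosets_act_one:
  assumes "subgroup E G" "t \<in> rcosets E"
  shows "t #> \<one> = t"
  by (rule coset_mult_one[OF subgroup.rcosets_carrier[OF assms(1) is_group assms(2)]])

lemma rcosets_act_inv:
  assumes "subgroup E G" "t \<in> rcosets E" "x \<in> carrier G"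
  shows "t #> x #> inv x = t" "t #> inv x #> x = t"
  using assms by (simp_all add: rcosets_act_assoc rcosets_act_one)

lemma rcosets_mem_eq:
  assumes "subgroup E G" "t \<in> rcosets E" "x \<in> t"
  shows "t = E #> x" "x \<in> carrier G"
proof -
  show x: "x \<in> carrier G"
    using subgroup.rcosets_carrier[OF assms(1) is_group assms(2)] assms(3) by blast
  obtain a where a: "a \<in> carrier G" "t = E #> a" using assms(2) by (auto simp: RCOSETS_def)
  then show "t = E #> x" using repr_independence[of x E a] assms by simp
qed

lemma rcos_eq_iff:
  assumes "subgroup E G" "x \<in> carrier G" "y \<in> carrier G"
  shows "E #> x = E #> y \<longleftrightarrow> x \<otimes> inv y \<in> E"
  by (metis assms repr_independence rcos_self subgroup.rcos_module is_group)

lemma rcosets_act_bij: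
  assumes "subgroup E G" "x \<in> carrier G"
  shows "bij_betw (\<lambda>t. t #> x) (rcosets E) (rcosets E)"
  by (rule bij_betwI[where g = "\<lambda>t. t #> inv x"])
    (use assms in \<open>auto simp: rcosets_act rcosets_act_inv\<close>)

lemma rcosets_self: "subgroup E G \<Longrightarrow> E \<in> rcosets E"
  by (simp add: subgroup.subgroup_in_rcosets is_group)

text \<open>Conjugation by a representative \<open>a\<close> of \<open>t\<close> keeps
  \<open>u\<close> in \<open>N\<close>, hence in \<open>E\<close>, so
  \<open>E a u = E a\<close>.\<close>

lemma normal_act_trivial:
  assumes "N \<lhd> G" "N \<subseteq> E" "subgroup E G" "t \<in> rcosets E" "u \<in> N"
  shows "t #> u = t"
proof -
  obtain a where a: "a \<in> carrier G" "t = E #> a" using assms(4) by (auto simp: RCOSETS_def)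
  have u: "u \<in> carrier G" using normal_imp_subgroup[OF assms(1)] assms(5) by (rule subgroup.mem_carrier)
  have "a \<otimes> u \<otimes> inv a \<in> E"
    using normal.inv_op_closed2[OF assms(1) a(1) assms(5)] assms(2) by blast
  then show ?thesis
    using a u assms(3) by (simp add: coset_mult_assoc subgroup.subset rcos_eq_iff)
qed

lemma cocycle_hom:
  assumes E: "subgroup E G" and c: "cocycle G E H c"
  shows "(\<lambda>x. (\<lambda>t\<in>rcosets E. t #> x, \<lambda>t\<in>rcosets E. c t x)) \<in> hom G (perm_wreath (rcosets E) H)"
proof (rule homI)
  fix x assume x: "x \<in> carrier G"
  then show "(\<lambda>t\<in>rcosets E. t #> x, \<lambda>t\<in>rcosets E. c t x) \<in> carrier (perm_wreath (rcosets E) H)"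
    using rcosets_act_bij[OF E x] E c by (auto simp: perm_wreath_def cocycle_def rcosets_act)
next
  fix x y assume "x \<in> carrier G" "y \<in> carrier G"
  then show "(\<lambda>t\<in>rcosets E. t #> (x \<otimes> y), \<lambda>t\<in>rcosets E. c t (x \<otimes> y)) =
    (\<lambda>t\<in>rcosets E. t #> x, \<lambda>t\<in>rcosets E. c t x) \<otimes>\<^bsub>perm_wreath (rcosets E) H\<^esub>
    (\<lambda>t\<in>rcosets E. t #> y, \<lambda>t\<in>rcosets E. c t y)"
    using c E by (simp add: perm_wreath_def cocycle_def rcosets_act rcosets_act_assoc cong: restrict_cong)
qed

lemma cocycle_one:
  assumes "subgroup E G" "cocycle G E H c" "group H" "t \<in> rcosets E"
  shows "c t \<one> = \<one>\<^bsub>H\<^esub>"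
proof -
  interpret H: group H by fact
  have "c t (\<one> \<otimes> \<one>) = c t \<one> \<otimes>\<^bsub>H\<^esub> c (t #> \<one>) \<one>"
    by (rule cocycle_mult[OF assms(2,4) one_closed one_closed])
  moreover have "c t \<one> \<in> carrier H" by (rule cocycle_closed[OF assms(2,4) one_closed])
  ultimately show ?thesis using rcosets_act_one[OF assms(1,4)] by simp
qed

lemma cocycle_stabilizer_hom:
  assumes E: "subgroup E G" and c: "cocycle G E H c"
  shows "c E \<in> hom (G\<lparr>carrier := E\<rparr>) H"
proof (rule homI)
  fix x assume "x \<in> carrier (G\<lparr>carrier := E\<rparr>)"
  then have "x \<in> carrier G" using subgroup.mem_carrier[OF E] by simp
  then show "c E x \<in> carrier H"
    by (rule cocycle_closed[OF c rcosets_self[OF E]])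
next
  fix x y assume "x \<in> carrier (G\<lparr>carrier := E\<rparr>)" "y \<in> carrier (G\<lparr>carrier := E\<rparr>)"
  then have xy: "x \<in> E" "x \<in> carrier G" "y \<in> carrier G"
    using subgroup.mem_carrier[OF E] by simp_all
  show "c E (x \<otimes>\<^bsub>G\<lparr>carrier := E\<rparr>\<^esub> y) = c E x \<otimes>\<^bsub>H\<^esub> c E y"
    using cocycle_mult[OF c rcosets_self[OF E] xy(2,3)] coset_join2[OF xy(2) E xy(1)] by simp
qed

end

context chain_group
begin

text \<open>A coset of \<open>E\<close> is recovered from any point of any coset of
  \<open>U i\<close> inside it, so there are at most as many as cosets of
  \<open>U i\<close>.\<close>

lemma finite_rcosets:
  assumes "subgroup E G" "U i \<subseteq> E"
  shows "finite (rcosets E)"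
proof -
  have "rcosets E \<subseteq> (\<lambda>t. E #> (SOME x. x \<in> t)) ` (rcosets U i)"
  proof
    fix t assume "t \<in> rcosets E"
    then obtain a where a: "a \<in> carrier G" "t = E #> a" by (auto simp: RCOSETS_def)
    have "a \<in> U i #> a" using rcos_self[OF a(1) U_subgroup] .
    then have "(SOME x. x \<in> U i #> a) \<in> U i #> a" by (rule someI)
    then obtain u where u: "u \<in> U i" "(SOME x. x \<in> U i #> a) = u \<otimes> a" by (auto simp: r_coset_def)
    have "E #> (u \<otimes> a) = E #> u #> a"
      using u a assms by (simp add: coset_mult_assoc subgroup.subset U_carrier)
    also have "\<dots> = E #> a"
      using u assms by (simp add: coset_join2 U_carrier subsetD)
    finally have "t = E #> (SOME x. x \<in> U i #> a)" using u a by simp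
    moreover have "U i #> a \<in> rcosets U i" using a by (simp add: rcosetsI subgroup.subset[OF U_subgroup])
    ultimately show "t \<in> (\<lambda>t. E #> (SOME x. x \<in> t)) ` (rcosets U i)" by blast
  qed
  then show ?thesis using finite_rcosets_U finite_surj by blast
qed

lemma U_act_trivial:
  assumes "subgroup E G" "U i \<subseteq> E" "i \<le> j" "t \<in> rcosets E" "u \<in> U j"
  shows "t #> u = t"
  using normal_act_trivial[OF U_normal _ assms(1,4,5)] U_anti[OF assms(3)] assms(2) by blast

lemma ccocycle_chom:
  assumes E: "subgroup E G" "U i \<subseteq> E" and c: "ccocycle G U E H c"
  shows "(\<lambda>x. (\<lambda>t\<in>rcosets E. t #> x, \<lambda>t\<in>rcosets E. c t x)) \<in> chom G U (perm_wreath (rcosets E) H)"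
proof -
  obtain k where k: "\<And>x t. x \<in> U k \<Longrightarrow> t \<in> rcosets E \<Longrightarrow> c t x = \<one>\<^bsub>H\<^esub>"
    using c by (auto simp: ccocycle_def)
  have "(\<lambda>t\<in>rcosets E. t #> x, \<lambda>t\<in>rcosets E. c t x) = \<one>\<^bsub>perm_wreath (rcosets E) H\<^esub>"
    if "x \<in> U (max i k)" for x
    using that k subsetD[OF U_anti[of k "max i k"]] U_act_trivial[OF E, of "max i k" _ x]
    by (simp add: perm_wreath_def cong: restrict_cong)
  with cocycle_hom[OF E(1) ccocycle_cocycle[OF c]] show ?thesis
    unfolding chom_def by blast
qed

text \<open>Both cocycles are continuous homomorphisms into the wreath product with the same
  permutation part, so agreement on a dense set propagates.\<close>

lemma cocycle_eqI:
  assumes E: "subgroup E G" "U i \<subseteq> E" and "ccocycle G U E H c" "ccocycle G U E H c'" "group H"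
    and "dense_in G U Z" "Z \<subseteq> carrier G"
    and eq: "\<And>t x. t \<in> rcosets E \<Longrightarrow> x \<in> Z \<Longrightarrow> c t x = c' t x"
    and "t \<in> rcosets E" "x \<in> carrier G"
  shows "c t x = c' t x"
proof -
  have "(\<lambda>x. (\<lambda>t\<in>rcosets E. t #> x, \<lambda>t\<in>rcosets E. c t x)) x
      = (\<lambda>x. (\<lambda>t\<in>rcosets E. t #> x, \<lambda>t\<in>rcosets E. c' t x)) x"
    by (rule chom_eqI[OF ccocycle_chom[OF E assms(3)] ccocycle_chom[OF E assms(4)]
          group_perm_wreath[OF \<open>group H\<close>] assms(6,7) _ assms(10)])
      (simp add: eq cong: restrict_cong)
  then show ?thesis using assms(9) by (metis (no_types, lifting) Pair_inject restrict_apply')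
qed

text \<open>Freeness gives a homomorphism into the wreath product with the prescribed images of the
  generators, and its label part is the cocycle. The point to prove is that its permutation part is
  the coset action at every element, not only at the generators.\<close>

lemma cocycle_exists:
  fixes H :: "('h, 'n) monoid_scheme"
  assumes E: "subgroup E G" "U i \<subseteq> E" and H: "group H" "finite (carrier H)"
    and free: "free_on G U I z" and I: "finite I"
    and w: "\<And>i t. i \<in> I \<Longrightarrow> t \<in> rcosets E \<Longrightarrow> w i t \<in> carrier H"
  obtains c where "ccocycle G U E H c" "\<And>i t. i \<in> I \<Longrightarrow> t \<in> rcosets E \<Longrightarrow> c t (z i) = w i t"
proof -
  let ?T = "rcosets E"
  let ?W = "perm_wreath ?T H"
  let ?act = "\<lambda>x. \<lambda>t\<in>?T. t #> x"
  interpret H: group H by fact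
  have z: "z i \<in> carrier G" if "i \<in> I" for i using free_on_carrier[OF free that] .
  have W: "group ?W" "finite (carrier ?W)"
    using group_perm_wreath[OF H(1)] finite_perm_wreath[OF finite_rcosets[OF E] H(2)] .
  let ?q = "\<lambda>i. (?act (z i), \<lambda>t\<in>?T. w i t)"
  have "?q i \<in> carrier ?W" if i: "i \<in> I" for i
    using rcosets_act_bij[OF E(1) z[OF i]] w[OF i] z[OF i] E
    by (auto simp: perm_wreath_def rcosets_act)
  then have "?q ` I \<subseteq> carrier ?W" by blast
  moreover have "finite {i \<in> I. ?q i \<noteq> \<one>\<^bsub>?W\<^esub>}" using I by simp
  ultimately obtain f where f: "f \<in> chom G U ?W" "\<And>i. i \<in> I \<Longrightarrow> f (z i) = ?q i"
    using free_on_chom[OF free is_group W] by blast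
  interpret f: group_hom G ?W f
    using chom_hom[OF f(1)] W by (simp add: group_homI)
  \<comment> \<open>Erasing the labels is an endomorphism of the wreath product. Its composite with
    \<open>f\<close> and the homomorphism of the trivial cocycle agree on the generators, hence
    everywhere, which identifies the permutation part of \<open>f\<close>.\<close>
  let ?r = "\<lambda>x. (fst x, \<lambda>t\<in>?T. \<one>\<^bsub>H\<^esub>)"
  have r: "?r \<in> hom ?W ?W"
  proof (rule homI)
    fix x y assume "x \<in> carrier ?W" "y \<in> carrier ?W"
    then have "fst x t \<in> ?T" if "t \<in> ?T" for t using that by (auto simp: perm_wreath_def)
    then show "?r (x \<otimes>\<^bsub>?W\<^esub> y) = ?r x \<otimes>\<^bsub>?W\<^esub> ?r y"
      by (simp add: perm_wreath_def split_beta cong: restrict_cong)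
  qed (auto simp: perm_wreath_def)
  have r1: "(\<lambda>x. ?r (f x)) \<in> chom G U ?W"
    by (rule chom_compose[OF f(1) r W(1) W(1)])
  have triv: "ccocycle G U E H (\<lambda>_ _. \<one>\<^bsub>H\<^esub>)" by (simp add: ccocycle_def cocycle_def)
  have fst_f: "fst (f x) = ?act x" if "x \<in> carrier G" for x
  proof -
    have "(\<lambda>x. ?r (f x)) x = (\<lambda>x. (?act x, \<lambda>t\<in>?T. \<one>\<^bsub>H\<^esub>)) x"
      by (rule chom_eqI[OF r1 ccocycle_chom[OF E triv] W(1) free_on_dense[OF free] _ _ that])
        (use f(2) z in auto)
    then show ?thesis by simp
  qed
  define c where "c t x = snd (f x) t" for t x
  have "c t (x \<otimes> y) = c t x \<otimes>\<^bsub>H\<^esub> c (t #> x) y" if "t \<in> ?T" "x \<in> carrier G" "y \<in> carrier G" for t x y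
    using that fst_f[OF that(2)] f.hom_mult[OF that(2,3)]
    by (simp add: c_def perm_wreath_def split_beta)
  moreover have "c t x \<in> carrier H" if "t \<in> ?T" "x \<in> carrier G" for t x
    using f.hom_closed[OF that(2)] that(1) by (auto simp: c_def perm_wreath_def PiE_mem)
  ultimately have "cocycle G E H c" unfolding cocycle_def by blast
  moreover obtain k where "\<forall>x\<in>U k. f x = \<one>\<^bsub>?W\<^esub>" using f(1) by (auto simp: chom_def)
  then have "\<forall>x\<in>U k. \<forall>t\<in>?T. c t x = \<one>\<^bsub>H\<^esub>" by (simp add: c_def perm_wreath_def)
  ultimately have "ccocycle G U E H c" unfolding ccocycle_def by blast
  moreover have "c t (z i) = w i t" if "i \<in> I" "t \<in> ?T" for i t
    using f(2)[OF that(1)] that(2) by (simp add: c_def)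
  ultimately show ?thesis using that by blast
qed

end

section \<open>The Nielsen--Schreier theorem\<close>

lemma (in group) r_coset_Int_subgroup:
  assumes "subgroup S G" "N \<subseteq> carrier G" "a \<in> S"
  shows "(N #> a) \<inter> S = (N \<inter> S) #> a"
proof -
  have a: "a \<in> carrier G" using assms(1,3) by (rule subgroup.mem_carrier)
  have "x \<in> S" if "x \<in> N" "x \<otimes> a \<in> S" for x
  proof -
    have x: "x \<in> carrier G" using that(1) assms(2) by auto
    have "(x \<otimes> a) \<otimes> inv a \<in> S"
      using subgroup.m_closed[OF assms(1) that(2) subgroup.m_inv_closed[OF assms(1,3)]] .
    moreover have "(x \<otimes> a) \<otimes> inv a = x" using x a by (simp add: m_assoc)
    ultimately show ?thesis by simp
  qed
  then show ?thesis
    using subgroup.m_closed[OF assms(1) _ assms(3)] by (auto simp: r_coset_def)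
qed

context chain_group
begin

lemma chain_group_subgroup:
  assumes S: "subgroup S G"
  shows "chain_group (G\<lparr>carrier := S\<rparr>) (\<lambda>i. U i \<inter> S)"
proof -
  have "U i \<inter> S \<lhd> G\<lparr>carrier := S\<rparr>" for i
  proof -
    have "second_isomorphism_grp (U i) G S"
      unfolding second_isomorphism_grp_def second_isomorphism_grp_axioms_def
      using U_normal S by simp
    from second_isomorphism_grp.normal_subgrp_intersection_normal[OF this]
    show ?thesis by (simp add: Int_commute)
  qed
  moreover have "finite (rcosets\<^bsub>G\<lparr>carrier := S\<rparr>\<^esub> (U i \<inter> S))" for i
  proof -
    have "rcosets\<^bsub>G\<lparr>carrier := S\<rparr>\<^esub> (U i \<inter> S) \<subseteq> (\<lambda>T. T \<inter> S) ` (rcosets U i)"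
    proof
      fix t assume "t \<in> rcosets\<^bsub>G\<lparr>carrier := S\<rparr>\<^esub> (U i \<inter> S)"
      then obtain a where a: "a \<in> S" "t = (U i \<inter> S) #> a" by (auto simp: RCOSETS_def)
      have "t = (U i #> a) \<inter> S"
        using r_coset_Int_subgroup[OF S subgroup.subset[OF U_subgroup] a(1)] a(2) by simp
      moreover have "U i #> a \<in> rcosets U i"
        by (rule rcosetsI[OF subgroup.subset[OF U_subgroup] subgroup.mem_carrier[OF S a(1)]])
      ultimately show "t \<in> (\<lambda>T. T \<inter> S) ` (rcosets U i)" by simp
    qed
    then show ?thesis using finite_rcosets_U by (meson finite_imageI finite_subset)
  qed
  moreover have "U (Suc i) \<inter> S \<subseteq> U i \<inter> S" for i using U_Suc[of i] by auto
  ultimately show ?thesis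
    unfolding chain_group_def chain_group_axioms_def
    using subgroup.subgroup_is_group[OF S is_group] by simp
qed

text \<open>The setwise stabiliser of \<open>J\<close> is a subgroup: as \<open>J\<close> is finite,
  mapping it into itself means permuting it, which gives inverses. It contains \<open>U i\<close>
  and \<open>Z\<close>, so by density it is the whole group, and \<open>S\<close> reaches every
  coset.\<close>

lemma generators_transitive:
  assumes S: "subgroup S G" "U i \<subseteq> S" and dense: "dense_in G U Z" "Z \<subseteq> carrier G"
    and J: "J \<subseteq> rcosets S" "S \<in> J" "\<And>t x. t \<in> J \<Longrightarrow> x \<in> Z \<Longrightarrow> t #> x \<in> J"
  shows "J = rcosets S"
proof -
  let ?St = "{x \<in> carrier G. \<forall>t\<in>J. t #> x \<in> J}"
  have finJ: "finite J" using J(1) finite_rcosets[OF S] finite_subset by blast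
  have "subgroup ?St G"
  proof (rule subgroupI)
    have "\<one> \<in> ?St" using rcosets_act_one[OF S(1) subsetD[OF J(1)]] by simp
    then show "?St \<noteq> {}" by blast
  next
    fix x assume x: "x \<in> ?St"
    have inj: "inj_on (\<lambda>t. t #> x) J"
      by (rule inj_on_subset[OF bij_betw_imp_inj_on[OF rcosets_act_bij[OF S(1)]] J(1)]) (use x in simp)
    have "(\<lambda>t. t #> x) ` J \<subseteq> J" using x by auto
    then have img: "(\<lambda>t. t #> x) ` J = J"
      using card_subset_eq[OF finJ] card_image[OF inj] by simp
    have "t #> inv x \<in> J" if "t \<in> J" for t
    proof -
      have "t \<in> (\<lambda>t. t #> x) ` J" using img that by simp
      then obtain s where s: "s \<in> J" "t = s #> x" by blast
      have "s \<in> rcosets S" using s(1) J(1) by (rule subsetD[rotated])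
      from rcosets_act_inv(1)[OF S(1) this, of x] show ?thesis using s x by simp
    qed
    with x show "inv x \<in> ?St" by simp
  next
    fix x y assume "x \<in> ?St" "y \<in> ?St"
    then have xy: "x \<in> carrier G" "y \<in> carrier G" "\<And>t. t \<in> J \<Longrightarrow> t #> x \<in> J" "\<And>t. t \<in> J \<Longrightarrow> t #> y \<in> J"
      by auto
    have "t #> (x \<otimes> y) \<in> J" if "t \<in> J" for t
      using rcosets_act_assoc[OF S(1) subsetD[OF J(1) that] xy(1,2)] xy(4)[OF xy(3)[OF that]] by simp
    then show "x \<otimes> y \<in> ?St" using xy(1,2) by simp
  qed auto
  moreover have "U i \<subseteq> ?St"
  proof
    fix u assume u: "u \<in> U i"
    then have "t #> u = t" if "t \<in> J" for t
      by (rule U_act_trivial[OF S order_refl subsetD[OF J(1) that]])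
    then show "u \<in> ?St" using U_carrier[OF u] by simp
  qed
  moreover have "Z \<subseteq> ?St" using J(3) dense(2) by auto
  ultimately have "carrier G \<subseteq> ?St" using dense(1) unfolding dense_in_def by blast
  then have "S #> x \<in> J" if "x \<in> carrier G" for x using that J(2) by auto
  with J(1) show ?thesis by (auto simp: RCOSETS_def)
qed

text \<open>A spanning tree of the Schreier graph with root \<open>S\<close> is grown edge by edge;
  by \<open>generators_transitive\<close> some edge leaves every proper vertex set. The last
  conclusion is induction along the tree, the form in which its connectedness is used.\<close>

lemma schreier_tree:
  assumes S: "subgroup S G" "U i \<subseteq> S" and dense: "dense_in G U (z ` I)" "z ` I \<subseteq> carrier G"
    and I: "finite I"
  obtains y tree where "\<And>t. t \<in> rcosets S \<Longrightarrow> y t \<in> t" "y S = \<one>"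
    "tree \<subseteq> (rcosets S) \<times> I" "Suc (card tree) = card (rcosets S)"
    "\<And>t i. (t, i) \<in> tree \<Longrightarrow> y (t #> z i) = y t \<otimes> z i"
    "\<forall>Q. Q S \<longrightarrow> (\<forall>(t, i)\<in>tree. Q t \<longrightarrow> Q (t #> z i)) \<longrightarrow> (\<forall>t\<in>rcosets S. Q t)"
proof -
  let ?T = "rcosets S"
  have fin: "finite ?T" by (rule finite_rcosets[OF S])
  have ind: "k < card ?T \<Longrightarrow> \<exists>y J tree. J \<subseteq> ?T \<and> card J = Suc k \<and> S \<in> J \<and> (\<forall>t\<in>J. y t \<in> t) \<and> y S = \<one> \<and>
      tree \<subseteq> J \<times> I \<and> card tree = k \<and> (\<forall>(t, i)\<in>tree. t #> z i \<in> J \<and> y (t #> z i) = y t \<otimes> z i) \<and>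
      (\<forall>Q. Q S \<longrightarrow> (\<forall>(t, i)\<in>tree. Q t \<longrightarrow> Q (t #> z i)) \<longrightarrow> (\<forall>t\<in>J. Q t))" for k
  proof (induction k)
    case 0
    then show ?case
      using rcosets_self[OF S(1)] subgroup.one_closed[OF S(1)]
      by (intro exI[of _ "\<lambda>_. \<one>"] exI[of _ "{S}"] exI[of _ "{}"]) simp
  next
    case (Suc k)
    then obtain y J tree where IH: "J \<subseteq> ?T" "card J = Suc k" "S \<in> J" "\<forall>t\<in>J. y t \<in> t" "y S = \<one>"
      "tree \<subseteq> J \<times> I" "card tree = k" "\<forall>(t, i)\<in>tree. t #> z i \<in> J \<and> y (t #> z i) = y t \<otimes> z i"
      "\<And>Q. Q S \<Longrightarrow> \<forall>(t, i)\<in>tree. Q t \<longrightarrow> Q (t #> z i) \<Longrightarrow> \<forall>t\<in>J. Q t"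
      by (auto dest: Suc_lessD)
    have "J \<noteq> ?T" using IH(2) Suc.prems by auto
    then obtain t i where ti: "t \<in> J" "i \<in> I" "t #> z i \<notin> J"
      using generators_transitive[OF S dense IH(1,3)] by auto
    have tT: "t \<in> ?T" and zi: "z i \<in> carrier G" using ti IH(1) dense(2) by auto
    let ?u = "t #> z i"
    let ?y = "y(?u := y t \<otimes> z i)"
    have u: "?u \<in> ?T" by (rule rcosets_act[OF S(1) tT zi])
    have new: "(t, i) \<notin> tree" using IH(8) ti(3) by auto
    have "finite (J \<times> I)" using IH(1) fin I by (auto intro: finite_subset)
    then have fin_tree: "finite tree" using IH(6) finite_subset by blast
    have u_fresh: "s \<noteq> ?u" if "s \<in> J" for s using that ti(3) by auto
    show ?case
    proof (intro exI conjI)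
      show "insert ?u J \<subseteq> ?T" using IH(1) u by simp
      show "card (insert ?u J) = Suc (Suc k)"
        using IH(2) ti(3) finite_subset[OF IH(1) fin] by simp
      show "S \<in> insert ?u J" using IH(3) by simp
      show "?y S = \<one>" using IH(5) u_fresh[OF IH(3)] by simp
      have "y t \<in> t" using IH(4) ti(1) by blast
      then have "y t \<otimes> z i \<in> ?u" by (auto simp: r_coset_def)
      then show "\<forall>s\<in>insert ?u J. ?y s \<in> s" using IH(4) by simp
      show "insert (t, i) tree \<subseteq> insert ?u J \<times> I" using IH(6) ti by auto
      show "card (insert (t, i) tree) = Suc k" using IH(7) new fin_tree by simp
      show "\<forall>(s, j)\<in>insert (t, i) tree. s #> z j \<in> insert ?u J \<and> ?y (s #> z j) = ?y s \<otimes> z j"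
        using IH(8,6) u_fresh ti by (auto split: prod.splits)
      show "\<forall>Q. Q S \<longrightarrow> (\<forall>(s, j)\<in>insert (t, i) tree. Q s \<longrightarrow> Q (s #> z j)) \<longrightarrow> (\<forall>s\<in>insert ?u J. Q s)"
      proof (intro allI impI)
        fix Q assume Q: "Q S" "\<forall>(s, j)\<in>insert (t, i) tree. Q s \<longrightarrow> Q (s #> z j)"
        then have QJ: "\<forall>s\<in>J. Q s" by (intro IH(9)) auto
        moreover have "Q ?u" using Q(2) QJ ti(1) by auto
        ultimately show "\<forall>s\<in>insert ?u J. Q s" by simp
      qed
    qed
  qed
  have "card ?T > 0" using fin rcosets_self[OF S(1)] by (auto simp: card_gt_0_iff)
  then obtain n where n: "card ?T = Suc n" by (metis gr0_conv_Suc)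
  then have n_less: "n < card ?T" by simp
  obtain y J tree where *: "J \<subseteq> ?T \<and> card J = Suc n \<and> S \<in> J \<and> (\<forall>t\<in>J. y t \<in> t) \<and> y S = \<one> \<and>
      tree \<subseteq> J \<times> I \<and> card tree = n \<and> (\<forall>(t, i)\<in>tree. t #> z i \<in> J \<and> y (t #> z i) = y t \<otimes> z i) \<and>
      (\<forall>Q. Q S \<longrightarrow> (\<forall>(t, i)\<in>tree. Q t \<longrightarrow> Q (t #> z i)) \<longrightarrow> (\<forall>t\<in>J. Q t))"
    using ind[OF n_less] by (elim exE) (rule that)
  have J: "J = ?T" using * n fin by (simp add: card_subset_eq)
  have Q: "\<forall>Q. Q S \<longrightarrow> (\<forall>(t, i)\<in>tree. Q t \<longrightarrow> Q (t #> z i)) \<longrightarrow> (\<forall>t\<in>rcosets S. Q t)"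
    unfolding J[symmetric] using * by (elim conjE)
  show ?thesis
  proof (rule that[of y tree])
    show "y t \<in> t" if "t \<in> ?T" for t using * J that by simp
    show "y (t #> z i) = y t \<otimes> z i" if "(t, i) \<in> tree" for t i using * that by auto
    show "Suc (card tree) = card ?T" using * n by simp
    show "tree \<subseteq> ?T \<times> I" using * J by simp
    show "y S = \<one>" using * by simp
  qed (fact Q)
qed

text \<open>The basis is indexed by the edges outside a spanning tree: out along the tree, across
  the edge, and back along the tree. A tree has one edge fewer than vertices, whence the rank,
  stated additively to avoid truncated subtraction.\<close>

lemma nielsen_schreier:
  fixes z :: "'i \<Rightarrow> 'a"
  assumes S: "subgroup S G" "U i \<subseteq> S" and free: "free_on G U I z" and I: "finite I"
  obtains I' :: "('a set \<times> 'i) set" and z' where "free_on (G\<lparr>carrier := S\<rparr>) (\<lambda>i. U i \<inter> S) I' z'"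
    "finite I'" "card I' + card (rcosets S) = card (rcosets S) * card I + 1"
proof -
  let ?T = "rcosets S"
  let ?GS = "G\<lparr>carrier := S\<rparr>" and ?US = "\<lambda>i. U i \<inter> S"
  have fin: "finite ?T" by (rule finite_rcosets[OF S])
  have z: "z i \<in> carrier G" if "i \<in> I" for i by (rule free_on_carrier[OF free that])
  then have zI: "z ` I \<subseteq> carrier G" by blast
  obtain y tree where y: "\<And>t. t \<in> ?T \<Longrightarrow> y t \<in> t" "y S = \<one>"
    and tree: "tree \<subseteq> ?T \<times> I" "Suc (card tree) = card ?T"
      "\<And>t i. (t, i) \<in> tree \<Longrightarrow> y (t #> z i) = y t \<otimes> z i"
    and tree_ind: "\<forall>Q. Q S \<longrightarrow> (\<forall>(t, i)\<in>tree. Q t \<longrightarrow> Q (t #> z i)) \<longrightarrow> (\<forall>t\<in>rcosets S. Q t)"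
    by (rule schreier_tree[OF S free_on_dense[OF free] zI I]) (rule that; assumption)
  have tree_induct: "Q t" if "Q S" "\<And>t i. (t, i) \<in> tree \<Longrightarrow> Q t \<Longrightarrow> Q (t #> z i)" "t \<in> ?T" for Q t
    using spec[OF tree_ind, of Q] that by auto
  have yc: "y t \<in> carrier G" "S #> y t = t" if "t \<in> ?T" for t
    using rcosets_mem_eq[OF S(1) that y(1)[OF that]] by auto
  define I' where "I' = ?T \<times> I - tree"
  define z' where "z' = (\<lambda>(t, i). y t \<otimes> z i \<otimes> inv y (t #> z i))"
  have act: "t #> z i \<in> ?T" if "t \<in> ?T" "i \<in> I" for t i
    by (rule rcosets_act[OF S(1) that(1) z[OF that(2)]])
  have z'_mem: "z' (t, i) \<in> S" if "t \<in> ?T" "i \<in> I" for t i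
  proof -
    have "S #> (y t \<otimes> z i) = S #> y (t #> z i)"
      using yc(2)[OF act[OF that]] yc[OF that(1)] z[OF that(2)] subgroup.subset[OF S(1)]
      by (simp add: coset_mult_assoc[symmetric])
    then show ?thesis
      using yc(1)[OF that(1)] yc(1)[OF act[OF that]] z[OF that(2)]
      by (simp add: z'_def rcos_eq_iff[OF S(1)])
  qed
  have z'_eq: "y t \<otimes> z i = z' (t, i) \<otimes> y (t #> z i)" if "t \<in> ?T" "i \<in> I" for t i
    using yc(1)[OF that(1)] yc(1)[OF act[OF that]] z[OF that(2)] by (simp add: z'_def m_assoc)
  have finI': "finite I'" using fin I by (simp add: I'_def)
  have card: "card I' + card ?T = card ?T * card I + 1"
  proof -
    have ft: "finite tree" using tree(1) fin I by (meson finite_SigmaI finite_subset)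
    have "card I' = card (?T \<times> I) - card tree"
      unfolding I'_def by (rule card_Diff_subset[OF ft tree(1)])
    moreover have "card tree \<le> card (?T \<times> I)" using fin I tree(1) by (intro card_mono) auto
    ultimately show ?thesis using tree(2) by (simp add: card_cartesian_product)
  qed
  interpret GS: chain_group ?GS ?US by (rule chain_group_subgroup[OF S(1)])
  have dense: "dense_in ?GS ?US (z' ` I')"
    unfolding dense_in_def
  proof (intro allI impI)
    fix j R assume R: "subgroup R ?GS \<and> U j \<inter> S \<subseteq> R \<and> z' ` I' \<subseteq> R"
    have RG: "subgroup R G" using R incl_subgroup[OF S(1)] by blast
    have RS: "R \<subseteq> S" using R subgroup.subset[of R ?GS] by simp
    have UR: "U (max i j) \<subseteq> R"
      using U_anti[of i "max i j"] U_anti[of j "max i j"] S(2) R by auto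
    have RT: "R #> y t \<in> rcosets R" if "t \<in> ?T" for t
      by (rule rcosetsI[OF subgroup.subset[OF RG] yc(1)[OF that]])
    \<comment> \<open>The cosets \<open>R y t\<close> are closed under right multiplication by the
      generators because every \<open>z'\<close> lies in \<open>R\<close>; for tree edges it is 1.
      So they are all the cosets of \<open>R\<close>, and one that contains an element of
      \<open>S\<close> can only belong to \<open>t = S\<close>, which gives
      \<open>S \<subseteq> R\<close>.\<close>
    let ?J = "(\<lambda>t. R #> y t) ` ?T"
    have "?J = rcosets R"
    proof (rule generators_transitive[OF RG UR free_on_dense[OF free] zI])
      show "?J \<subseteq> rcosets R" using RT by blast
      have "R #> y S = R" using y(2) subgroup.subset[OF RG] by simp
      then show "R \<in> ?J" using rcosets_self[OF S(1)] by (metis imageI)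
    next
      fix u x assume "u \<in> ?J" "x \<in> z ` I"
      then obtain t i where ti: "t \<in> ?T" "u = R #> y t" "i \<in> I" "x = z i" by auto
      have "z' (t, i) \<in> R"
      proof (cases "(t, i) \<in> tree")
        case True
        then have "z' (t, i) = \<one>"
          using tree(3) yc(1)[OF ti(1)] z[OF ti(3)] by (simp add: z'_def)
        then show ?thesis using subgroup.one_closed[OF RG] by simp
      next
        case False
        then show ?thesis using ti R by (auto simp: I'_def)
      qed
      then have "R #> (z' (t, i) \<otimes> y (t #> z i)) = R #> y (t #> z i)"
        using coset_mult_assoc[OF subgroup.subset[OF RG], of "z' (t, i)" "y (t #> z i)"]
          coset_join2[OF _ RG] yc(1)[OF act[OF ti(1,3)]] subgroup.mem_carrier[OF RG] by simp
      then have "u #> x = R #> y (t #> z i)"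
        using ti z'_eq[OF ti(1,3)] coset_mult_assoc[OF subgroup.subset[OF RG] yc(1)[OF ti(1)] z[OF ti(3)]]
        by simp
      then show "u #> x \<in> ?J" using act[OF ti(1,3)] by simp
    qed
    show "carrier ?GS \<subseteq> R"
    proof
      fix x assume "x \<in> carrier ?GS"
      then have x: "x \<in> S" "x \<in> carrier G" using subgroup.mem_carrier[OF S(1)] by auto
      have "R #> x \<in> ?J" unfolding \<open>?J = rcosets R\<close>
        by (rule rcosetsI[OF subgroup.subset[OF RG] x(2)])
      then obtain t where t: "t \<in> ?T" "R #> x = R #> y t" by blast
      then have yx: "y t \<otimes> inv x \<in> S" using rcos_eq_iff[OF RG yc(1)[OF t(1)] x(2)] RS by auto
      have "S #> y t = S #> x" using rcos_eq_iff[OF S(1) yc(1)[OF t(1)] x(2)] yx by simp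
      then have "t = S" using yc(2)[OF t(1)] coset_join2[OF x(2) S(1) x(1)] by simp
      then have "R #> x = R" using t(2) y(2) subgroup.subset[OF RG] by simp
      then show "x \<in> R" using coset_join1[OF _ x(2) RG] by simp
    qed
  qed
  have univ: "\<exists>f\<in>chom ?GS ?US H. \<forall>p\<in>I'. f (z' p) = q p"
    if H: "group H" "finite (carrier H)" "q ` I' \<subseteq> carrier H" for H :: "nat monoid" and q
  proof -
    interpret H: group H by fact
    \<comment> \<open>Tree edges get the label 1, so the cocycle is trivial along the tree and its
      value at \<open>z' p\<close> is just the label of the edge \<open>p\<close>.\<close>
    define w where "w i t = (if (t, i) \<in> I' then q (t, i) else \<one>\<^bsub>H\<^esub>)" for i t
    have w: "w i t \<in> carrier H" if "i \<in> I" "t \<in> ?T" for i t using H(3) by (auto simp: w_def)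
    obtain c where c: "ccocycle G U S H c" "\<And>i t. i \<in> I \<Longrightarrow> t \<in> ?T \<Longrightarrow> c t (z i) = w i t"
      using cocycle_exists[OF S H(1,2) free I, of w] w by blast
    note cc = ccocycle_cocycle[OF c(1)]
    have SS: "S \<in> ?T" by (rule rcosets_self[OF S(1)])
    have cy: "c S (y t) = \<one>\<^bsub>H\<^esub>" if "t \<in> ?T" for t
      using that
    proof -
      have "t \<in> ?T \<and> c S (y t) = \<one>\<^bsub>H\<^esub>"
      proof (rule tree_induct[of "\<lambda>t. t \<in> ?T \<and> c S (y t) = \<one>\<^bsub>H\<^esub>"])
        show "S \<in> ?T \<and> c S (y S) = \<one>\<^bsub>H\<^esub>"
          using SS y(2) cocycle_one[OF S(1) cc H(1) SS] by simp
      next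
        fix t i assume ti: "(t, i) \<in> tree" "t \<in> ?T \<and> c S (y t) = \<one>\<^bsub>H\<^esub>"
        then have i: "i \<in> I" using tree(1) by auto
        have "c S (y t \<otimes> z i) = c S (y t) \<otimes>\<^bsub>H\<^esub> c (S #> y t) (z i)"
          by (rule cocycle_mult[OF cc SS yc(1) z[OF i]]) (use ti in simp)
        also have "\<dots> = \<one>\<^bsub>H\<^esub>" using ti i yc(2) c(2)[OF i, of t] by (simp add: I'_def w_def)
        finally show "t #> z i \<in> ?T \<and> c S (y (t #> z i)) = \<one>\<^bsub>H\<^esub>"
          using act ti i tree(3) by simp
      qed fact
      then show ?thesis by simp
    qed
    have "c S (z' p) = q p" if p: "p \<in> I'" for p
    proof -
      obtain t i where ti: "p = (t, i)" "t \<in> ?T" "i \<in> I" using p by (auto simp: I'_def)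
      have "c S (z' p \<otimes> y (t #> z i)) = c S (z' p) \<otimes>\<^bsub>H\<^esub> c (S #> z' p) (y (t #> z i))"
        using ti z'_mem[OF ti(2,3)] subgroup.mem_carrier[OF S(1)] yc(1)[OF act[OF ti(2,3)]]
        by (intro cocycle_mult[OF cc SS]) auto
      also have "S #> z' p = S"
        using ti z'_mem[OF ti(2,3)] subgroup.mem_carrier[OF S(1)] by (simp add: coset_join2[OF _ S(1)])
      also have "c S (y (t #> z i)) = \<one>\<^bsub>H\<^esub>" by (rule cy[OF act[OF ti(2,3)]])
      also have "c S (z' p) \<otimes>\<^bsub>H\<^esub> \<one>\<^bsub>H\<^esub> = c S (z' p)"
        using ti z'_mem[OF ti(2,3)] subgroup.mem_carrier[OF S(1)]
        by (intro H.r_one cocycle_closed[OF cc SS]) auto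
      finally have "c S (z' p) = c S (y t \<otimes> z i)" using ti z'_eq by simp
      also have "\<dots> = c S (y t) \<otimes>\<^bsub>H\<^esub> c (S #> y t) (z i)"
        by (rule cocycle_mult[OF cc SS yc(1)[OF ti(2)] z[OF ti(3)]])
      also have "\<dots> = q p"
        using cy[OF ti(2)] yc(2)[OF ti(2)] c(2)[OF ti(3,2)] p ti(1) w[OF ti(3,2)] by (simp add: w_def)
      finally show ?thesis .
    qed
    moreover have "c S \<in> chom ?GS ?US H"
    proof -
      obtain k where "\<forall>x\<in>U k. \<forall>t\<in>?T. c t x = \<one>\<^bsub>H\<^esub>" using c(1) by (auto simp: ccocycle_def)
      then have "\<forall>x\<in>?US k. c S x = \<one>\<^bsub>H\<^esub>" using SS by blast
      then show ?thesis
        using cocycle_stabilizer_hom[OF S(1) cc] unfolding chom_def by blast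
    qed
    ultimately show ?thesis by blast
  qed
  have "free_on ?GS ?US I' z'"
    unfolding free_on_def using dense univ z'_mem by (auto simp: I'_def)
  with finI' card show ?thesis using that by blast
qed

end

section \<open>Few permutations with few orbits\<close>

text \<open>\<open>P\<close> meets every orbit of the group generated by \<open>S\<close>, and \<open>\<rho>\<close> maps every point to a point of
  \<open>P\<close> in its orbit.\<close>

definition orbit_reps :: "'t set \<Rightarrow> ('t \<Rightarrow> 't) set \<Rightarrow> 't set \<Rightarrow> ('t \<Rightarrow> 't) \<Rightarrow> bool" where
  "orbit_reps T S P \<rho> \<longleftrightarrow> P \<subseteq> T \<and> \<rho> ` T \<subseteq> P \<and>
     (\<forall>X t. X \<subseteq> T \<longrightarrow> (\<forall>s\<in>S. s ` X \<subseteq> X) \<longrightarrow> t \<in> T \<longrightarrow> (t \<in> X \<longleftrightarrow> \<rho> t \<in> X))"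

text \<open>The form in which representatives are applied: the points where two lifts agree form a
  set closed under \<open>S\<close>, so agreement on \<open>P\<close> gives agreement on
  \<open>T\<close>.\<close>

definition spanning :: "'t set \<Rightarrow> ('t \<Rightarrow> 't) set \<Rightarrow> 't set \<Rightarrow> bool" where
  "spanning T S P \<longleftrightarrow> P \<subseteq> T \<and> (\<forall>X. P \<subseteq> X \<longrightarrow> X \<subseteq> T \<longrightarrow> (\<forall>s\<in>S. s ` X \<subseteq> X) \<longrightarrow> X = T)"

lemma orbit_reps_spanning: "orbit_reps T S P \<rho> \<Longrightarrow> spanning T S P"
  unfolding spanning_def
proof (intro conjI allI impI)
  assume reps: "orbit_reps T S P \<rho>"
  show "P \<subseteq> T" using reps by (simp add: orbit_reps_def)
  fix X assume X: "P \<subseteq> X" "X \<subseteq> T" "\<forall>s\<in>S. s ` X \<subseteq> X"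
  have "t \<in> X" if "t \<in> T" for t
  proof -
    have "t \<in> X \<longleftrightarrow> \<rho> t \<in> X" using reps X that unfolding orbit_reps_def by simp
    moreover have "\<rho> t \<in> X" using reps X(1) that unfolding orbit_reps_def by auto
    ultimately show ?thesis by simp
  qed
  with X(2) show "X = T" by blast
qed

lemma card_filter_sum: "finite A \<Longrightarrow> card {x \<in> A. P x} = (\<Sum>x\<in>A. if P x then 1 else 0)"
  using sum.inter_filter[of A "\<lambda>_. 1 :: nat" P] by simp

text \<open>The permutations are extensional functions, so that \<open>H\<close> is a finite set
  whose elements can be counted.\<close>

locale finite_perm_group =
  fixes T :: "'t set" and H :: "('t \<Rightarrow> 't) set"
  assumes finite_T: "finite T"
    and H_ext: "H \<subseteq> T \<rightarrow>\<^sub>E T"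
    and H_mult: "s \<in> H \<Longrightarrow> s' \<in> H \<Longrightarrow> (\<lambda>t\<in>T. s' (s t)) \<in> H"
    and H_inv: "s \<in> H \<Longrightarrow> \<exists>s'\<in>H. \<forall>t\<in>T. s' (s t) = t"
    and H_ne: "H \<noteq> {}"
begin

lemma finite_H: "finite H"
  by (rule finite_subset[OF H_ext]) (simp add: finite_PiE finite_T)

lemma H_mem: "s \<in> H \<Longrightarrow> t \<in> T \<Longrightarrow> s t \<in> T"
  using H_ext by auto

lemma H_inj: "s \<in> H \<Longrightarrow> inj_on s T"
  by (rule inj_onI) (metis H_inv)

lemma card_transport_le:
  assumes s: "s \<in> H" and t: "t \<in> T" "x \<in> T"
  shows "card {r \<in> H. r t = x} \<le> card {r \<in> H. r t = s x}"
proof (rule card_inj_on_le)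
  show "inj_on (\<lambda>r. \<lambda>t\<in>T. s (r t)) {r \<in> H. r t = x}"
  proof (rule inj_onI)
    fix r r' assume r: "r \<in> {r \<in> H. r t = x}" "r' \<in> {r \<in> H. r t = x}"
      and eq: "(\<lambda>t\<in>T. s (r t)) = (\<lambda>t\<in>T. s (r' t))"
    have "r u = r' u" if "u \<in> T" for u
    proof -
      have "s (r u) = s (r' u)" using fun_cong[OF eq, of u] that by simp
      then show ?thesis using inj_onD[OF H_inj[OF s]] H_mem r that by simp
    qed
    then show "r = r'" using r H_ext by (intro PiE_ext[of r T _ r']) auto
  qed
  show "(\<lambda>r. \<lambda>t\<in>T. s (r t)) ` {r \<in> H. r t = x} \<subseteq> {r \<in> H. r t = s x}"
    using H_mult[OF _ s] t by auto
  show "finite {r \<in> H. r t = s x}" using finite_H by simp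
qed

lemma card_transport:
  assumes s: "s \<in> H" and t: "t \<in> T" "x \<in> T"
  shows "card {r \<in> H. r t = s x} = card {r \<in> H. r t = x}"
proof (rule antisym)
  obtain s' where s': "s' \<in> H" "s' (s x) = x" using H_inv[OF s] t(2) by blast
  show "card {r \<in> H. r t = s x} \<le> card {r \<in> H. r t = x}"
    using card_transport_le[OF s'(1) t(1) H_mem[OF s t(2)]] s'(2) by simp
qed (rule card_transport_le[OF assms])

text \<open>For a random \<open>s\<close> in \<open>H\<close> the point \<open>s t\<close> is
  uniformly distributed on the orbit of \<open>t\<close>, because all fibres of evaluation at
  \<open>t\<close> have equal size. So it hits \<open>B\<close> with probability at most
  \<open>card B / q\<close>. The second disjunct covers infinite \<open>B\<close>, whose
  \<open>card\<close> is 0.\<close>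

lemma card_hit:
  assumes t: "t \<in> T" and q: "q \<le> card ((\<lambda>s. s t) ` H)"
  shows "card {s \<in> H. s t \<in> B} * q \<le> card B * card H \<or> infinite B"
proof -
  let ?O = "(\<lambda>s. s t) ` H"
  let ?n = "card {r \<in> H. r t = t}"
  have finO: "finite ?O" using finite_H by simp
  have fib: "card {s \<in> H. s t = x} = ?n" if "x \<in> ?O" for x
    using that card_transport[OF _ t t] by auto
  have count: "card {s \<in> H. s t \<in> A} = card (?O \<inter> A) * ?n" for A
  proof -
    have "{s \<in> H. s t \<in> A} = (\<Union>x\<in>?O \<inter> A. {s \<in> H. s t = x})" by auto
    also have "card \<dots> = (\<Sum>x\<in>?O \<inter> A. card {s \<in> H. s t = x})"
      using finO finite_H by (intro card_UN_disjoint) auto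
    also have "\<dots> = (\<Sum>x\<in>?O \<inter> A. ?n)" by (rule sum.cong) (auto simp: fib)
    finally show ?thesis by simp
  qed
  have H: "card H = card ?O * ?n" using count[of UNIV] by simp
  show ?thesis
  proof (cases "finite B")
    case True
    then have "card (?O \<inter> B) \<le> card B" by (intro card_mono) auto
    then have "card (?O \<inter> B) * ?n * q \<le> card B * ?n * card ?O"
      using q by (intro mult_mono) auto
    then show ?thesis using count[of B] H by (simp add: mult.assoc mult.commute)
  qed simp
qed

text \<open>An injection of a finite set into itself is onto, so a closed set is invariant in both
  directions.\<close>

lemma closed_iff:
  assumes "s \<in> H" "X \<subseteq> T" "s ` X \<subseteq> X" "t \<in> T"
  shows "t \<in> X \<longleftrightarrow> s t \<in> X"
proof
  have inj: "inj_on s X" using H_inj[OF assms(1)] assms(2) by (rule inj_on_subset)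
  have "finite X" using finite_subset[OF assms(2) finite_T] .
  then have img: "s ` X = X" using card_subset_eq[OF _ assms(3)] card_image[OF inj] by simp
  assume "s t \<in> X"
  then obtain x where "x \<in> X" "s t = s x" using img by (metis imageE)
  then show "t \<in> X" using inj_onD[OF H_inj[OF assms(1)], of t x] assms(2,4) by auto
qed (use assms in auto)

text \<open>A random element of \<open>H\<close> moves every \<open>v \<in> P\<close> out of its class with probability at least 1/2
  unless that class makes up more than half of the \<open>H\<close>-orbit. The points moved downwards (or those moved
  upwards) with respect to some enumeration of \<open>T\<close> may be removed from \<open>P\<close>.\<close>

lemma orbit_reps_step:
  assumes reps: "orbit_reps T S P \<rho>" and q: "0 < q" "\<And>t. t \<in> T \<Longrightarrow> q \<le> card ((\<lambda>s. s t) ` H)"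
  obtains s P' \<rho>' where "s \<in> H" "orbit_reps T (insert s S) P' \<rho>'"
    "4 * card P' \<le> 3 * card P + card {v \<in> P. q < 2 * card {t \<in> T. \<rho> t = v}}"
proof -
  let ?fib = "\<lambda>v. {t \<in> T. \<rho> t = v}"
  let ?small = "{v \<in> P. 2 * card (?fib v) \<le> q}"
  have PT: "P \<subseteq> T" "\<And>t. t \<in> T \<Longrightarrow> \<rho> t \<in> P" using reps by (auto simp: orbit_reps_def)
  have finP: "finite P" using finite_subset[OF PT(1) finite_T] .
  have move: "card H \<le> 2 * card {s \<in> H. \<rho> (s v) \<noteq> v}" if v: "v \<in> ?small" for v
  proof -
    have vT: "v \<in> T" using v PT by auto
    have "{s \<in> H. \<rho> (s v) = v} = {s \<in> H. s v \<in> ?fib v}" using H_mem vT by auto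
    then have "card {s \<in> H. \<rho> (s v) = v} * q \<le> card (?fib v) * card H"
      using card_hit[OF vT q(2)[OF vT], of "?fib v"] finite_T by simp
    then have "2 * card {s \<in> H. \<rho> (s v) = v} * q \<le> (2 * card (?fib v)) * card H" by simp
    also have "\<dots> \<le> q * card H" using v by (intro mult_right_mono) auto
    finally have "2 * card {s \<in> H. \<rho> (s v) = v} \<le> card H" using q(1) by (simp add: mult.commute)
    moreover have "card H = card {s \<in> H. \<rho> (s v) = v} + card {s \<in> H. \<rho> (s v) \<noteq> v}"
    proof -
      have "H = {s \<in> H. \<rho> (s v) = v} \<union> {s \<in> H. \<rho> (s v) \<noteq> v}" by auto
      moreover have "card ({s \<in> H. \<rho> (s v) = v} \<union> {s \<in> H. \<rho> (s v) \<noteq> v})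
          = card {s \<in> H. \<rho> (s v) = v} + card {s \<in> H. \<rho> (s v) \<noteq> v}"
        using finite_H by (intro card_Un_disjoint) auto
      ultimately show ?thesis by simp
    qed
    ultimately show ?thesis by linarith
  qed
  \<comment> \<open>Double counting: each small \<open>v\<close> is moved out of its class by at
    least half of \<open>H\<close>, so some single \<open>s\<close> moves at least half of the small
    \<open>v\<close>.\<close>
  have "\<exists>s\<in>H. card ?small \<le> 2 * card {v \<in> ?small. \<rho> (s v) \<noteq> v}"
  proof (rule ccontr)
    assume "\<not> ?thesis"
    then have lt: "\<And>s. s \<in> H \<Longrightarrow> 2 * card {v \<in> ?small. \<rho> (s v) \<noteq> v} < card ?small"
      by (simp add: not_le)
    have "(\<Sum>s\<in>H. 2 * card {v \<in> ?small. \<rho> (s v) \<noteq> v}) < (\<Sum>s\<in>H. card ?small)"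
      by (rule sum_strict_mono) (use finite_H H_ne lt in auto)
    moreover have "(\<Sum>s\<in>H. card {v \<in> ?small. \<rho> (s v) \<noteq> v}) = (\<Sum>v\<in>?small. card {s \<in> H. \<rho> (s v) \<noteq> v})"
    proof -
      have "(\<Sum>s\<in>H. card {v \<in> ?small. \<rho> (s v) \<noteq> v}) = (\<Sum>s\<in>H. \<Sum>v\<in>?small. if \<rho> (s v) \<noteq> v then 1 else 0)"
        by (rule sum.cong[OF refl]) (rule card_filter_sum, simp add: finP)
      also have "\<dots> = (\<Sum>v\<in>?small. \<Sum>s\<in>H. if \<rho> (s v) \<noteq> v then 1 else 0)" by (rule sum.swap)
      also have "\<dots> = (\<Sum>v\<in>?small. card {s \<in> H. \<rho> (s v) \<noteq> v})"
        by (rule sum.cong[OF refl]) (rule card_filter_sum[OF finite_H, symmetric])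
      finally show ?thesis .
    qed
    moreover have "(\<Sum>v\<in>?small. card H) \<le> (\<Sum>v\<in>?small. 2 * card {s \<in> H. \<rho> (s v) \<noteq> v})"
      by (rule sum_mono) (rule move)
    ultimately show False by (simp add: sum_distrib_left[symmetric] mult.commute)
  qed
  then obtain s where s: "s \<in> H" "card ?small \<le> 2 * card {v \<in> ?small. \<rho> (s v) \<noteq> v}" by blast
  let ?f = "\<lambda>v. \<rho> (s v)"
  let ?Y = "{v \<in> P. ?f v \<noteq> v}"
  have "card {v \<in> ?small. \<rho> (s v) \<noteq> v} \<le> card ?Y" using finP by (intro card_mono) auto
  with s(2) have Y: "card ?small \<le> 2 * card ?Y" by linarith
  obtain num :: "'t \<Rightarrow> nat" where num: "inj_on num T" using finite_imp_inj_to_nat_seg[OF finite_T] by blast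
  define b where "b = Max (num ` T)"
  have b: "num t \<le> b" if "t \<in> T" for t using that finite_T by (simp add: b_def)
  have fP: "?f v \<in> P" if "v \<in> P" for v using that PT H_mem[OF s(1)] by blast
  \<comment> \<open>A moved point goes down either in \<open>num\<close> or in the reversed
    numbering \<open>b - num\<close>, so one of the two accounts for half of the moved
    points.\<close>
  have "\<exists>m :: 't \<Rightarrow> nat. card ?Y \<le> 2 * card {v \<in> P. m (?f v) < m v}"
  proof (rule ccontr)
    assume no: "\<not> ?thesis"
    have "?Y \<subseteq> {v \<in> P. num (?f v) < num v} \<union> {v \<in> P. b - num (?f v) < b - num v}"
    proof
      fix v assume v: "v \<in> ?Y"
      then have "num (?f v) \<noteq> num v" using inj_onD[OF num, of "?f v" v] fP PT(1) by auto
      moreover have "num (?f v) \<le> b" "num v \<le> b" using b fP v PT(1) by auto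
      ultimately show "v \<in> {v \<in> P. num (?f v) < num v} \<union> {v \<in> P. b - num (?f v) < b - num v}"
        using v by auto
    qed
    then have "card ?Y \<le> card ({v \<in> P. num (?f v) < num v} \<union> {v \<in> P. b - num (?f v) < b - num v})"
      using finP by (intro card_mono) auto
    also have "\<dots> \<le> card {v \<in> P. num (?f v) < num v} + card {v \<in> P. b - num (?f v) < b - num v}"
      by (rule card_Un_le)
    finally show False using no[simplified, rule_format, of num] no[simplified, rule_format, of "\<lambda>t. b - num t"]
      by simp
  qed
  then obtain m :: "'t \<Rightarrow> nat" where m: "card ?Y \<le> 2 * card {v \<in> P. m (?f v) < m v}" by blast
  let ?Z = "{v \<in> P. m (?f v) < m v}"
  let ?P = "P - ?Z"
  let ?closed = "\<lambda>X. X \<subseteq> T \<and> (\<forall>r\<in>insert s S. r ` X \<subseteq> X)"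
  have reps_iff: "t \<in> X \<longleftrightarrow> \<rho> t \<in> X" if "?closed X" "t \<in> T" for X t
    using reps that unfolding orbit_reps_def by auto
  have f_iff: "v \<in> X \<longleftrightarrow> ?f v \<in> X" if "?closed X" "v \<in> P" for X v
  proof -
    have vT: "v \<in> T" using that PT by auto
    have "v \<in> X \<longleftrightarrow> s v \<in> X" using that vT by (intro closed_iff[OF s(1)]) auto
    then show ?thesis using reps_iff[OF that(1) H_mem[OF s(1) vT]] by simp
  qed
  \<comment> \<open>Inside \<open>?Z\<close> the map \<open>?f\<close> strictly lowers
    \<open>m\<close>, so iterating it ends at a remaining point, which lies in the same closed
    sets.\<close>
  have ex: "\<exists>v'\<in>?P. \<forall>X. ?closed X \<longrightarrow> (v \<in> X \<longleftrightarrow> v' \<in> X)" if "v \<in> P" for v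
    using that
  proof (induction "m v" arbitrary: v rule: less_induct)
    case less
    show ?case
    proof (cases "v \<in> ?Z")
      case True
      then obtain v' where v': "v' \<in> ?P" "\<forall>X. ?closed X \<longrightarrow> (?f v \<in> X \<longleftrightarrow> v' \<in> X)"
        using less.hyps[of "?f v"] fP[OF less.prems] by auto
      have "v \<in> X \<longleftrightarrow> v' \<in> X" if "?closed X" for X
        using v'(2) that f_iff[OF that less.prems] by blast
      then show ?thesis using v'(1) by blast
    next
      case False
      then show ?thesis using less.prems by blast
    qed
  qed
  then have "\<forall>v\<in>P. \<exists>v'. v' \<in> ?P \<and> (\<forall>X. ?closed X \<longrightarrow> (v \<in> X \<longleftrightarrow> v' \<in> X))" by blast
  from bchoice[OF this] obtain g
    where "\<forall>v\<in>P. g v \<in> ?P \<and> (\<forall>X. ?closed X \<longrightarrow> (v \<in> X \<longleftrightarrow> g v \<in> X))" ..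
  then have g: "\<And>v. v \<in> P \<Longrightarrow> g v \<in> ?P"
    "\<And>v X. v \<in> P \<Longrightarrow> ?closed X \<Longrightarrow> (v \<in> X \<longleftrightarrow> g v \<in> X)"
    by blast+
  have "orbit_reps T (insert s S) ?P (\<lambda>t. g (\<rho> t))"
    unfolding orbit_reps_def
  proof (intro conjI allI impI)
    show "?P \<subseteq> T" using PT by auto
    show "(\<lambda>t. g (\<rho> t)) ` T \<subseteq> ?P" using g(1) PT(2) by blast
  next
    fix X t assume "X \<subseteq> T" "\<forall>r\<in>insert s S. r ` X \<subseteq> X" and t: "t \<in> T"
    then have X: "?closed X" by blast
    show "t \<in> X \<longleftrightarrow> g (\<rho> t) \<in> X"
      using reps_iff[OF X t] g(2)[OF PT(2)[OF t] X] by simp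
  qed
  \<comment> \<open>\<open>card ?small \<le> 2 * card ?Y \<le> 4 * card ?Z\<close>: one factor 2
    comes from the choice of \<open>s\<close>, the other from that of \<open>m\<close>.\<close>
  moreover have "4 * card ?P \<le> 3 * card P + card {v \<in> P. q < 2 * card (?fib v)}"
  proof -
    have "card ?P = card P - card ?Z" using finP by (intro card_Diff_subset) auto
    moreover have "card ?Z \<le> card P" using finP by (intro card_mono) auto
    moreover have "card P = card ?small + card {v \<in> P. q < 2 * card (?fib v)}"
    proof -
      have "P = ?small \<union> {v \<in> P. q < 2 * card (?fib v)}" by auto
      moreover have "card (?small \<union> {v \<in> P. q < 2 * card (?fib v)})
          = card ?small + card {v \<in> P. q < 2 * card (?fib v)}"
        using finP by (intro card_Un_disjoint) auto
      ultimately show ?thesis by simp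
    qed
    ultimately show ?thesis using m Y by linarith
  qed
  ultimately show ?thesis using that[OF s(1)] by blast
qed

lemma orbit_reps_init: "orbit_reps T {} T id"
  by (auto simp: orbit_reps_def)

text \<open>One step from the partition into points; all classes have size 1, so with
  \<open>q = 2\<close> none is big.\<close>

lemma spanning_one:
  assumes "\<And>t. t \<in> T \<Longrightarrow> 2 \<le> card ((\<lambda>s. s t) ` H)"
  obtains s P where "s \<in> H" "spanning T {s} P" "4 * card P \<le> 3 * card T"
proof -
  obtain s P \<rho> where *: "s \<in> H" "orbit_reps T (insert s {}) P \<rho>"
    "4 * card P \<le> 3 * card T + card {v \<in> T. 2 < 2 * card {t \<in> T. id t = v}}"
    using orbit_reps_step[OF orbit_reps_init, of 2] assms by auto
  have "{t \<in> T. id t = v} = {v}" if "v \<in> T" for v using that by auto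
  then have big: "{v \<in> T. 2 < 2 * card {t \<in> T. id t = v}} = {}" by auto
  have "4 * card P \<le> 3 * card T" using *(3) unfolding big by simp
  then show ?thesis using that[OF *(1) orbit_reps_spanning[OF *(2)]] by simp
qed

text \<open>At most \<open>card T / 16\<close> classes have more than 16 points, so a step with
  \<open>q = 32\<close> turns a bound \<open>p\<close> on \<open>card P / card T\<close> into
  \<open>3/4 p + 1/64\<close>. Starting from 1 this gives \<open>1/16 + 15/16 (3/4)^k\<close>, and
  \<open>k = 10\<close> is the first exponent that brings it below 1/8.\<close>

lemma spanning_few:
  assumes q: "\<And>t. t \<in> T \<Longrightarrow> 32 \<le> card ((\<lambda>s. s t) ` H)"
  obtains S P where "S \<subseteq> H" "finite S" "card S \<le> 10" "spanning T S P" "8 * card P \<le> card T"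
proof -
  have ind: "\<exists>S P \<rho>. S \<subseteq> H \<and> finite S \<and> card S \<le> k \<and> orbit_reps T S P \<rho> \<and>
      16 * 4 ^ k * card P \<le> (4 ^ k + 15 * 3 ^ k) * card T" for k
  proof (induction k)
    case 0
    have "{} \<subseteq> H \<and> finite ({} :: ('t \<Rightarrow> 't) set) \<and> card ({} :: ('t \<Rightarrow> 't) set) \<le> 0 \<and> orbit_reps T {} T id \<and>
        16 * 4 ^ 0 * card T \<le> (4 ^ 0 + 15 * 3 ^ 0) * card T"
      using orbit_reps_init by simp
    then show ?case by blast
  next
    case (Suc k)
    then obtain S P \<rho> where IH: "S \<subseteq> H" "finite S" "card S \<le> k" "orbit_reps T S P \<rho>"
      "16 * 4 ^ k * card P \<le> (4 ^ k + 15 * 3 ^ k) * card T" by blast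
    let ?big = "{v \<in> P. 32 < 2 * card {t \<in> T. \<rho> t = v}}"
    obtain s P' \<rho>' where *: "s \<in> H" "orbit_reps T (insert s S) P' \<rho>'" "4 * card P' \<le> 3 * card P + card ?big"
      using orbit_reps_step[OF IH(4), of 32] q by auto
    have finP: "finite P" using IH(4) finite_subset[OF _ finite_T] by (auto simp: orbit_reps_def)
    have "(\<Sum>v\<in>?big. 16) \<le> (\<Sum>v\<in>?big. card {t \<in> T. \<rho> t = v})" by (rule sum_mono) auto
    also have "\<dots> = card (\<Union>v\<in>?big. {t \<in> T. \<rho> t = v})"
      using finP finite_T by (intro card_UN_disjoint[symmetric]) auto
    also have "\<dots> \<le> card T" by (rule card_mono[OF finite_T]) auto
    finally have "16 * card ?big \<le> card T" by simp
    with *(3) have "64 * card P' \<le> 48 * card P + card T" by linarith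
    then have "4 ^ k * (64 * card P') \<le> 4 ^ k * (48 * card P + card T)" by (rule mult_left_mono) simp
    also have "\<dots> = 3 * (16 * 4 ^ k * card P) + 4 ^ k * card T" by (simp add: algebra_simps)
    also have "\<dots> \<le> 3 * ((4 ^ k + 15 * 3 ^ k) * card T) + 4 ^ k * card T"
      using IH(5) by (intro add_mono mult_left_mono) auto
    finally have "16 * 4 ^ Suc k * card P' \<le> (4 ^ Suc k + 15 * 3 ^ Suc k) * card T"
      by (simp add: algebra_simps)
    moreover have "card (insert s S) \<le> Suc k" using IH(2,3) by (simp add: card_insert_if)
    ultimately have "insert s S \<subseteq> H \<and> finite (insert s S) \<and> card (insert s S) \<le> Suc k \<and>
        orbit_reps T (insert s S) P' \<rho>' \<and> 16 * 4 ^ Suc k * card P' \<le> (4 ^ Suc k + 15 * 3 ^ Suc k) * card T"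
      using *(1,2) IH(1,2) by simp
    then show ?case by blast
  qed
  obtain S P \<rho> where *: "S \<subseteq> H" "finite S" "card S \<le> 10" "orbit_reps T S P \<rho>"
    "16 * 4 ^ 10 * card P \<le> (4 ^ 10 + 15 * 3 ^ 10) * card T" using ind[of 10] by blast
  have "8 * card P \<le> card T" using *(5) by simp
  then show ?thesis using that[OF *(1-3) orbit_reps_spanning[OF *(4)]] by simp
qed

end

section \<open>Counting the lifts of a homomorphism\<close>

text \<open>Translation by the inverse of one point moves the fibre into the kernel. It is only an
  inequality, as the fibre over \<open>g\<close> may miss \<open>B\<close>.\<close>

lemma card_hom_fibre:
  assumes "group H" "group K" and f: "f \<in> hom H K" and B: "subgroup B H" "finite B"
  shows "card {a \<in> B. f a = g} \<le> card {a \<in> B. f a = \<one>\<^bsub>K\<^esub>}"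
proof (cases "{a \<in> B. f a = g} = {}")
  case False
  then obtain b where b: "b \<in> B" "f b = g" by auto
  interpret f: group_hom H K f using assms by (simp add: group_homI)
  have BH: "x \<in> carrier H" if "x \<in> B" for x using B(1) that by (rule subgroup.mem_carrier)
  show ?thesis
  proof (rule card_inj_on_le[where f = "\<lambda>a. inv\<^bsub>H\<^esub> b \<otimes>\<^bsub>H\<^esub> a"])
    show "inj_on (\<lambda>a. inv\<^bsub>H\<^esub> b \<otimes>\<^bsub>H\<^esub> a) {a \<in> B. f a = g}"
      using BH b by (intro inj_onI) simp
    show "(\<lambda>a. inv\<^bsub>H\<^esub> b \<otimes>\<^bsub>H\<^esub> a) ` {a \<in> B. f a = g} \<subseteq> {a \<in> B. f a = \<one>\<^bsub>K\<^esub>}"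
      using b BH subgroup.m_closed[OF B(1) subgroup.m_inv_closed[OF B(1) b(1)]] by auto
    show "finite {a \<in> B. f a = \<one>\<^bsub>K\<^esub>}" using B(2) by simp
  qed
qed (simp only: card.empty)

lemma card_hom_fibre_surj:
  assumes "group H" "group K" and f: "f \<in> hom H K" and fin: "finite (carrier H)"
    and surj: "f ` carrier H = carrier K" and g: "g \<in> carrier K"
  shows "card {a \<in> carrier H. f a = g} = card {a \<in> carrier H. f a = \<one>\<^bsub>K\<^esub>}"
proof (rule antisym)
  interpret f: group_hom H K f using assms by (simp add: group_homI)
  show "card {a \<in> carrier H. f a = g} \<le> card {a \<in> carrier H. f a = \<one>\<^bsub>K\<^esub>}"
    by (rule card_hom_fibre[OF assms(1,2) f group.subgroup_self[OF assms(1)] fin])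
  have "g \<in> f ` carrier H" using surj g by simp
  then obtain b where b: "b \<in> carrier H" "f b = g" by blast
  show "card {a \<in> carrier H. f a = \<one>\<^bsub>K\<^esub>} \<le> card {a \<in> carrier H. f a = g}"
  proof (rule card_inj_on_le[where f = "\<lambda>a. b \<otimes>\<^bsub>H\<^esub> a"])
    show "inj_on (\<lambda>a. b \<otimes>\<^bsub>H\<^esub> a) {a \<in> carrier H. f a = \<one>\<^bsub>K\<^esub>}" using b by (intro inj_onI) simp
    show "(\<lambda>a. b \<otimes>\<^bsub>H\<^esub> a) ` {a \<in> carrier H. f a = \<one>\<^bsub>K\<^esub>} \<subseteq> {a \<in> carrier H. f a = g}"
      using b g by auto
  qed (use fin in simp)
qed

text \<open>Here \<open>G\<close> stands for the free open overgroup, not for the ambient group, and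
  \<phi> has already been extended to the open subgroup \<open>E\<close>.\<close>

locale lifting_problem = chain_group G U for G (structure) and U :: "nat \<Rightarrow> 'a set" +
  fixes I :: "'i set" and z :: "'i \<Rightarrow> 'a" and E :: "'a set" and d :: nat
    and K :: "('k, 'km) monoid_scheme" and H :: "('h, 'hm) monoid_scheme"
    and \<phi> :: "'a \<Rightarrow> 'k" and \<alpha> :: "'h \<Rightarrow> 'k"
  assumes free: "free_on G U I z" and finI: "finite I"
    and E: "subgroup E G" "U d \<subseteq> E"
    and K: "group K" and H: "group H" "finite (carrier H)"
    and \<phi>: "\<phi> \<in> chom (G\<lparr>carrier := E\<rparr>) (\<lambda>i. U i \<inter> E) K" "\<phi> ` E = carrier K"
    and \<alpha>: "\<alpha> \<in> hom H K" "\<alpha> ` carrier H = carrier K"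
begin

sublocale H: group H by (rule H)
sublocale K: group K by (rule K)
sublocale \<alpha>: group_hom H K \<alpha> by (rule group_homI[OF H(1) K \<alpha>(1)])

abbreviation "T \<equiv> rcosets E"

definition A where "A = {a \<in> carrier H. \<alpha> a = \<one>\<^bsub>K\<^esub>}"

text \<open>The base coset gets the representative 1, so that the induced cocycle restricts to
  \<phi> itself on \<open>E\<close> and not to a conjugate.\<close>

definition y :: "'a set \<Rightarrow> 'a" where "y t = (if t = E then \<one> else SOME x. x \<in> t)"

definition \<kappa> :: "'a set \<Rightarrow> 'a \<Rightarrow> 'a" where "\<kappa> t x = y t \<otimes> x \<otimes> inv y (t #> x)"

text \<open>The cocycle induced from \<phi>, as for an induced representation. Lifting it along
  \<alpha> lifts \<phi> on \<open>E\<close>, see \<open>coc_E_lift\<close>.\<close>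

definition cK :: "'a set \<Rightarrow> 'a \<Rightarrow> 'k" where "cK t x = \<phi> (\<kappa> t x)"

definition labels :: "('i \<Rightarrow> 'a set \<Rightarrow> 'h) set" where
  "labels = (\<Pi>\<^sub>E i\<in>I. \<Pi>\<^sub>E t\<in>T. {a \<in> carrier H. \<alpha> a = cK t (z i)})"

text \<open>On cosets in \<open>T\<close> and group elements the choice is determined by the labels,
  by \<open>cocycle_eqI\<close>.\<close>

definition coc :: "('i \<Rightarrow> 'a set \<Rightarrow> 'h) \<Rightarrow> 'a set \<Rightarrow> 'a \<Rightarrow> 'h" where
  "coc w = (SOME c. ccocycle G U E H c \<and> (\<forall>i\<in>I. \<forall>t\<in>T. c t (z i) = w i t))"

lemma finT: "finite T" by (rule finite_rcosets[OF E])

lemma ET: "E \<in> T" by (rule rcosets_self[OF E(1)])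

lemma z_carrier: "i \<in> I \<Longrightarrow> z i \<in> carrier G"
  by (rule free_on_carrier[OF free])

lemma E_carrier: "x \<in> E \<Longrightarrow> x \<in> carrier G"
  by (rule subgroup.mem_carrier[OF E(1)])

lemma act_closed: "t \<in> T \<Longrightarrow> x \<in> carrier G \<Longrightarrow> t #> x \<in> T"
  by (rule rcosets_act[OF E(1)])

lemma y_mem: assumes "t \<in> T" shows "y t \<in> t"
proof (cases "t = E")
  case True
  then show ?thesis using subgroup.one_closed[OF E(1)] by (simp add: y_def)
next
  case False
  have "t \<noteq> {}" by (rule subgroup.rcosets_non_empty[OF E(1) assms])
  then have "\<exists>x. x \<in> t" by blast
  from someI_ex[OF this] False show ?thesis by (simp add: y_def)
qed

lemma y_carrier: "t \<in> T \<Longrightarrow> y t \<in> carrier G"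
  and y_coset: "t \<in> T \<Longrightarrow> E #> y t = t"
  using rcosets_mem_eq[OF E(1) _ y_mem] by auto

lemma y_E: "y E = \<one>" by (simp add: y_def)

lemma \<kappa>_mem: assumes "t \<in> T" "x \<in> carrier G" shows "\<kappa> t x \<in> E"
proof -
  have "E #> (y t \<otimes> x) = t #> x"
    using y_coset[OF assms(1)] y_carrier[OF assms(1)] assms(2)
    by (simp add: coset_mult_assoc[OF subgroup.subset[OF E(1)], symmetric])
  also have "\<dots> = E #> y (t #> x)" by (rule y_coset[OF act_closed[OF assms], symmetric])
  finally show ?thesis
    using y_carrier[OF assms(1)] y_carrier[OF act_closed[OF assms]] assms(2)
    by (simp add: \<kappa>_def rcos_eq_iff[OF E(1)])
qed

lemma \<kappa>_shift: assumes "t \<in> T" "x \<in> carrier G" shows "\<kappa> t x \<otimes> y (t #> x) = y t \<otimes> x"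
  using y_carrier[OF assms(1)] y_carrier[OF act_closed[OF assms]] assms(2)
  by (simp add: \<kappa>_def m_assoc)

lemma \<kappa>_E: assumes "x \<in> E" shows "\<kappa> E x = x"
  using coset_join2[OF E_carrier[OF assms] E(1) assms] E_carrier[OF assms] by (simp add: \<kappa>_def y_E)

lemma \<kappa>_y: assumes "t \<in> T" shows "\<kappa> E (y t) = \<one>"
  using y_carrier[OF assms] by (simp add: \<kappa>_def y_coset[OF assms] y_E)

lemma \<kappa>_mult:
  assumes "t \<in> T" "x \<in> carrier G" "x' \<in> carrier G"
  shows "\<kappa> t (x \<otimes> x') = \<kappa> t x \<otimes> \<kappa> (t #> x) x'"
proof -
  have "y (t #> x) \<in> carrier G" "y (t #> x #> x') \<in> carrier G" "y t \<in> carrier G"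
    using assms by (simp_all add: act_closed y_carrier)
  moreover have "t #> (x \<otimes> x') = t #> x #> x'" by (rule rcosets_act_assoc[OF E(1) assms, symmetric])
  ultimately show ?thesis using assms(2,3)
    by (simp add: \<kappa>_def m_assoc inv_solve_left)
qed

lemma \<phi>_hom: "\<phi> \<in> hom (G\<lparr>carrier := E\<rparr>) K" by (rule chom_hom[OF \<phi>(1)])

lemma \<phi>_mult: "x \<in> E \<Longrightarrow> x' \<in> E \<Longrightarrow> \<phi> (x \<otimes> x') = \<phi> x \<otimes>\<^bsub>K\<^esub> \<phi> x'"
  using hom_mult[OF \<phi>_hom] by simp

lemma \<phi>_closed: "x \<in> E \<Longrightarrow> \<phi> x \<in> carrier K"
  using hom_in_carrier[OF \<phi>_hom] by simp

lemma \<phi>_one: "\<phi> \<one> = \<one>\<^bsub>K\<^esub>"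
  using hom_one[OF \<phi>_hom subgroup.subgroup_is_group[OF E(1) is_group] K] by simp

lemma cK_ccocycle: "ccocycle G U E K cK"
proof -
  have "cocycle G E K cK"
    unfolding cocycle_def cK_def
    by (simp add: \<phi>_closed \<kappa>_mem \<kappa>_mult \<phi>_mult act_closed)
  moreover obtain k where k: "\<And>x. x \<in> U k \<Longrightarrow> x \<in> E \<Longrightarrow> \<phi> x = \<one>\<^bsub>K\<^esub>"
    using \<phi>(1) by (auto simp: chom_def)
  \<comment> \<open>\<open>U d\<close> fixes every coset, so for such \<open>x\<close> the element
    \<open>\<kappa> t x\<close> is a conjugate of \<open>x\<close> and stays in
    \<open>U k\<close>.\<close>
  have "cK t x = \<one>\<^bsub>K\<^esub>" if x: "x \<in> U (max d k)" and t: "t \<in> T" for t x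
  proof -
    have tx: "t #> x = t" by (rule U_act_trivial[OF E _ t x]) simp
    have xc: "x \<in> carrier G" by (rule U_carrier[OF x])
    have "\<kappa> t x \<in> U (max d k)" using U_conj[OF y_carrier[OF t] x] by (simp add: \<kappa>_def tx)
    then have "\<kappa> t x \<in> U k" using U_anti[of k "max d k"] by auto
    then show ?thesis using k \<kappa>_mem[OF t xc] by (simp add: cK_def)
  qed
  ultimately show ?thesis unfolding ccocycle_def by blast
qed

lemma cK_closed: "t \<in> T \<Longrightarrow> x \<in> carrier G \<Longrightarrow> cK t x \<in> carrier K"
  by (simp add: cK_def \<phi>_closed \<kappa>_mem)

lemma finA: "finite A" using H(2) by (simp add: A_def)

lemma subgroup_A: "subgroup A H"
  by (rule H.subgroupI) (auto simp: A_def)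

lemma card_A_pos: "card A > 0"
  using finA subgroup.one_closed[OF subgroup_A] by (auto simp: card_gt_0_iff)

lemma card_fibre: "g \<in> carrier K \<Longrightarrow> card {a \<in> carrier H. \<alpha> a = g} = card A"
  unfolding A_def by (rule card_hom_fibre_surj[OF H(1) K \<alpha>(1) H(2) \<alpha>(2)])

lemma card_labels: "card labels = card A ^ (card T * card I)"
proof -
  have "card labels = (\<Prod>i\<in>I. \<Prod>t\<in>T. card A)"
    unfolding labels_def using finI finT
    by (simp add: card_PiE card_fibre cK_closed z_carrier)
  then show ?thesis by (simp add: power_mult)
qed

lemma labels_mem: "w \<in> labels \<Longrightarrow> i \<in> I \<Longrightarrow> t \<in> T \<Longrightarrow> w i t \<in> carrier H \<and> \<alpha> (w i t) = cK t (z i)"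
  unfolding labels_def by (drule PiE_mem, assumption) (drule PiE_mem, assumption, simp)

lemma labels_eqI:
  assumes "w \<in> labels" "w' \<in> labels" "\<And>i t. i \<in> I \<Longrightarrow> t \<in> T \<Longrightarrow> w i t = w' i t"
  shows "w = w'"
proof (rule PiE_ext)
  show "w \<in> (\<Pi>\<^sub>E i\<in>I. \<Pi>\<^sub>E t\<in>T. {a \<in> carrier H. \<alpha> a = cK t (z i)})"
    and "w' \<in> (\<Pi>\<^sub>E i\<in>I. \<Pi>\<^sub>E t\<in>T. {a \<in> carrier H. \<alpha> a = cK t (z i)})"
    using assms by (simp_all only: labels_def)
  fix i assume i: "i \<in> I"
  show "w i = w' i"
    by (rule PiE_ext[of _ T "\<lambda>t. {a \<in> carrier H. \<alpha> a = cK t (z i)}"])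
      (use assms i in \<open>auto simp only: labels_def PiE_mem\<close>)
qed

lemma coc:
  assumes "w \<in> labels"
  shows "ccocycle G U E H (coc w)" "i \<in> I \<Longrightarrow> t \<in> T \<Longrightarrow> coc w t (z i) = w i t"
proof -
  have "\<exists>c. ccocycle G U E H c \<and> (\<forall>i\<in>I. \<forall>t\<in>T. c t (z i) = w i t)"
    using cocycle_exists[OF E H free finI, of w] labels_mem[OF assms] by metis
  from someI_ex[OF this]
  show "ccocycle G U E H (coc w)" "i \<in> I \<Longrightarrow> t \<in> T \<Longrightarrow> coc w t (z i) = w i t"
    by (simp_all add: coc_def)
qed

lemma coc_closed: "w \<in> labels \<Longrightarrow> t \<in> T \<Longrightarrow> x \<in> carrier G \<Longrightarrow> coc w t x \<in> carrier H"
  by (rule cocycle_closed[OF ccocycle_cocycle[OF coc(1)]])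

lemma coc_mult: "w \<in> labels \<Longrightarrow> t \<in> T \<Longrightarrow> x \<in> carrier G \<Longrightarrow> x' \<in> carrier G \<Longrightarrow>
    coc w t (x \<otimes> x') = coc w t x \<otimes>\<^bsub>H\<^esub> coc w (t #> x) x'"
  by (rule cocycle_mult[OF ccocycle_cocycle[OF coc(1)]])

text \<open>Both sides are continuous cocycles with values in \<open>K\<close>, and they agree on
  the generators by the choice of the labels.\<close>

lemma coc_lift:
  assumes w: "w \<in> labels" and "t \<in> T" "x \<in> carrier G"
  shows "\<alpha> (coc w t x) = cK t x"
proof -
  have "ccocycle G U E K (\<lambda>t x. \<alpha> (coc w t x))"
  proof -
    have "cocycle G E K (\<lambda>t x. \<alpha> (coc w t x))"
      unfolding cocycle_def by (simp add: coc_closed[OF w] coc_mult[OF w] act_closed)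
    moreover obtain k where "\<forall>x\<in>U k. \<forall>t\<in>T. coc w t x = \<one>\<^bsub>H\<^esub>"
      using coc(1)[OF w] by (auto simp: ccocycle_def)
    then have "\<forall>x\<in>U k. \<forall>t\<in>T. \<alpha> (coc w t x) = \<one>\<^bsub>K\<^esub>" by simp
    ultimately show ?thesis unfolding ccocycle_def by blast
  qed
  then show ?thesis
  proof (rule cocycle_eqI[OF E _ cK_ccocycle K free_on_dense[OF free] _ _ assms(2,3)])
    show "z ` I \<subseteq> carrier G" using z_carrier by auto
    show "\<alpha> (coc w t x) = cK t x" if "t \<in> T" "x \<in> z ` I" for t x
      using that coc(2)[OF w] labels_mem[OF w] by auto
  qed
qed

lemma coc_E_chom:
  assumes "w \<in> labels"
  shows "coc w E \<in> chom (G\<lparr>carrier := E\<rparr>) (\<lambda>i. U i \<inter> E) H"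
proof -
  obtain k where "\<forall>x\<in>U k. \<forall>t\<in>T. coc w t x = \<one>\<^bsub>H\<^esub>"
    using coc(1)[OF assms] by (auto simp: ccocycle_def)
  then have "\<forall>x\<in>U k \<inter> E. coc w E x = \<one>\<^bsub>H\<^esub>" using ET by blast
  then show ?thesis
    using cocycle_stabilizer_hom[OF E(1) ccocycle_cocycle[OF coc(1)[OF assms]]] unfolding chom_def by blast
qed

lemma coc_E_lift: "w \<in> labels \<Longrightarrow> x \<in> E \<Longrightarrow> \<alpha> (coc w E x) = \<phi> x"
  using coc_lift[OF _ ET E_carrier] by (simp add: cK_def \<kappa>_E)

text \<open>After conjugation by the values of the cocycle at the representatives \<open>y t\<close>, a cocycle whose
  restriction to \<open>E\<close> takes values in \<open>H'\<close> has all its labels in \<open>H'\<close>.\<close>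

lemma card_labels_into_subgroup:
  assumes H': "subgroup H' H" "H' \<noteq> carrier H" and I: "card I \<ge> card (carrier H) + card A + 2"
  shows "4 * 2 ^ card (carrier H) * card {w \<in> labels. coc w E ` E \<subseteq> H'} \<le> card labels"
proof (cases "{w \<in> labels. coc w E ` E \<subseteq> H'} = {}")
  case False
  let ?n = "card T" and ?r = "card I"
  let ?A' = "{a \<in> H'. \<alpha> a = \<one>\<^bsub>K\<^esub>}"
  let ?W = "{w \<in> labels. coc w E ` E \<subseteq> H'}"
  have finH': "finite H'" using H(2) subgroup.subset[OF H'(1)] finite_subset by blast
  have H'c: "a \<in> H' \<Longrightarrow> a \<in> carrier H" for a by (rule subgroup.mem_carrier[OF H'(1)])
  have A'A: "?A' \<subseteq> A" using H'c by (auto simp: A_def)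
  obtain w where w: "w \<in> labels" "coc w E ` E \<subseteq> H'" using False by blast
  \<comment> \<open>If \<open>H'\<close> contained \<open>A\<close>, it would be all of
    \<open>H\<close>, because the values of \<open>coc w E\<close> in \<open>H'\<close> lift the
    surjection \<phi>. Hence \<open>?A'\<close> is a proper subgroup of \<open>A\<close> and has at
    most half its size.\<close>
  have "?A' \<noteq> A"
  proof
    assume eq: "?A' = A"
    have "carrier H \<subseteq> H'"
    proof
      fix h assume h: "h \<in> carrier H"
      then have "\<alpha> h \<in> \<phi> ` E" using \<phi>(2) by simp
      then obtain x where x: "x \<in> E" "\<phi> x = \<alpha> h" by force
      let ?a = "coc w E x"
      have a: "?a \<in> H'" "\<alpha> ?a = \<alpha> h" using w(2) x coc_E_lift[OF w(1)] by auto
      then have "inv\<^bsub>H\<^esub> ?a \<otimes>\<^bsub>H\<^esub> h \<in> A" using h H'c by (simp add: A_def)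
      then have "inv\<^bsub>H\<^esub> ?a \<otimes>\<^bsub>H\<^esub> h \<in> H'" using eq by blast
      then have "?a \<otimes>\<^bsub>H\<^esub> (inv\<^bsub>H\<^esub> ?a \<otimes>\<^bsub>H\<^esub> h) \<in> H'" using subgroup.m_closed[OF H'(1) a(1)] by blast
      then show "h \<in> H'" using a h H'c by (simp add: H.m_assoc[symmetric])
    qed
    then show False using H' subgroup.subset[OF H'(1)] by blast
  qed
  have A'sub: "subgroup ?A' (H\<lparr>carrier := A\<rparr>)"
  proof -
    have "subgroup ?A' H"
      using subgroup.m_closed[OF H'(1)] subgroup.m_inv_closed[OF H'(1)] subgroup.one_closed[OF H'(1)] H'c
      by (intro H.subgroupI) auto
    then show ?thesis by (rule H.subgroup_incl[OF _ subgroup_A A'A])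
  qed
  have "card ?A' dvd card A"
  proof -
    interpret A: group "H\<lparr>carrier := A\<rparr>" by (rule subgroup.subgroup_is_group[OF subgroup_A H(1)])
    have "card (rcosets\<^bsub>H\<lparr>carrier := A\<rparr>\<^esub> ?A') * card ?A' = card A"
      using A.lagrange[OF A'sub] by (simp add: order_def)
    from this[symmetric] show ?thesis by simp
  qed
  then obtain k where k: "card A = card ?A' * k" by (auto elim: dvdE)
  have "card ?A' < card A" using psubset_card_mono[OF finA] A'A \<open>?A' \<noteq> A\<close> by blast
  then have "k \<ge> 2" using k card_A_pos by (cases k; cases "k - 1") auto
  then have A2: "2 * card ?A' \<le> card A" using k by (simp add: mult.commute)
  \<comment> \<open>A label is recovered from the transports to the representatives
    \<open>y t\<close>, which lie in \<open>A\<close>, and from the values at the elements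
    \<open>\<kappa> t (z i)\<close> of \<open>E\<close>, which lie in \<open>H'\<close>.\<close>
  let ?D = "(\<Pi>\<^sub>E t\<in>T. A) \<times> (\<Pi>\<^sub>E i\<in>I. \<Pi>\<^sub>E t\<in>T. {a \<in> H'. \<alpha> a = cK t (z i)})"
  let ?f = "\<lambda>w. (\<lambda>t\<in>T. coc w E (y t), \<lambda>i\<in>I. \<lambda>t\<in>T. coc w E (\<kappa> t (z i)))"
  have finD: "finite ?D" using finA finH' finI finT by (intro finite_cartesian_product finite_PiE) auto
  have "card ?W \<le> card ?D"
  proof (rule card_inj_on_le[OF _ _ finD])
    show "?f ` ?W \<subseteq> ?D"
    proof
      fix p assume "p \<in> ?f ` ?W"
      then obtain w where w: "w \<in> labels" "coc w E ` E \<subseteq> H'" "p = ?f w" by blast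
      have "coc w E (y t) \<in> A" if "t \<in> T" for t
        using coc_closed[OF w(1) ET y_carrier[OF that]] coc_lift[OF w(1) ET y_carrier[OF that]] \<kappa>_y[OF that]
        by (simp add: A_def cK_def \<phi>_one)
      moreover have "coc w E (\<kappa> t (z i)) \<in> {a \<in> H'. \<alpha> a = cK t (z i)}" if "t \<in> T" "i \<in> I" for t i
        using w(2) \<kappa>_mem[OF that(1) z_carrier[OF that(2)]] coc_E_lift[OF w(1)] by (auto simp: cK_def)
      ultimately show "p \<in> ?D" unfolding w(3) by simp
    qed
    show "inj_on ?f ?W"
    proof (rule inj_onI)
      fix w w' assume "w \<in> ?W" "w' \<in> ?W" and eq: "?f w = ?f w'"
      then have w: "w \<in> labels" "w' \<in> labels" by auto
      have eq1: "coc w E (y t) = coc w' E (y t)" if "t \<in> T" for t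
        using fun_cong[OF conjunct1[OF eq[unfolded prod.inject]], of t] that by simp
      have eq2: "coc w E (\<kappa> t (z i)) = coc w' E (\<kappa> t (z i))" if "t \<in> T" "i \<in> I" for t i
        using fun_cong[OF fun_cong[OF conjunct2[OF eq[unfolded prod.inject]], of i], of t] that by simp
      have key: "coc v E (y t) \<otimes>\<^bsub>H\<^esub> v i t = coc v E (\<kappa> t (z i)) \<otimes>\<^bsub>H\<^esub> coc v E (y (t #> z i))"
        if v: "v \<in> labels" and "t \<in> T" "i \<in> I" for v t i
      proof -
        have zi: "z i \<in> carrier G" and u: "t #> z i \<in> T" using that act_closed z_carrier by auto
        have \<kappa>: "\<kappa> t (z i) \<in> E" by (rule \<kappa>_mem[OF that(2) zi])
        have "coc v E (y t) \<otimes>\<^bsub>H\<^esub> v i t = coc v E (y t \<otimes> z i)"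
          using coc_mult[OF v ET y_carrier[OF that(2)] zi] y_coset[OF that(2)] coc(2)[OF v that(3,2)] by simp
        also have "\<dots> = coc v E (\<kappa> t (z i) \<otimes> y (t #> z i))" using \<kappa>_shift[OF that(2) zi] by simp
        also have "\<dots> = coc v E (\<kappa> t (z i)) \<otimes>\<^bsub>H\<^esub> coc v E (y (t #> z i))"
          using coc_mult[OF v ET E_carrier[OF \<kappa>] y_carrier[OF u]] coset_join2[OF E_carrier[OF \<kappa>] E(1) \<kappa>] by simp
        finally show ?thesis .
      qed
      show "w = w'"
      proof (rule labels_eqI[OF w])
        fix i t assume it: "i \<in> I" "t \<in> T"
        have u: "t #> z i \<in> T" using it act_closed z_carrier by auto
        have "coc w E (y t) \<otimes>\<^bsub>H\<^esub> w i t = coc w E (y t) \<otimes>\<^bsub>H\<^esub> w' i t"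
          using key[OF w(1) it(2,1)] key[OF w(2) it(2,1)] eq1[OF it(2)] eq1[OF u] eq2[OF it(2,1)] by simp
        then show "w i t = w' i t"
          using coc_closed[OF w(1) ET y_carrier[OF it(2)]] labels_mem[OF w(1) it] labels_mem[OF w(2) it] by simp
      qed
    qed
  qed
  also have "\<dots> \<le> card A ^ ?n * card ?A' ^ (?n * ?r)"
  proof -
    have "card (\<Pi>\<^sub>E i\<in>I. \<Pi>\<^sub>E t\<in>T. {a \<in> H'. \<alpha> a = cK t (z i)}) = (\<Prod>i\<in>I. \<Prod>t\<in>T. card {a \<in> H'. \<alpha> a = cK t (z i)})"
      using finI finT by (simp add: card_PiE)
    also have "\<dots> \<le> (\<Prod>i\<in>I. \<Prod>t\<in>T. card ?A')"
      by (intro prod_mono conjI card_hom_fibre[OF H(1) K \<alpha>(1) H'(1) finH']) auto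
    also have "\<dots> = card ?A' ^ (?n * ?r)" by (simp add: power_mult)
    finally show ?thesis using finT by (simp add: card_cartesian_product card_PiE)
  qed
  finally have W: "card ?W \<le> card A ^ ?n * card ?A' ^ (?n * ?r)" .
  have n: "?n \<ge> 1" using finT ET by (metis One_nat_def Suc_leI card_gt_0_iff empty_iff)
  let ?h = "card (carrier H)"
  \<comment> \<open>The transports cost at most \<open>2 ^ (card A * ?n)\<close>, and halving the
    choice for every label gains \<open>2 ^ (?n * ?r)\<close>. The factor \<open>4 * 2 ^ ?h\<close>
    makes room for summing over all proper subgroups of \<open>H\<close>.\<close>
  have "4 * 2 ^ ?h * card A ^ ?n \<le> 2 ^ (?n * ?r)"
  proof -
    have "card A ^ ?n \<le> (2 ^ card A) ^ ?n" by (rule power_mono[OF less_imp_le[OF less_exp]]) simp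
    then have "4 * 2 ^ ?h * card A ^ ?n \<le> 2 ^ 2 * 2 ^ ?h * 2 ^ (card A * ?n)" by (simp add: power_mult)
    also have "\<dots> = 2 ^ (2 + ?h + card A * ?n)" by (simp add: power_add)
    also have "2 + ?h + card A * ?n \<le> ?n * (?h + card A + 2)"
      using n by (cases ?n) (auto simp: algebra_simps)
    then have "2 + ?h + card A * ?n \<le> ?n * ?r" using mult_le_mono2[OF I, of ?n] by linarith
    then have "(2::nat) ^ (2 + ?h + card A * ?n) \<le> 2 ^ (?n * ?r)"
      by (rule power_increasing) simp
    finally show ?thesis by simp
  qed
  then have "4 * 2 ^ ?h * (card A ^ ?n * card ?A' ^ (?n * ?r)) \<le> 2 ^ (?n * ?r) * card ?A' ^ (?n * ?r)"
    using mult_le_mono1[of "4 * 2 ^ ?h * card A ^ ?n" "2 ^ (?n * ?r)" "card ?A' ^ (?n * ?r)"]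
    by (simp only: mult.assoc)
  also have "\<dots> = (2 * card ?A') ^ (?n * ?r)" by (simp add: power_mult_distrib)
  also have "\<dots> \<le> card A ^ (?n * ?r)" by (rule power_mono[OF A2]) simp
  finally show ?thesis
    using W card_labels by (metis (no_types, lifting) mult_le_mono2 order_trans)
qed (simp only: card.empty)

end

section \<open>Normal subgroups acting on a coset space\<close>

context group
begin

lemma finite_perm_group_normal:
  assumes E: "subgroup E G" "finite (rcosets E)" and N: "subgroup N G"
  shows "finite_perm_group (rcosets E) ((\<lambda>x. \<lambda>t\<in>rcosets E. t #> x) ` N)"
proof -
  have Nc: "x \<in> carrier G" if "x \<in> N" for x by (rule subgroup.mem_carrier[OF N that])
  show ?thesis
  proof (unfold_locales)
    show "finite (rcosets E)" by (rule E(2))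
    show "(\<lambda>x. \<lambda>t\<in>rcosets E. t #> x) ` N \<subseteq> rcosets E \<rightarrow>\<^sub>E rcosets E"
      using rcosets_act[OF E(1)] Nc by auto
    show "(\<lambda>x. \<lambda>t\<in>rcosets E. t #> x) ` N \<noteq> {}" using subgroup.one_closed[OF N] by blast
  next
    fix s s' assume "s \<in> (\<lambda>x. \<lambda>t\<in>rcosets E. t #> x) ` N" "s' \<in> (\<lambda>x. \<lambda>t\<in>rcosets E. t #> x) ` N"
    then obtain x x' where x: "x \<in> N" "s = (\<lambda>t\<in>rcosets E. t #> x)" "x' \<in> N" "s' = (\<lambda>t\<in>rcosets E. t #> x')" by blast
    have "(\<lambda>t\<in>rcosets E. s' (s t)) = (\<lambda>t\<in>rcosets E. t #> (x \<otimes> x'))"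
      using rcosets_act[OF E(1)] rcosets_act_assoc[OF E(1)] Nc x by (simp cong: restrict_cong)
    then show "(\<lambda>t\<in>rcosets E. s' (s t)) \<in> (\<lambda>x. \<lambda>t\<in>rcosets E. t #> x) ` N"
      using subgroup.m_closed[OF N x(1,3)] by blast
  next
    fix s assume "s \<in> (\<lambda>x. \<lambda>t\<in>rcosets E. t #> x) ` N"
    then obtain x where x: "x \<in> N" "s = (\<lambda>t\<in>rcosets E. t #> x)" by blast
    show "\<exists>s'\<in>(\<lambda>x. \<lambda>t\<in>rcosets E. t #> x) ` N. \<forall>t\<in>rcosets E. s' (s t) = t"
      using rcosets_act[OF E(1)] rcosets_act_inv(1)[OF E(1)] Nc[OF x(1)] x(2) subgroup.m_inv_closed[OF N x(1)]
      by (intro bexI[of _ "\<lambda>t\<in>rcosets E. t #> inv x"]) auto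
  qed
qed

text \<open>By normality \<open>E x a = (E a) (inv a x a)\<close> with the last factor in
  \<open>N\<close>, so translation by \<open>a\<close> embeds the orbit of \<open>E\<close> into
  that of \<open>E a\<close>.\<close>

lemma card_normal_orbit:
  assumes E: "subgroup E G" and N: "N \<lhd> G" and t: "t \<in> rcosets E" and fin: "finite (rcosets E)"
  shows "card ((\<lambda>x. E #> x) ` N) \<le> card ((\<lambda>s. s t) ` (\<lambda>x. \<lambda>t\<in>rcosets E. t #> x) ` N)"
proof -
  have Nc: "x \<in> carrier G" if "x \<in> N" for x by (rule subgroup.mem_carrier[OF normal_imp_subgroup[OF N] that])
  obtain a where a: "a \<in> carrier G" "t = E #> a" using t by (auto simp: RCOSETS_def)
  have im: "(\<lambda>s. s t) ` (\<lambda>x. \<lambda>t\<in>rcosets E. t #> x) ` N = (\<lambda>x. t #> x) ` N"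
    using t by (auto simp: image_image)
  show ?thesis unfolding im
  proof (rule card_inj_on_le[where f = "\<lambda>u. u #> a"])
    have sub: "(\<lambda>x. E #> x) ` N \<subseteq> rcosets E"
      using Nc by (auto intro: rcosetsI[OF subgroup.subset[OF E]])
    show "inj_on (\<lambda>u. u #> a) ((\<lambda>x. E #> x) ` N)"
      by (rule inj_on_subset[OF bij_betw_imp_inj_on[OF rcosets_act_bij[OF E a(1)]] sub])
    show "(\<lambda>u. u #> a) ` (\<lambda>x. E #> x) ` N \<subseteq> (\<lambda>x. t #> x) ` N"
    proof clarify
      fix x assume x: "x \<in> N"
      have "inv a \<otimes> x \<otimes> a \<in> N" by (rule normal.inv_op_closed1[OF N a(1) x])
      moreover have "E #> x #> a = t #> (inv a \<otimes> x \<otimes> a)"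
        using a Nc[OF x] by (simp add: coset_mult_assoc[OF subgroup.subset[OF E]] m_assoc[symmetric])
      ultimately show "E #> x #> a \<in> (\<lambda>x. t #> x) ` N" by blast
    qed
    show "finite ((\<lambda>x. t #> x) ` N)"
      by (rule finite_subset[OF _ fin]) (use rcosets_act[OF E t] Nc in auto)
  qed
qed

end

context lifting_problem
begin

text \<open>If the cocycle of \<open>w\<close> is trivial on \<open>N\<^sub>1 \<inter> N\<^sub>2\<close>, then its values at \<open>N\<^sub>1\<close> and at \<open>N\<^sub>2\<close> satisfy the
  relations coming from the fact that \<open>N\<^sub>1\<close> and \<open>N\<^sub>2\<close> commute modulo \<open>N\<^sub>1 \<inter> N\<^sub>2\<close>. Hence \<open>w\<close> is determined by
  the full values at the few elements \<open>hs\<close> and by values at orbit representatives.\<close>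

lemma card_labels_trivial_on:
  assumes N: "N1 \<lhd> G" "N2 \<lhd> G" "N1 \<inter> N2 \<subseteq> E"
    and hs: "hs \<subseteq> N2" "finite hs" "card hs \<le> 10" and g: "g \<in> N1"
    and Ph: "spanning T ((\<lambda>x. \<lambda>t\<in>T. t #> x) ` hs) Ph" "8 * card Ph \<le> card T"
    and Pg: "spanning T {\<lambda>t\<in>T. t #> g} Pg" "4 * card Pg \<le> 3 * card T"
    and r: "card I \<ge> 89" and A2: "card A \<ge> 2"
  shows "2 * card {w \<in> labels. \<forall>x\<in>N1 \<inter> N2. coc w E x = \<one>\<^bsub>H\<^esub>} \<le> card labels"
proof -
  let ?n = "card T" and ?r = "card I" and ?a = "card A"
  let ?W = "{w \<in> labels. \<forall>x\<in>N1 \<inter> N2. coc w E x = \<one>\<^bsub>H\<^esub>}"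
  have N1c: "x \<in> N1 \<Longrightarrow> x \<in> carrier G" and N2c: "x \<in> N2 \<Longrightarrow> x \<in> carrier G" for x
    by (rule subgroup.mem_carrier[OF normal_imp_subgroup[OF N(1)]], assumption)
      (rule subgroup.mem_carrier[OF normal_imp_subgroup[OF N(2)]], assumption)
  have R: "N1 \<inter> N2 \<lhd> G" by (rule normal_subgroup_intersect[OF N(1,2)])
  have fixR: "t #> x = t" if "x \<in> N1 \<inter> N2" "t \<in> T" for x t
    by (rule normal_act_trivial[OF R N(3) E(1) that(2,1)])
  \<comment> \<open>Triviality at the base point spreads to every \<open>t\<close> by conjugation
    with \<open>y t\<close>, as \<open>N1 \<inter> N2\<close> is normal and fixes all
    cosets.\<close>
  have triv: "coc w t x = \<one>\<^bsub>H\<^esub>" if w: "w \<in> ?W" and t: "t \<in> T" and x: "x \<in> N1 \<inter> N2" for w t x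
  proof -
    have wl: "w \<in> labels" using w by simp
    have xc: "x \<in> carrier G" using x N1c by auto
    have yt: "y t \<in> carrier G" by (rule y_carrier[OF t])
    let ?x = "y t \<otimes> x \<otimes> inv y t"
    have x': "?x \<in> N1 \<inter> N2" by (rule normal.inv_op_closed2[OF R yt x])
    then have x'c: "?x \<in> carrier G" using N1c by auto
    have "coc w E (?x \<otimes> y t) = coc w E ?x \<otimes>\<^bsub>H\<^esub> coc w (E #> ?x) (y t)"
      by (rule coc_mult[OF wl ET x'c yt])
    also have "\<dots> = coc w E (y t)"
      using w x' fixR[OF x' ET] coc_closed[OF wl ET yt] by simp
    also have "?x \<otimes> y t = y t \<otimes> x" using yt xc by (simp add: m_assoc)
    also have "coc w E (y t \<otimes> x) = coc w E (y t) \<otimes>\<^bsub>H\<^esub> coc w t x"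
      using coc_mult[OF wl ET yt xc] y_coset[OF t] by simp
    finally show ?thesis using coc_closed[OF wl ET yt] coc_closed[OF wl t xc] by simp
  qed
  \<comment> \<open>\<open>x h\<close> and \<open>h x\<close> differ by a commutator in
    \<open>N1 \<inter> N2\<close>, where the cocycle is trivial and which fixes
    \<open>t\<close>.\<close>
  have comm: "coc w t x \<otimes>\<^bsub>H\<^esub> coc w (t #> x) h = coc w t h \<otimes>\<^bsub>H\<^esub> coc w (t #> h) x"
    if w: "w \<in> ?W" and t: "t \<in> T" and x: "x \<in> N1" and h: "h \<in> N2" for w t x h
  proof -
    have wl: "w \<in> labels" using w by simp
    have xc: "x \<in> carrier G" and hc: "h \<in> carrier G" using x h N1c N2c by auto
    let ?k = "x \<otimes> h \<otimes> inv x \<otimes> inv h"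
    have "x \<otimes> h \<otimes> inv x \<in> N2" by (rule normal.inv_op_closed2[OF N(2) xc h])
    then have k2: "?k \<in> N2"
      by (rule subgroup.m_closed[OF normal_imp_subgroup[OF N(2)] _ subgroup.m_inv_closed[OF normal_imp_subgroup[OF N(2)] h]])
    have "h \<otimes> inv x \<otimes> inv h \<in> N1"
      by (rule normal.inv_op_closed2[OF N(1) hc subgroup.m_inv_closed[OF normal_imp_subgroup[OF N(1)] x]])
    then have "x \<otimes> (h \<otimes> inv x \<otimes> inv h) \<in> N1"
      by (rule subgroup.m_closed[OF normal_imp_subgroup[OF N(1)] x])
    then have k: "?k \<in> N1 \<inter> N2" using k2 xc hc by (simp add: m_assoc)
    have kc: "?k \<in> carrier G" using xc hc by simp
    have "inv h \<otimes> (h \<otimes> x) = x" using xc hc by (simp add: m_assoc[symmetric])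
    then have "coc w t (x \<otimes> h) = coc w t (?k \<otimes> (h \<otimes> x))"
      using xc hc by (simp add: m_assoc)
    also have "\<dots> = coc w t ?k \<otimes>\<^bsub>H\<^esub> coc w (t #> ?k) (h \<otimes> x)"
      by (rule coc_mult[OF wl t kc]) (use xc hc in simp)
    also have "\<dots> = coc w t (h \<otimes> x)"
      using triv[OF w t k] fixR[OF k t] coc_closed[OF wl t] xc hc by simp
    finally show ?thesis using coc_mult[OF wl t xc hc] coc_mult[OF wl t hc xc] by simp
  qed
  \<comment> \<open>From \<open>g \<otimes> z i = z i \<otimes> ?g i\<close> the label at
    \<open>t #> g\<close> follows from the label at \<open>t\<close>, once the values at
    \<open>g\<close> and at \<open>?g i\<close> are known.\<close>
  let ?g = "\<lambda>i. inv z i \<otimes> g \<otimes> z i"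
  have g': "?g i \<in> N1" if "i \<in> I" for i by (rule normal.inv_op_closed1[OF N(1) z_carrier[OF that] g])
  have PhT: "Ph \<subseteq> T" and PgT: "Pg \<subseteq> T" using Ph Pg by (auto simp: spanning_def)
  let ?f = "\<lambda>w. (\<lambda>h\<in>hs. \<lambda>t\<in>T. coc w t h, \<lambda>t\<in>Ph. coc w t g,
      \<lambda>i\<in>I. \<lambda>t\<in>Ph. coc w t (?g i), \<lambda>i\<in>I. \<lambda>t\<in>Pg. w i t)"
  let ?F = "\<lambda>t x. {a \<in> carrier H. \<alpha> a = cK t x}"
  let ?D = "(\<Pi>\<^sub>E h\<in>hs. \<Pi>\<^sub>E t\<in>T. ?F t h) \<times> (\<Pi>\<^sub>E t\<in>Ph. ?F t g) \<times>
      (\<Pi>\<^sub>E i\<in>I. \<Pi>\<^sub>E t\<in>Ph. ?F t (?g i)) \<times> (\<Pi>\<^sub>E i\<in>I. \<Pi>\<^sub>E t\<in>Pg. ?F t (z i))"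
  have finP: "finite Ph" "finite Pg" using finite_subset finT PhT PgT by auto
  have finF: "finite (?F t x)" for t x using H(2) by simp
  have finD: "finite ?D"
    using finP finF finI finT hs(2) by (intro finite_cartesian_product finite_PiE) auto
  have F: "coc w t x \<in> ?F t x" if "w \<in> labels" "t \<in> T" "x \<in> carrier G" for w t x
    using coc_closed[OF that] coc_lift[OF that] by simp
  have "card ?W \<le> card ?D"
  proof (rule card_inj_on_le[OF _ _ finD])
    show "?f ` ?W \<subseteq> ?D"
    proof
      fix p assume "p \<in> ?f ` ?W"
      then obtain w where w: "w \<in> labels" "p = ?f w" by blast
      have 1: "(\<lambda>h\<in>hs. \<lambda>t\<in>T. coc w t h) \<in> (\<Pi>\<^sub>E h\<in>hs. \<Pi>\<^sub>E t\<in>T. ?F t h)"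
        using F[OF w(1)] N2c hs(1) by (intro restrict_PiE_iff[THEN iffD2] ballI) blast
      have 2: "(\<lambda>t\<in>Ph. coc w t g) \<in> (\<Pi>\<^sub>E t\<in>Ph. ?F t g)"
        using F[OF w(1)] N1c[OF g] PhT by (intro restrict_PiE_iff[THEN iffD2] ballI) blast
      have 3: "(\<lambda>i\<in>I. \<lambda>t\<in>Ph. coc w t (?g i)) \<in> (\<Pi>\<^sub>E i\<in>I. \<Pi>\<^sub>E t\<in>Ph. ?F t (?g i))"
        using F[OF w(1)] N1c[OF g'] PhT by (intro restrict_PiE_iff[THEN iffD2] ballI) blast
      have 4: "(\<lambda>i\<in>I. \<lambda>t\<in>Pg. w i t) \<in> (\<Pi>\<^sub>E i\<in>I. \<Pi>\<^sub>E t\<in>Pg. ?F t (z i))"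
        using labels_mem[OF w(1)] PgT by (intro restrict_PiE_iff[THEN iffD2] ballI) blast
      show "p \<in> ?D" unfolding w(2) using 1 2 3 4 by (simp only: mem_Times_iff fst_conv snd_conv simp_thms)
    qed
    show "inj_on ?f ?W"
    proof (rule inj_onI)
      fix w w' assume W: "w \<in> ?W" "w' \<in> ?W" and eq: "?f w = ?f w'"
      then have w: "w \<in> labels" "w' \<in> labels" by auto
      note eqs = eq[unfolded prod.inject]
      have eh: "coc w t h = coc w' t h" if "h \<in> hs" "t \<in> T" for t h
        using fun_cong[OF fun_cong[OF conjunct1[OF eqs], of h], of t] that by simp
      have eg: "coc w t g = coc w' t g" if "t \<in> Ph" for t
        using fun_cong[OF conjunct1[OF conjunct2[OF eqs]], of t] that by simp
      have eg': "coc w t (?g i) = coc w' t (?g i)" if "i \<in> I" "t \<in> Ph" for t i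
        using fun_cong[OF fun_cong[OF conjunct1[OF conjunct2[OF conjunct2[OF eqs]]], of i], of t] that by simp
      have ez: "w i t = w' i t" if "i \<in> I" "t \<in> Pg" for t i
        using fun_cong[OF fun_cong[OF conjunct2[OF conjunct2[OF conjunct2[OF eqs]]], of i], of t] that by simp
      \<comment> \<open>By \<open>comm\<close>, the points where two lifts agree at \<open>x\<close>
        form a set closed under \<open>hs\<close>, since the values at \<open>hs\<close> are
        recorded on all of \<open>T\<close>. So for \<open>x\<close> in \<open>N1\<close> the values
        on \<open>Ph\<close> suffice.\<close>
      have spread: "coc w t x = coc w' t x"
        if x: "x \<in> N1" and base: "\<And>t. t \<in> Ph \<Longrightarrow> coc w t x = coc w' t x" and t: "t \<in> T" for x t
      proof -
        let ?X = "{t \<in> T. coc w t x = coc w' t x}"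
        have xc: "x \<in> carrier G" by (rule N1c[OF x])
        have "t #> h \<in> ?X" if h: "h \<in> hs" and t: "t \<in> ?X" for h t
        proof -
          have h2: "h \<in> N2" and hc: "h \<in> carrier G" using h hs(1) N2c by auto
          have tT: "t \<in> T" using t by simp
          have th: "t #> h \<in> T" and tx: "t #> x \<in> T" using act_closed tT hc xc by auto
          have "coc w t h \<otimes>\<^bsub>H\<^esub> coc w (t #> h) x = coc w t h \<otimes>\<^bsub>H\<^esub> coc w' (t #> h) x"
            using comm[OF W(1) tT x h2] comm[OF W(2) tT x h2] eh[OF h tT] eh[OF h tx] t by simp
          then have "coc w (t #> h) x = coc w' (t #> h) x"
            using coc_closed[OF w(1) tT hc] coc_closed[OF w(1) th xc] coc_closed[OF w(2) th xc] by simp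
          with th show ?thesis by simp
        qed
        then have "\<forall>s\<in>(\<lambda>x. \<lambda>t\<in>T. t #> x) ` hs. s ` ?X \<subseteq> ?X" by auto
        moreover have "Ph \<subseteq> ?X" using PhT base by auto
        moreover have "?X \<subseteq> T" by auto
        ultimately have "?X = T" using Ph(1) unfolding spanning_def by blast
        with t show ?thesis by blast
      qed
      have eqg: "coc w t g = coc w' t g" if "t \<in> T" for t
        by (rule spread[OF g eg that])
      have eqg': "coc w t (?g i) = coc w' t (?g i)" if "i \<in> I" "t \<in> T" for t i
        by (rule spread[OF g'[OF that(1)] eg'[OF that(1)] that(2)])
      have rel: "coc v t g \<otimes>\<^bsub>H\<^esub> v i (t #> g) = v i t \<otimes>\<^bsub>H\<^esub> coc v (t #> z i) (?g i)"
        if v: "v \<in> labels" and i: "i \<in> I" and t: "t \<in> T" for v i t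
      proof -
        have zi: "z i \<in> carrier G" and gc: "g \<in> carrier G" and gi: "?g i \<in> carrier G"
          using z_carrier[OF i] N1c[OF g] N1c[OF g'[OF i]] by auto
        have tg: "t #> g \<in> T" by (rule act_closed[OF t gc])
        have "coc v t g \<otimes>\<^bsub>H\<^esub> v i (t #> g) = coc v t (g \<otimes> z i)"
          using coc_mult[OF v t gc zi] coc(2)[OF v i tg] by simp
        also have "g \<otimes> z i = z i \<otimes> ?g i" using zi gc by (simp add: m_assoc[symmetric])
        also have "coc v t (z i \<otimes> ?g i) = v i t \<otimes>\<^bsub>H\<^esub> coc v (t #> z i) (?g i)"
          using coc_mult[OF v t zi gi] coc(2)[OF v i t] by simp
        finally show ?thesis .
      qed
      show "w = w'"
      proof (rule labels_eqI[OF w])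
        fix i t assume i: "i \<in> I" and t: "t \<in> T"
        let ?X = "{t \<in> T. w i t = w' i t}"
        have gc: "g \<in> carrier G" by (rule N1c[OF g])
        have "t #> g \<in> ?X" if t: "t \<in> ?X" for t
        proof -
          have tT: "t \<in> T" using t by simp
          have tg: "t #> g \<in> T" and tz: "t #> z i \<in> T" using act_closed tT gc z_carrier[OF i] by auto
          have "coc w t g \<otimes>\<^bsub>H\<^esub> w i (t #> g) = coc w t g \<otimes>\<^bsub>H\<^esub> w' i (t #> g)"
            using rel[OF w(1) i tT] rel[OF w(2) i tT] eqg[OF tT] eqg'[OF i tz] t by simp
          then have "w i (t #> g) = w' i (t #> g)"
            using coc_closed[OF w(1) tT gc] labels_mem[OF w(1) i tg] labels_mem[OF w(2) i tg] by simp
          with tg show ?thesis by simp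
        qed
        then have "\<forall>s\<in>{\<lambda>t\<in>T. t #> g}. s ` ?X \<subseteq> ?X" by auto
        moreover have "Pg \<subseteq> ?X" using PgT ez[OF i] by auto
        moreover have "?X \<subseteq> T" by auto
        ultimately have "?X = T" using Pg(1) unfolding spanning_def by blast
        with t show "w i t = w' i t" by blast
      qed
    qed
  qed
  also have "card ?D = ?a ^ (card hs * ?n + card Ph + card Ph * ?r + card Pg * ?r)"
  proof -
    have cF: "card (?F t x) = ?a" if "t \<in> T" "x \<in> carrier G" for t x
      by (rule card_fibre[OF cK_closed[OF that]])
    have "card (\<Pi>\<^sub>E h\<in>hs. \<Pi>\<^sub>E t\<in>T. ?F t h) = (\<Prod>h\<in>hs. \<Prod>t\<in>T. ?a)"
      using hs(1) N2c by (subst card_PiE[OF hs(2)], intro prod.cong refl) (subst card_PiE[OF finT], intro prod.cong refl cF, auto)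
    moreover have "card (\<Pi>\<^sub>E t\<in>Ph. ?F t g) = (\<Prod>t\<in>Ph. ?a)"
      using PhT N1c[OF g] by (subst card_PiE[OF finP(1)], intro prod.cong refl cF) auto
    moreover have "card (\<Pi>\<^sub>E i\<in>I. \<Pi>\<^sub>E t\<in>Ph. ?F t (?g i)) = (\<Prod>i\<in>I. \<Prod>t\<in>Ph. ?a)"
      using PhT N1c[OF g'] by (subst card_PiE[OF finI], intro prod.cong refl) (subst card_PiE[OF finP(1)], intro prod.cong refl cF, auto)
    moreover have "card (\<Pi>\<^sub>E i\<in>I. \<Pi>\<^sub>E t\<in>Pg. ?F t (z i)) = (\<Prod>i\<in>I. \<Prod>t\<in>Pg. ?a)"
      using PgT z_carrier by (subst card_PiE[OF finI], intro prod.cong refl) (subst card_PiE[OF finP(2)], intro prod.cong refl cF, auto)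
    ultimately show ?thesis
      by (simp only: card_cartesian_product prod_constant power_mult[symmetric] power_add[symmetric])
        (simp add: algebra_simps)
  qed
  finally have le: "card ?W \<le> ?a ^ (card hs * ?n + card Ph + card Ph * ?r + card Pg * ?r)" .
  have n: "?n \<ge> 1" using finT ET by (metis One_nat_def Suc_leI card_gt_0_iff empty_iff)
  \<comment> \<open>Multiplied by 8 and with \<open>n\<close>, \<open>r\<close> for
    \<open>?n\<close>, \<open>?r\<close>, it suffices that
    \<open>80 n + n + n r + 6 n r + 8 \<le> 8 n r\<close>, that is
    \<open>81 n + 8 \<le> n r\<close>; as \<open>n \<ge> 1\<close>, this is where
    \<open>r \<ge> 89\<close> comes from. The successor leaves a spare factor
    \<open>card A \<ge> 2\<close>.\<close>
  have "Suc (card hs * ?n + card Ph + card Ph * ?r + card Pg * ?r) \<le> ?n * ?r"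
  proof -
    have "8 * (card hs * ?n) \<le> 80 * ?n" using mult_le_mono1[OF hs(3), of ?n] by linarith
    moreover have "8 * (card Ph * ?r) \<le> ?n * ?r"
      using mult_le_mono1[OF Ph(2), of ?r] by (simp only: mult.assoc)
    moreover have "4 * (card Pg * ?r) \<le> 3 * (?n * ?r)"
      using mult_le_mono1[OF Pg(2), of ?r] by (simp only: mult.assoc)
    moreover have "89 * ?n \<le> ?n * ?r" using mult_le_mono1[OF r, of ?n] by (simp only: mult.commute)
    moreover note Ph(2) n
    ultimately show ?thesis by linarith
  qed
  then have "?a ^ Suc (card hs * ?n + card Ph + card Ph * ?r + card Pg * ?r) \<le> ?a ^ (?n * ?r)"
    using A2 by (intro power_increasing) auto
  moreover have "2 * ?a ^ (card hs * ?n + card Ph + card Ph * ?r + card Pg * ?r)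
      \<le> ?a ^ Suc (card hs * ?n + card Ph + card Ph * ?r + card Pg * ?r)"
    using A2 by simp
  ultimately show ?thesis using le card_labels by linarith
qed

text \<open>A union bound: lifts into proper subgroups are at most a quarter of all lifts, lifts
  trivial on \<open>N1 \<inter> N2\<close> at most a half. Any other lift is surjective, so it sends
  \<open>N1 \<inter> N2\<close> to a nontrivial normal subgroup of \<open>H\<close> inside
  \<open>A\<close>, which is \<open>A\<close> by minimality.\<close>

lemma exists_lift_onto_kernel:
  assumes N: "N1 \<lhd> G" "N2 \<lhd> G" "N1 \<inter> N2 \<subseteq> E" "\<And>x. x \<in> N1 \<inter> N2 \<Longrightarrow> \<phi> x = \<one>\<^bsub>K\<^esub>"
    and N1: "\<not> N1 \<subseteq> E" and N2: "32 \<le> card ((\<lambda>x. E #> x) ` N2)"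
    and A: "A \<noteq> {\<one>\<^bsub>H\<^esub>}" "\<And>B. B \<lhd> H \<Longrightarrow> B \<subseteq> A \<Longrightarrow> B = {\<one>\<^bsub>H\<^esub>} \<or> B = A"
    and r: "card I \<ge> card (carrier H) + card A + 2" "card I \<ge> 89"
  obtains l where "l \<in> chom (G\<lparr>carrier := E\<rparr>) (\<lambda>i. U i \<inter> E) H"
    "\<And>x. x \<in> E \<Longrightarrow> \<alpha> (l x) = \<phi> x" "l ` (N1 \<inter> N2) = A"
proof -
  let ?R = "N1 \<inter> N2"
  have R: "?R \<lhd> G" by (rule normal_subgroup_intersect[OF N(1,2)])
  have A2: "card A \<ge> 2"
  proof (rule ccontr)
    assume "\<not> 2 \<le> card A"
    then have "card A = 1" using card_A_pos by linarith
    then obtain a where "A = {a}" by (auto simp: card_1_singleton_iff)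
    then show False using A(1) subgroup.one_closed[OF subgroup_A] by auto
  qed
  obtain hs Ph where hs: "hs \<subseteq> N2" "finite hs" "card hs \<le> 10"
    and Ph: "spanning T ((\<lambda>x. \<lambda>t\<in>T. t #> x) ` hs) Ph" "8 * card Ph \<le> card T"
  proof -
    interpret P: finite_perm_group T "(\<lambda>x. \<lambda>t\<in>T. t #> x) ` N2"
      by (rule finite_perm_group_normal[OF E(1) finT normal_imp_subgroup[OF N(2)]])
    have "32 \<le> card ((\<lambda>s. s t) ` (\<lambda>x. \<lambda>t\<in>T. t #> x) ` N2)" if "t \<in> T" for t
      using card_normal_orbit[OF E(1) N(2) that finT] N2 by linarith
    then obtain S P where S: "S \<subseteq> (\<lambda>x. \<lambda>t\<in>T. t #> x) ` N2" "finite S" "card S \<le> 10" "spanning T S P" "8 * card P \<le> card T"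
      using P.spanning_few by metis
    \<comment> \<open>One preimage in \<open>N2\<close> per permutation, so that \<open>hs\<close>
      is no larger than \<open>S\<close>.\<close>
    then obtain hs where hs: "hs \<subseteq> N2" "inj_on (\<lambda>x. \<lambda>t\<in>T. t #> x) hs" "S = (\<lambda>x. \<lambda>t\<in>T. t #> x) ` hs"
      unfolding subset_image_inj by metis
    have "finite hs" using S(2) hs(2,3) finite_image_iff by blast
    moreover have "card hs \<le> 10" using S(3) hs(3) card_image[OF hs(2)] by simp
    ultimately show ?thesis using that hs(1) S(4,5) hs(3) by blast
  qed
  obtain g Pg where g: "g \<in> N1" and Pg: "spanning T {\<lambda>t\<in>T. t #> g} Pg" "4 * card Pg \<le> 3 * card T"
  proof -
    interpret P: finite_perm_group T "(\<lambda>x. \<lambda>t\<in>T. t #> x) ` N1"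
      by (rule finite_perm_group_normal[OF E(1) finT normal_imp_subgroup[OF N(1)]])
    \<comment> \<open>An element of \<open>N1\<close> outside \<open>E\<close> moves the coset
      \<open>E\<close>, so by normality every orbit of \<open>N1\<close> has at least two
      points.\<close>
    obtain x0 where x0: "x0 \<in> N1" "x0 \<notin> E" using N1 by blast
    have x0c: "x0 \<in> carrier G" by (rule subgroup.mem_carrier[OF normal_imp_subgroup[OF N(1)] x0(1)])
    have one: "\<one> \<in> N1" by (rule subgroup.one_closed[OF normal_imp_subgroup[OF N(1)]])
    have ne: "E #> \<one> \<noteq> E #> x0"
      using coset_join1[OF _ x0c E(1)] x0(2) subgroup.subset[OF E(1)] by auto
    have sub: "{E #> \<one>, E #> x0} \<subseteq> (\<lambda>x. E #> x) ` N1" using x0(1) one by auto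
    have fin: "finite ((\<lambda>x. E #> x) ` N1)"
      by (rule finite_subset[OF _ finT])
        (use rcosetsI[OF subgroup.subset[OF E(1)]] subgroup.mem_carrier[OF normal_imp_subgroup[OF N(1)]] in auto)
    have "2 \<le> card ((\<lambda>x. E #> x) ` N1)" using card_mono[OF fin sub] ne by simp
    then have "2 \<le> card ((\<lambda>s. s t) ` (\<lambda>x. \<lambda>t\<in>T. t #> x) ` N1)" if "t \<in> T" for t
      using card_normal_orbit[OF E(1) N(1) that finT] by linarith
    from P.spanning_one[OF this] obtain s P
      where s: "s \<in> (\<lambda>x. \<lambda>t\<in>T. t #> x) ` N1" "spanning T {s} P" "4 * card P \<le> 3 * card T" by blast
    then obtain g where "g \<in> N1" "s = (\<lambda>t\<in>T. t #> g)" by blast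
    with s(2,3) show ?thesis using that by blast
  qed
  have "\<exists>w\<in>labels. coc w E ` ?R = A"
  proof (rule ccontr)
    assume no: "\<not> ?thesis"
    let ?W1 = "\<lambda>H'. {w \<in> labels. coc w E ` E \<subseteq> H'}" and ?W2 = "{w \<in> labels. \<forall>x\<in>?R. coc w E x = \<one>\<^bsub>H\<^esub>}"
    let ?S = "{H'. subgroup H' H \<and> H' \<noteq> carrier H}"
    let ?h = "card (carrier H)"
    have fin_labels: "finite labels" unfolding labels_def
      using finI finT H(2) by (intro finite_PiE) auto
    have Ssub: "?S \<subseteq> Pow (carrier H)" using subgroup.subset by blast
    have finS: "finite ?S" by (rule finite_subset[OF Ssub]) (simp add: H(2))
    have "labels \<subseteq> (\<Union>H'\<in>?S. ?W1 H') \<union> ?W2"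
    proof
      fix w assume w: "w \<in> labels"
      have EG: "group (G\<lparr>carrier := E\<rparr>)" by (rule subgroup.subgroup_is_group[OF E(1) is_group])
      interpret l: group_hom "G\<lparr>carrier := E\<rparr>" H "coc w E"
        by (rule group_homI[OF EG H(1) chom_hom[OF coc_E_chom[OF w]]])
      show "w \<in> (\<Union>H'\<in>?S. ?W1 H') \<union> ?W2"
      proof (cases "coc w E ` E = carrier H")
        case False
        have "subgroup (coc w E ` E) H" using l.img_is_subgroup by simp
        then show ?thesis using w False by auto
      next
        case True
        have "?R \<lhd> G\<lparr>carrier := E\<rparr>"
          by (rule normal_restrict_supergroup[OF E(1) R N(3)])
        from normal.surj_hom_normal_subgroup[OF this l.group_hom_axioms]
        have nor: "coc w E ` ?R \<lhd> H" using True by simp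
        have "coc w E ` ?R \<subseteq> A"
          using N(3,4) coc_E_lift[OF w] coc_closed[OF w ET E_carrier] by (auto simp: A_def)
        from A(2)[OF nor this] have "coc w E ` ?R = {\<one>\<^bsub>H\<^esub>}" using no w by blast
        then show ?thesis using w by blast
      qed
    qed
    then have "card labels \<le> card ((\<Union>H'\<in>?S. ?W1 H') \<union> ?W2)"
      using fin_labels finS by (intro card_mono) auto
    also have "\<dots> \<le> card (\<Union>H'\<in>?S. ?W1 H') + card ?W2" by (rule card_Un_le)
    also have "card (\<Union>H'\<in>?S. ?W1 H') \<le> (\<Sum>H'\<in>?S. card (?W1 H'))" by (rule card_UN_le[OF finS])
    finally have le: "card labels \<le> (\<Sum>H'\<in>?S. card (?W1 H')) + card ?W2" by simp
    have "4 * 2 ^ ?h * (\<Sum>H'\<in>?S. card (?W1 H')) = (\<Sum>H'\<in>?S. 4 * 2 ^ ?h * card (?W1 H'))"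
      by (rule sum_distrib_left)
    also have "\<dots> \<le> (\<Sum>H'\<in>?S. card labels)"
      by (rule sum_mono) (use card_labels_into_subgroup r(1) in auto)
    also have "\<dots> \<le> 2 ^ ?h * card labels"
      using card_mono[OF _ Ssub] H(2) by (simp add: card_Pow)
    finally have "4 * (\<Sum>H'\<in>?S. card (?W1 H')) \<le> card labels" by simp
    moreover have "2 * card ?W2 \<le> card labels"
      by (rule card_labels_trivial_on[OF N(1-3) hs g Ph Pg r(2) A2])
    moreover have "card labels > 0" using card_labels card_A_pos by simp
    ultimately show False using le by linarith
  qed
  then obtain w where "w \<in> labels" "coc w E ` ?R = A" by blast
  then show ?thesis using that coc_E_chom coc_E_lift by blast
qed

end

section \<open>Embedding problems and the diamond\<close>

text \<open>\<open>embeddings_solvable\<close> speaks of groups carried by \<open>nat\<close>, so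
  quotients, whose elements are cosets, have to be renamed before it can be applied.\<close>

lemma quotient_nat_copy:
  assumes "group G" and N: "N \<lhd> G" and fin: "finite (rcosets\<^bsub>G\<^esub> N)"
  obtains Q :: "nat monoid" and h where "group Q" "finite (carrier Q)" "h \<in> hom G Q"
    "h ` carrier G = carrier Q" "\<And>x. x \<in> carrier G \<Longrightarrow> h x = \<one>\<^bsub>Q\<^esub> \<longleftrightarrow> x \<in> N"
proof -
  interpret G: group G by fact
  have NG: "subgroup N G" by (rule normal_imp_subgroup[OF N])
  have F: "group (G Mod N)" by (rule normal.factorgroup_is_group[OF N])
  have finF: "finite (carrier (G Mod N))" using fin by (simp add: FactGroup_def)
  obtain Q :: "nat monoid" and k where Q: "group Q" "finite (carrier Q)" "k \<in> iso (G Mod N) Q"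
    using finite_group_nat_copy[OF F finF] by blast
  have k: "k \<in> hom (G Mod N) Q" "bij_betw k (carrier (G Mod N)) (carrier Q)"
    using Q(3) by (auto simp: iso_def)
  interpret k: group_hom "G Mod N" Q k by (rule group_homI[OF F Q(1) k(1)])
  have r: "(\<lambda>x. N #>\<^bsub>G\<^esub> x) \<in> hom G (G Mod N)" by (rule normal.r_coset_hom_Mod[OF N])
  let ?h = "\<lambda>x. k (N #>\<^bsub>G\<^esub> x)"
  have "?h \<in> hom G Q" using hom_compose[OF r k(1)] by (simp add: comp_def)
  moreover have "?h ` carrier G = carrier Q"
  proof -
    have "carrier (G Mod N) = (\<lambda>x. N #>\<^bsub>G\<^esub> x) ` carrier G" by (rule carrier_FactGroup)
    then show ?thesis using k(2) by (simp add: bij_betw_def image_image)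
  qed
  moreover have "?h x = \<one>\<^bsub>Q\<^esub> \<longleftrightarrow> x \<in> N" if x: "x \<in> carrier G" for x
  proof -
    have xm: "N #>\<^bsub>G\<^esub> x \<in> carrier (G Mod N)" using x by (auto simp: carrier_FactGroup)
    have "?h x = \<one>\<^bsub>Q\<^esub> \<longleftrightarrow> k (N #>\<^bsub>G\<^esub> x) = k \<one>\<^bsub>G Mod N\<^esub>" by (simp only: k.hom_one)
    also have "\<dots> \<longleftrightarrow> N #>\<^bsub>G\<^esub> x = N"
      using k(2) xm k.G.one_closed by (auto simp: bij_betw_def inj_on_eq_iff)
    also have "\<dots> \<longleftrightarrow> x \<in> N"
      using G.coset_join1[OF _ x NG] G.coset_join2[OF x NG] subgroup.subset[OF NG] by auto
    finally show ?thesis .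
  qed
  ultimately show ?thesis using that Q(1,2) by blast
qed

lemma factor_hom:
  assumes "group G" "group Q" "group K" and h: "h \<in> hom G Q" "h ` carrier G = carrier Q"
    and f: "f \<in> hom G K" and ker: "\<And>x. x \<in> carrier G \<Longrightarrow> h x = \<one>\<^bsub>Q\<^esub> \<Longrightarrow> f x = \<one>\<^bsub>K\<^esub>"
  obtains g where "g \<in> hom Q K" "\<And>x. x \<in> carrier G \<Longrightarrow> g (h x) = f x"
proof -
  interpret h: group_hom G Q h by (rule group_homI[OF assms(1,2) h(1)])
  interpret f: group_hom G K f by (rule group_homI[OF assms(1,3) f])
  let ?s = "inv_into (carrier G) h"
  let ?g = "\<lambda>q. f (?s q)"
  have s: "?s q \<in> carrier G" "h (?s q) = q" if "q \<in> carrier Q" for q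
    using that h(2) by (auto intro: inv_into_into f_inv_into_f)
  have g: "?g (h x) = f x" if x: "x \<in> carrier G" for x
  proof -
    have sx: "?s (h x) \<in> carrier G" "h (?s (h x)) = h x" using s[of "h x"] x by auto
    have "h (?s (h x) \<otimes>\<^bsub>G\<^esub> inv\<^bsub>G\<^esub> x) = \<one>\<^bsub>Q\<^esub>" using sx x by simp
    then have "f (?s (h x) \<otimes>\<^bsub>G\<^esub> inv\<^bsub>G\<^esub> x) = \<one>\<^bsub>K\<^esub>" using ker sx x by simp
    then have "f (?s (h x)) \<otimes>\<^bsub>K\<^esub> inv\<^bsub>K\<^esub> f x = \<one>\<^bsub>K\<^esub>" using sx x by simp
    then show ?thesis using sx x
      by (metis f.H.inv_equality f.H.inv_inv f.H.inv_closed f.hom_closed)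
  qed
  have "?g \<in> hom Q K"
  proof (rule homI)
    fix q q' assume q: "q \<in> carrier Q" "q' \<in> carrier Q"
    have "h (?s q \<otimes>\<^bsub>G\<^esub> ?s q') = q \<otimes>\<^bsub>Q\<^esub> q'" using s q by simp
    then have "?g (q \<otimes>\<^bsub>Q\<^esub> q') = f (?s q \<otimes>\<^bsub>G\<^esub> ?s q')" using g[of "?s q \<otimes>\<^bsub>G\<^esub> ?s q'"] s q by simp
    then show "?g (q \<otimes>\<^bsub>Q\<^esub> q') = ?g q \<otimes>\<^bsub>K\<^esub> ?g q'" using s q by simp
  qed (use s in simp)
  with g show ?thesis using that by blast
qed

definition solves :: "('a, 'm) monoid_scheme \<Rightarrow> (nat \<Rightarrow> 'a set) \<Rightarrow> ('k, 'n) monoid_scheme \<Rightarrow> ('h, 'o) monoid_scheme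
    \<Rightarrow> ('a \<Rightarrow> 'k) \<Rightarrow> ('h \<Rightarrow> 'k) \<Rightarrow> bool" where
  "solves G U K H \<phi> \<alpha> \<longleftrightarrow> (\<exists>\<psi>\<in>chom G U H. \<psi> ` carrier G = carrier H \<and> (\<forall>x\<in>carrier G. \<alpha> (\<psi> x) = \<phi> x))"

definition embedding_problem :: "('a, 'm) monoid_scheme \<Rightarrow> (nat \<Rightarrow> 'a set) \<Rightarrow> ('k, 'n) monoid_scheme \<Rightarrow> ('h, 'o) monoid_scheme
    \<Rightarrow> ('a \<Rightarrow> 'k) \<Rightarrow> ('h \<Rightarrow> 'k) \<Rightarrow> bool" where
  "embedding_problem G U K H \<phi> \<alpha> \<longleftrightarrow> group K \<and> group H \<and> finite (carrier K) \<and> finite (carrier H) \<and>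
     \<phi> \<in> chom G U K \<and> \<phi> ` carrier G = carrier K \<and> \<alpha> \<in> hom H K \<and> \<alpha> ` carrier H = carrier K"

definition embeddings_solvable :: "('a, 'm) monoid_scheme \<Rightarrow> (nat \<Rightarrow> 'a set) \<Rightarrow> bool" where
  "embeddings_solvable G U \<longleftrightarrow>
     (\<forall>(K :: nat monoid) (H :: nat monoid) \<phi> \<alpha>. embedding_problem G U K H \<phi> \<alpha> \<longrightarrow> solves G U K H \<phi> \<alpha>)"

text \<open>An embedding problem is solved by climbing a chief series of \<open>H\<close> below the kernel of \<open>\<alpha>\<close>.\<close>

lemma embeddings_solvable_if_minimal:
  fixes G :: "('a, 'm) monoid_scheme"
  assumes "group G"
    and minimal: "\<And>(K :: nat monoid) (H :: nat monoid) \<phi> \<alpha>. embedding_problem G U K H \<phi> \<alpha> \<Longrightarrow>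
      {a \<in> carrier H. \<alpha> a = \<one>\<^bsub>K\<^esub>} \<noteq> {\<one>\<^bsub>H\<^esub>} \<Longrightarrow>
      (\<And>B. B \<lhd> H \<Longrightarrow> B \<subseteq> {a \<in> carrier H. \<alpha> a = \<one>\<^bsub>K\<^esub>} \<Longrightarrow> B = {\<one>\<^bsub>H\<^esub>} \<or> B = {a \<in> carrier H. \<alpha> a = \<one>\<^bsub>K\<^esub>})
      \<Longrightarrow> solves G U K H \<phi> \<alpha>"
  shows "embeddings_solvable G U"
proof -
  have "solves G U K H \<phi> \<alpha>" if "embedding_problem G U K H \<phi> \<alpha>" for K H :: "nat monoid" and \<phi> \<alpha>
    using that
  proof (induction "card {a \<in> carrier H. \<alpha> a = \<one>\<^bsub>K\<^esub>}" arbitrary: K H \<phi> \<alpha> rule: less_induct)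
    case less
    let ?A = "{a \<in> carrier H. \<alpha> a = \<one>\<^bsub>K\<^esub>}"
    have K: "group K" "finite (carrier K)" and H: "group H" "finite (carrier H)"
      and \<phi>: "\<phi> \<in> chom G U K" "\<phi> ` carrier G = carrier K"
      and \<alpha>: "\<alpha> \<in> hom H K" "\<alpha> ` carrier H = carrier K"
      using less.prems by (auto simp: embedding_problem_def)
    interpret \<alpha>: group_hom H K \<alpha> by (rule group_homI[OF H(1) K(1) \<alpha>(1)])
    show ?case
    proof (cases "?A = {\<one>\<^bsub>H\<^esub>}")
      case True
      have inj: "inj_on \<alpha> (carrier H)"
        unfolding \<alpha>.inj_on_one_iff using True by blast
      then have "\<alpha> \<in> iso H K" using \<alpha> by (simp add: iso_def bij_betw_def)
      then have "inv_into (carrier H) \<alpha> \<in> iso K H" by (rule group.iso_set_sym[OF H(1)])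
      then have i: "inv_into (carrier H) \<alpha> \<in> hom K H" "inv_into (carrier H) \<alpha> ` carrier K = carrier H"
        by (auto simp: iso_def bij_betw_def)
      let ?\<psi> = "\<lambda>x. inv_into (carrier H) \<alpha> (\<phi> x)"
      have "?\<psi> \<in> chom G U H" by (rule chom_compose[OF \<phi>(1) i(1) K(1) H(1)])
      moreover have "?\<psi> ` carrier G = carrier H" using i(2) \<phi>(2) by (simp add: image_image[symmetric])
      moreover have "\<alpha> (?\<psi> x) = \<phi> x" if "x \<in> carrier G" for x
        by (rule f_inv_into_f) (use that \<phi>(2) \<alpha>(2) in auto)
      ultimately show ?thesis unfolding solves_def by blast
    next
      case nontriv: False
      show ?thesis
      proof (cases "\<forall>B. B \<lhd> H \<longrightarrow> B \<subseteq> ?A \<longrightarrow> B = {\<one>\<^bsub>H\<^esub>} \<or> B = ?A")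
        case True
        show ?thesis by (rule minimal[OF less.prems nontriv]) (use True in blast)
      next
        case False
        then obtain B where B: "B \<lhd> H" "B \<subseteq> ?A" "B \<noteq> {\<one>\<^bsub>H\<^esub>}" "B \<noteq> ?A" by blast
        \<comment> \<open>\<alpha> is split as \<open>H \<rightarrow> H/B \<rightarrow> K\<close>.
          Both kernels are smaller than \<open>?A\<close>, so \<phi> can be lifted first to the
          quotient and then to \<open>H\<close>.\<close>
        have BH: "subgroup B H" by (rule normal_imp_subgroup[OF B(1)])
        have "finite (rcosets\<^bsub>H\<^esub> B)"
          by (rule finite_subset[OF \<alpha>.G.rcosets_subset_PowG[OF BH]]) (simp add: H(2))
        then obtain Q :: "nat monoid" and h where Q: "group Q" "finite (carrier Q)"
          and h: "h \<in> hom H Q" "h ` carrier H = carrier Q" "\<And>x. x \<in> carrier H \<Longrightarrow> h x = \<one>\<^bsub>Q\<^esub> \<longleftrightarrow> x \<in> B"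
          using quotient_nat_copy[OF H(1) B(1)] by metis
        have "\<alpha> x = \<one>\<^bsub>K\<^esub>" if "x \<in> carrier H" "h x = \<one>\<^bsub>Q\<^esub>" for x using h(3) that B(2) by auto
        then obtain \<beta> where \<beta>: "\<beta> \<in> hom Q K" "\<And>x. x \<in> carrier H \<Longrightarrow> \<beta> (h x) = \<alpha> x"
          using factor_hom[OF H(1) Q(1) K(1) h(1,2) \<alpha>(1)] by metis
        interpret h: group_hom H Q h by (rule group_homI[OF H(1) Q(1) h(1)])
        have finA: "finite ?A" using H(2) by simp
        have "\<beta> ` carrier Q = carrier K"
        proof -
          have "\<beta> ` carrier Q = (\<lambda>x. \<beta> (h x)) ` carrier H" by (simp only: h(2)[symmetric] image_image)
          also have "\<dots> = \<alpha> ` carrier H" by (rule image_cong) (simp_all add: \<beta>(2))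
          finally show ?thesis using \<alpha>(2) by simp
        qed
        then have ep1: "embedding_problem G U K Q \<phi> \<beta>"
          using K Q \<phi> \<beta>(1) by (simp add: embedding_problem_def)
        have "{q \<in> carrier Q. \<beta> q = \<one>\<^bsub>K\<^esub>} = h ` ?A"
        proof (intro equalityI subsetI)
          fix q assume q: "q \<in> {q \<in> carrier Q. \<beta> q = \<one>\<^bsub>K\<^esub>}"
          then have "q \<in> h ` carrier H" using h(2) by simp
          then obtain x where x: "x \<in> carrier H" "q = h x" by blast
          then have "x \<in> ?A" using q \<beta>(2) by simp
          then show "q \<in> h ` ?A" using x(2) by blast
        qed (use \<beta>(2) in auto)
        moreover have "card (h ` ?A) < card ?A"
        proof -
          have "\<not> inj_on h ?A"
          proof
            assume inj: "inj_on h ?A"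
            have "b = \<one>\<^bsub>H\<^esub>" if b: "b \<in> B" for b
            proof -
              have bA: "b \<in> ?A" "\<one>\<^bsub>H\<^esub> \<in> ?A" using B(2) b by auto
              have "h b = h \<one>\<^bsub>H\<^esub>" using h(3)[of b] bA b by simp
              from inj_onD[OF inj this bA] show ?thesis .
            qed
            then show False using B(3) subgroup.one_closed[OF BH] by blast
          qed
          then have "card (h ` ?A) \<noteq> card ?A" using eq_card_imp_inj_on[OF finA, of h] by blast
          with card_image_le[OF finA, of h] show ?thesis by (rule le_neq_implies_less)
        qed
        ultimately have "solves G U K Q \<phi> \<beta>" using less.hyps[OF _ ep1] by simp
        then obtain \<psi>1 where \<psi>1: "\<psi>1 \<in> chom G U Q" "\<psi>1 ` carrier G = carrier Q"
          "\<And>x. x \<in> carrier G \<Longrightarrow> \<beta> (\<psi>1 x) = \<phi> x" unfolding solves_def by blast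
        have ep2: "embedding_problem G U Q H \<psi>1 h"
          using Q H \<psi>1 h by (simp add: embedding_problem_def)
        have "{x \<in> carrier H. h x = \<one>\<^bsub>Q\<^esub>} = B" using h(3) subgroup.subset[OF BH] by blast
        moreover have "card B < card ?A" using psubset_card_mono[OF finA] B(2,4) by blast
        ultimately have "solves G U Q H \<psi>1 h" using less.hyps[OF _ ep2] by simp
        then obtain \<psi> where \<psi>: "\<psi> \<in> chom G U H" "\<psi> ` carrier G = carrier H"
          "\<And>x. x \<in> carrier G \<Longrightarrow> h (\<psi> x) = \<psi>1 x" unfolding solves_def by blast
        have "\<alpha> (\<psi> x) = \<phi> x" if x: "x \<in> carrier G" for x
        proof -
          have "\<psi> x \<in> carrier H" using \<psi>(2) x by blast
          then show ?thesis using \<beta>(2)[of "\<psi> x"] \<psi>(3)[OF x] \<psi>1(3)[OF x] by simp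
        qed
        then show ?thesis unfolding solves_def using \<psi>(1,2) by blast
      qed
    qed
  qed
  then show ?thesis unfolding embeddings_solvable_def by blast
qed

section \<open>Open overgroups of a closed subgroup\<close>

context chain_group
begin

abbreviation over :: "nat \<Rightarrow> 'a set \<Rightarrow> 'a set" where "over k M \<equiv> U k <#> M"

text \<open>Closedness in the topology of the chain: the closure of a subgroup \<open>M\<close> is
  the intersection of its open overgroups \<open>over k M\<close>.\<close>

definition closed :: "'a set \<Rightarrow> bool" where
  "closed M \<longleftrightarrow> (\<forall>x\<in>carrier G. x \<notin> M \<longrightarrow> (\<exists>k. x \<notin> over k M))"

text \<open>For subgroups this says that \<open>N \<inter> M\<close> has infinite index in
  \<open>N\<close>, expressed through the cosets of \<open>M\<close> so that orbits on the cosets of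
  overgroups of \<open>M\<close> can be compared directly.\<close>

definition infinite_over :: "'a set \<Rightarrow> 'a set \<Rightarrow> bool" where
  "infinite_over M N \<longleftrightarrow> infinite ((\<lambda>x. M #> x) ` N)"

lemma subgroup_over: "subgroup M G \<Longrightarrow> subgroup (over k M) G"
  by (rule second_isomorphism_grp.normal_set_mult_subgroup)
    (simp add: second_isomorphism_grp_def second_isomorphism_grp_axioms_def U_normal)

lemma U_over: "subgroup M G \<Longrightarrow> U k \<subseteq> over k M"
  using subgroup.one_closed[of M G] U_carrier by (force simp: set_mult_def)

lemma M_over: "subgroup M G \<Longrightarrow> M \<subseteq> over k M"
  using subgroup.one_closed[OF U_subgroup, of k] subgroup.mem_carrier[of M G] by (force simp: set_mult_def)

lemma over_anti: "k \<le> l \<Longrightarrow> over l M \<subseteq> over k M"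
  by (rule mono_set_mult[OF U_anti order_refl])

lemma over_least: "subgroup F G \<Longrightarrow> U k \<subseteq> F \<Longrightarrow> M \<subseteq> F \<Longrightarrow> over k M \<subseteq> F"
  by (auto simp: set_mult_def intro: subgroup.m_closed)

text \<open>Since the groups \<open>over k M\<close> decrease, a single one can meet finitely many
  conditions at once, beyond any given bound \<open>d\<close>.\<close>

lemma closed_separate:
  assumes "closed M" "finite X" "X \<subseteq> carrier G" "X \<inter> M = {}"
  shows "\<exists>k\<ge>d. X \<inter> over k M = {}"
  using assms(2-)
proof (induction X rule: finite_induct)
  case (insert x X)
  then obtain k where k: "k \<ge> d" "X \<inter> over k M = {}" by auto
  obtain l where l: "x \<notin> over l M" using insert.prems assms(1) by (auto simp: closed_def)
  have "insert x X \<inter> over (max k l) M = {}"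
    using k(2) l over_anti[of k "max k l" M] over_anti[of l "max k l" M] by auto
  then show ?case using k(1) by (intro exI[of _ "max k l"]) auto
qed auto

lemma card_rcos_image:
  assumes S: "subgroup S G" and Y: "Y \<subseteq> carrier G"
    and sep: "\<And>y y'. y \<in> Y \<Longrightarrow> y' \<in> Y \<Longrightarrow> y \<noteq> y' \<Longrightarrow> y \<otimes> inv y' \<notin> S"
  shows "card ((\<lambda>y. S #> y) ` Y) = card Y"
proof (rule card_image, rule inj_onI, rule ccontr)
  fix y y' assume y: "y \<in> Y" "y' \<in> Y" "S #> y = S #> y'" "y \<noteq> y'"
  then have "y \<otimes> inv y' \<in> S" using rcos_eq_iff[OF S, of y y'] Y by auto
  then show False using sep y by blast
qed

lemma infinite_over_separated:
  assumes M: "subgroup M G" and N: "N \<subseteq> carrier G" "infinite_over M N"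
  obtains Y where "Y \<subseteq> N" "finite Y" "card Y = n"
    "\<And>y y'. y \<in> Y \<Longrightarrow> y' \<in> Y \<Longrightarrow> y \<noteq> y' \<Longrightarrow> y \<otimes> inv y' \<notin> M"
proof -
  obtain B where B: "finite B" "card B = n" "B \<subseteq> (\<lambda>x. M #> x) ` N"
    using infinite_arbitrarily_large[of "(\<lambda>x. M #> x) ` N" n] N(2) by (auto simp: infinite_over_def)
  then obtain Y where Y: "Y \<subseteq> N" "inj_on (\<lambda>x. M #> x) Y" "B = (\<lambda>x. M #> x) ` Y"
    unfolding subset_image_inj by metis
  have "finite Y" using B(1) Y(2,3) finite_image_iff by blast
  moreover have "card Y = n" using B(2) Y(3) card_image[OF Y(2)] by simp
  moreover have "y \<otimes> inv y' \<notin> M" if y: "y \<in> Y" "y' \<in> Y" "y \<noteq> y'" for y y'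
  proof
    assume "y \<otimes> inv y' \<in> M"
    then have "M #> y = M #> y'" using rcos_eq_iff[OF M, of y y'] y Y(1) N(1) by auto
    then show False using inj_onD[OF Y(2)] y by blast
  qed
  ultimately show ?thesis using that Y(1) by blast
qed

text \<open>Only one element of \<open>N\<close> is needed for each coset of \<open>F\<close>.\<close>

lemma infinite_over_Int:
  assumes M: "subgroup M G" and N: "subgroup N G" "infinite_over M N"
    and F: "subgroup F G" "finite (rcosets F)"
  shows "infinite_over M (N \<inter> F)"
  unfolding infinite_over_def
proof
  assume fin: "finite ((\<lambda>x. M #> x) ` (N \<inter> F))"
  let ?n = "\<lambda>t. SOME x. x \<in> t \<inter> N"
  have "(\<lambda>x. M #> x) ` N \<subseteq> (\<lambda>(c, t). c #> ?n t) ` ((\<lambda>x. M #> x) ` (N \<inter> F) \<times> rcosets F)"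
  proof clarify
    fix x assume x: "x \<in> N"
    have xc: "x \<in> carrier G" by (rule subgroup.mem_carrier[OF N(1) x])
    let ?t = "F #> x"
    have "x \<in> ?t \<inter> N" using rcos_self[OF xc F(1)] x by simp
    then have n: "?n ?t \<in> ?t \<inter> N" by (rule someI)
    then have nc: "?n ?t \<in> carrier G" using subgroup.mem_carrier[OF N(1)] by blast
    have tF: "?t \<in> rcosets F" by (rule rcosetsI[OF subgroup.subset[OF F(1)] xc])
    have "F #> x = F #> ?n ?t" using rcosets_mem_eq(1)[OF F(1) tF] n by blast
    then have "x \<otimes> inv ?n ?t \<in> F" using rcos_eq_iff[OF F(1) xc nc] by simp
    moreover have "x \<otimes> inv ?n ?t \<in> N"
      using subgroup.m_closed[OF N(1) x subgroup.m_inv_closed[OF N(1)]] n by blast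
    ultimately have y: "x \<otimes> inv ?n ?t \<in> N \<inter> F" by simp
    have "M #> x = (M #> (x \<otimes> inv ?n ?t)) #> ?n ?t"
      using xc nc by (simp add: coset_mult_assoc[OF subgroup.subset[OF M]] m_assoc)
    then show "M #> x \<in> (\<lambda>(c, t). c #> ?n t) ` ((\<lambda>x. M #> x) ` (N \<inter> F) \<times> rcosets F)"
      using y tF by (intro image_eqI[of _ _ "(M #> (x \<otimes> inv ?n ?t), ?t)"]) auto
  qed
  moreover have "finite ((\<lambda>(c, t). c #> ?n t) ` ((\<lambda>x. M #> x) ` (N \<inter> F) \<times> rcosets F))"
    using fin F(2) by blast
  ultimately show False using N(2) finite_subset unfolding infinite_over_def by blast
qed

lemma infinite_over_carrier: "infinite (rcosets M) \<longleftrightarrow> infinite_over M (carrier G)"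
proof -
  have "rcosets M = (\<lambda>x. M #> x) ` carrier G" by (auto simp: RCOSETS_def)
  then show ?thesis by (simp add: infinite_over_def)
qed

text \<open>Take representatives of \<open>n\<close> cosets of \<open>M\<close>. Their mutual
  quotients lie outside \<open>M\<close>, and an \<open>over k M\<close> that avoids them as well
  keeps the \<open>n\<close> cosets apart.\<close>

lemma large_index_over:
  assumes M: "subgroup M G" "closed M" "infinite (rcosets M)"
  obtains k where "k \<ge> d" "n \<le> card (rcosets (over k M))"
proof -
  obtain Y where Y: "Y \<subseteq> carrier G" "finite Y" "card Y = n"
    "\<And>y y'. y \<in> Y \<Longrightarrow> y' \<in> Y \<Longrightarrow> y \<noteq> y' \<Longrightarrow> y \<otimes> inv y' \<notin> M"
    using infinite_over_separated[OF M(1) order_refl] M(3) infinite_over_carrier by metis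
  let ?X = "{y \<otimes> inv y' | y y'. y \<in> Y \<and> y' \<in> Y \<and> y \<noteq> y'}"
  have "?X \<subseteq> (\<lambda>(y, y'). y \<otimes> inv y') ` (Y \<times> Y)" by auto
  then have finX: "finite ?X" by (rule finite_subset) (simp add: Y(2))
  have "?X \<subseteq> carrier G" using Y(1) by auto
  moreover have "?X \<inter> M = {}" using Y(4) by auto
  ultimately obtain k where k: "k \<ge> d" "?X \<inter> over k M = {}"
    using closed_separate[OF M(2) finX, of d] by blast
  have S: "subgroup (over k M) G" by (rule subgroup_over[OF M(1)])
  have "card ((\<lambda>y. over k M #> y) ` Y) = card Y"
    by (rule card_rcos_image[OF S Y(1)]) (use k(2) in blast)
  moreover have "(\<lambda>y. over k M #> y) ` Y \<subseteq> rcosets (over k M)"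
    using rcosetsI[OF subgroup.subset[OF S]] Y(1) by auto
  ultimately have "n \<le> card (rcosets (over k M))"
    using card_mono[OF finite_rcosets[OF S U_over[OF M(1)]]] Y(3) by metis
  with k(1) show ?thesis using that by blast
qed

text \<open>Here \<open>N1\<close> has only bounded orbits, so it keeps the role of moving every
  point, and the large orbits come from some \<open>U s\<close> with
  \<open>N1 \<inter> U s \<subseteq> M\<close>. To keep \<open>N1 \<inter> F\<close> outside
  \<open>M\<close>, the group \<open>F\<close> is built over \<open>N1 M\<close>, which is again
  closed of infinite index.\<close>

lemma large_overgroup_finite_case:
  assumes M: "subgroup M G" "closed M" "infinite (rcosets M)"
    and N: "N1 \<lhd> G" "\<not> N1 \<subseteq> M" "\<not> infinite_over M N1"
  obtains N2 F k where "N2 \<lhd> G" "N1 \<inter> N2 \<subseteq> M \<inter> U d" "subgroup F G" "U k \<subseteq> F" "M \<subseteq> F" "n \<le> card (rcosets F)"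
    "\<not> N1 \<inter> F \<subseteq> M" "infinite_over M (N2 \<inter> F)"
proof -
  have N1s: "subgroup N1 G" by (rule normal_imp_subgroup[OF N(1)])
  have N1c: "x \<in> N1 \<Longrightarrow> x \<in> carrier G" and Mc: "x \<in> M \<Longrightarrow> x \<in> carrier G" for x
    using subgroup.mem_carrier[OF N1s] subgroup.mem_carrier[OF M(1)] by blast+
  obtain X where X: "X \<subseteq> N1" "finite X" "(\<lambda>x. M #> x) ` N1 = (\<lambda>x. M #> x) ` X"
    using N(3) finite_subset_image[of "(\<lambda>x. M #> x) ` N1" "\<lambda>x. M #> x" N1] unfolding infinite_over_def by auto
  have rep: "\<exists>x\<in>X. M #> y = M #> x" if "y \<in> N1" for y using X(3) that by blast
  \<comment> \<open>An element of \<open>N1 \<inter> U s\<close> has its representative in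
    \<open>over s M\<close>. Representatives outside \<open>M\<close> are avoided there, so the
    element lies in \<open>M\<close>.\<close>
  obtain s where s: "s \<ge> d" "(X - M) \<inter> over s M = {}"
    using closed_separate[OF M(2), of "X - M" d] X(1,2) N1c by auto
  have N1s_M: "N1 \<inter> U s \<subseteq> M"
  proof
    fix y assume y: "y \<in> N1 \<inter> U s"
    then obtain x where x: "x \<in> X" "M #> y = M #> x" using rep by blast
    have yc: "y \<in> carrier G" and xc: "x \<in> carrier G" using y x X(1) N1c by auto
    have "x \<in> M #> y" using x(2) rcos_self[OF xc M(1)] by simp
    then obtain m where m: "m \<in> M" "x = m \<otimes> y" by (auto simp: r_coset_def)
    have "x = (m \<otimes> y \<otimes> inv m) \<otimes> m" using m yc Mc by (simp add: m_assoc)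
    moreover have "m \<otimes> y \<otimes> inv m \<in> U s" using U_conj[OF Mc[OF m(1)]] y by blast
    ultimately have "x \<in> over s M" using m(1) unfolding set_mult_def by blast
    then have "x \<in> M" using s(2) x(1) by blast
    then have "M #> y = M" using x(2) coset_join2[OF xc M(1)] by simp
    then show "y \<in> M" using coset_join1[OF _ yc M(1)] subgroup.subset[OF M(1)] by simp
  qed
  let ?Q = "N1 <#> M"
  have Q: "subgroup ?Q G"
    by (rule second_isomorphism_grp.normal_set_mult_subgroup)
      (simp add: second_isomorphism_grp_def second_isomorphism_grp_axioms_def N(1) M(1))
  have MQ: "M \<subseteq> ?Q" using subgroup.one_closed[OF N1s] Mc by (force simp: set_mult_def)
  have N1Q: "N1 \<subseteq> ?Q" using subgroup.one_closed[OF M(1)] N1c by (force simp: set_mult_def)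
  have Q_rep: "M #> q \<in> (\<lambda>x. M #> x) ` N1" if q: "q \<in> ?Q" for q
  proof -
    have "?Q = M <#> N1" using commut_normal[OF M(1) N(1)] by simp
    then obtain m x where mx: "m \<in> M" "x \<in> N1" "q = m \<otimes> x" using q by (auto simp: set_mult_def)
    have "M #> q = M #> m #> x"
      using mx Mc N1c by (simp add: coset_mult_assoc[OF subgroup.subset[OF M(1)]])
    also have "\<dots> = M #> x" using coset_join2[OF Mc[OF mx(1)] M(1) mx(1)] by simp
    finally show ?thesis using mx(2) by blast
  qed
  \<comment> \<open>\<open>N1 M\<close> is made of the finitely many cosets of \<open>M\<close> met
    by \<open>N1\<close>; if it had finite index, so would \<open>M\<close>.\<close>
  have infQ: "infinite (rcosets ?Q)"
  proof
    assume "finite (rcosets ?Q)"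
    then have "infinite_over M (carrier G \<inter> ?Q)"
      using infinite_over_Int[OF M(1) subgroup_self _ Q] M(3) infinite_over_carrier by blast
    moreover have "(\<lambda>x. M #> x) ` (carrier G \<inter> ?Q) \<subseteq> (\<lambda>x. M #> x) ` N1" using Q_rep by blast
    ultimately show False using N(3) finite_subset unfolding infinite_over_def by blast
  qed
  \<comment> \<open>A finite union of translates of a closed set is closed: \<open>y\<close> is
    separated from all cosets \<open>M x\<close> with \<open>x \<in> X\<close> by one
    \<open>k\<close>.\<close>
  have clQ: "closed ?Q"
    unfolding closed_def
  proof (intro ballI impI)
    fix y assume y: "y \<in> carrier G" "y \<notin> ?Q"
    let ?Y = "(\<lambda>x. y \<otimes> inv x) ` X"
    have "?Y \<inter> M = {}"
    proof (rule ccontr)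
      assume "?Y \<inter> M \<noteq> {}"
      then obtain x where x: "x \<in> X" "y \<otimes> inv x \<in> M" by blast
      then have xQ: "x \<in> ?Q" "y \<otimes> inv x \<in> ?Q" using X(1) N1Q MQ by auto
      have "y \<otimes> inv x \<otimes> x \<in> ?Q" by (rule subgroup.m_closed[OF Q xQ(2,1)])
      then show False using y x X(1) N1c by (simp add: m_assoc subset_iff)
    qed
    moreover have "?Y \<subseteq> carrier G"
    proof clarify
      fix x assume "x \<in> X"
      then have "x \<in> carrier G" using X(1) N1c by blast
      then show "y \<otimes> inv x \<in> carrier G" using y(1) by simp
    qed
    ultimately obtain k where k: "?Y \<inter> over k M = {}"
      using closed_separate[OF M(2) finite_imageI[OF X(2)], of "\<lambda>x. y \<otimes> inv x" 0] by blast
    have "y \<notin> over k ?Q"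
    proof
      assume "y \<in> over k ?Q"
      then obtain u q where uq: "u \<in> U k" "q \<in> ?Q" "y = u \<otimes> q" by (auto simp: set_mult_def)
      obtain x where x: "x \<in> X" "M #> q = M #> x" using Q_rep[OF uq(2)] X(3) by auto
      have c: "u \<in> carrier G" "q \<in> carrier G" "x \<in> carrier G"
        using U_carrier[OF uq(1)] subgroup.mem_carrier[OF Q uq(2)] x(1) X(1) N1c by auto
      have "q \<otimes> inv x \<in> M" using rcos_eq_iff[OF M(1) c(2,3)] x(2) by simp
      moreover have "y \<otimes> inv x = u \<otimes> (q \<otimes> inv x)" using uq(3) c by (simp add: m_assoc)
      ultimately have "y \<otimes> inv x \<in> over k M" using uq(1) by (auto simp: set_mult_def)
      then show False using k x(1) by blast
    qed
    then show "\<exists>k. y \<notin> over k ?Q" by blast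
  qed
  obtain k where k: "n \<le> card (rcosets (over k ?Q))"
    using large_index_over[OF Q clQ infQ, of 0 n] by blast
  let ?F = "over k ?Q"
  have F: "subgroup ?F G" "U k \<subseteq> ?F" "?Q \<subseteq> ?F"
    using subgroup_over[OF Q] U_over[OF Q] M_over[OF Q] by auto
  have "infinite_over M (carrier G \<inter> U s)"
    by (rule infinite_over_Int[OF M(1) subgroup_self _ U_subgroup finite_rcosets_U])
      (use M(3) infinite_over_carrier in blast)
  then have "infinite_over M (U s)" using U_carrier by (simp add: Int_absorb1 subset_iff)
  then have "infinite_over M (U s \<inter> ?F)"
    by (rule infinite_over_Int[OF M(1) U_subgroup _ F(1) finite_rcosets[OF F(1,2)]])
  moreover have "N1 \<inter> U s \<subseteq> M \<inter> U d" using N1s_M U_anti[OF s(1)] by blast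
  moreover have "\<not> N1 \<inter> ?F \<subseteq> M" using N(2) N1Q F(3) by blast
  moreover have "M \<subseteq> ?F" using MQ F(3) by blast
  ultimately show ?thesis using that[of "U s" ?F k] U_normal F k by blast
qed

text \<open>If both \<open>M1\<close> and \<open>M2\<close> meet infinitely many cosets of
  \<open>M\<close>, any open overgroup of large index serves as \<open>F\<close>, and
  \<open>M2\<close> is cut down by \<open>U d\<close>. Otherwise the one that meets finitely many
  takes the role of \<open>N1\<close>. Later \<open>d\<close> is chosen so that \<phi> is trivial on
  \<open>M \<inter> U d\<close>.\<close>

lemma large_overgroup:
  assumes M: "subgroup M G" "closed M" "infinite (rcosets M)"
    and N: "M1 \<lhd> G" "M2 \<lhd> G" "M1 \<inter> M2 \<subseteq> M" "\<not> M1 \<subseteq> M" "\<not> M2 \<subseteq> M"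
  obtains N1 N2 F k where "N1 \<lhd> G" "N2 \<lhd> G" "N1 \<inter> N2 \<subseteq> M \<inter> U d" "subgroup F G" "U k \<subseteq> F" "M \<subseteq> F"
    "n \<le> card (rcosets F)" "\<not> N1 \<inter> F \<subseteq> M" "infinite_over M (N2 \<inter> F)"
proof (cases "infinite_over M M1 \<and> infinite_over M M2")
  case False
  then consider "\<not> infinite_over M M1" | "\<not> infinite_over M M2" by blast
  then show ?thesis
  proof cases
    case 1
    show ?thesis
      by (rule large_overgroup_finite_case[OF M N(1,4) 1, of d n], rule that[OF N(1)])
  next
    case 2
    show ?thesis
      by (rule large_overgroup_finite_case[OF M N(2,5) 2, of d n], rule that[OF N(2)])
  qed
next
  case True
  obtain k where k: "n \<le> card (rcosets (over k M))"
    using large_index_over[OF M, of 0 n] by blast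
  let ?F = "over k M"
  have F: "subgroup ?F G" "U k \<subseteq> ?F" "M \<subseteq> ?F"
    using subgroup_over[OF M(1)] U_over[OF M(1)] M_over[OF M(1)] by auto
  have finF: "finite (rcosets ?F)" by (rule finite_rcosets[OF F(1,2)])
  have M1: "subgroup M1 G" and M2: "subgroup M2 G" using N(1,2) by (auto intro: normal_imp_subgroup)
  have inf1: "infinite_over M (M1 \<inter> ?F)"
    using infinite_over_Int[OF M(1) M1 _ F(1) finF] True by blast
  have "\<not> M1 \<inter> ?F \<subseteq> M"
  proof
    assume sub: "M1 \<inter> ?F \<subseteq> M"
    have "M #> x = M" if "x \<in> M1 \<inter> ?F" for x
      using coset_join2[OF _ M(1)] sub that subgroup.mem_carrier[OF M1] by blast
    then have "(\<lambda>x. M #> x) ` (M1 \<inter> ?F) \<subseteq> {M}" by blast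
    then show False using inf1 finite_subset unfolding infinite_over_def by blast
  qed
  moreover have M2d: "M2 \<inter> U d \<lhd> G" by (rule normal_subgroup_intersect[OF N(2) U_normal])
  have "infinite_over M (M2 \<inter> U d)"
    using infinite_over_Int[OF M(1) M2 _ U_subgroup finite_rcosets_U] True by blast
  then have "infinite_over M (M2 \<inter> U d \<inter> ?F)"
    by (rule infinite_over_Int[OF M(1) normal_imp_subgroup[OF M2d] _ F(1) finF])
  moreover have "M1 \<inter> (M2 \<inter> U d) \<subseteq> M \<inter> U d" using N(3) by blast
  ultimately show ?thesis using that[OF N(1) M2d] F k by blast
qed

text \<open>The homomorphism \<open>\<phi>\<close> on \<open>M\<close> is extended to \<open>U k <#> M\<close> by the trivial map on \<open>U k\<close>.\<close>

lemma extend_over: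
  assumes M: "subgroup M G" and K: "group K" and \<phi>: "\<phi> \<in> hom (G\<lparr>carrier := M\<rparr>) K"
    and triv: "\<And>x. x \<in> M \<inter> U k \<Longrightarrow> \<phi> x = \<one>\<^bsub>K\<^esub>"
  obtains \<xi> where "\<xi> \<in> hom (G\<lparr>carrier := over k M\<rparr>) K" "\<And>x. x \<in> M \<Longrightarrow> \<xi> x = \<phi> x" "\<And>x. x \<in> U k \<Longrightarrow> \<xi> x = \<one>\<^bsub>K\<^esub>"
proof -
  have GM: "group (G\<lparr>carrier := M\<rparr>)" by (rule subgroup.subgroup_is_group[OF M is_group])
  interpret K: group K by fact
  interpret \<phi>: group_hom "G\<lparr>carrier := M\<rparr>" K \<phi> by (rule group_homI[OF GM K \<phi>])
  have Mc: "x \<in> M \<Longrightarrow> x \<in> carrier G" for x by (rule subgroup.mem_carrier[OF M])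
  have \<phi>c: "x \<in> M \<Longrightarrow> \<phi> x \<in> carrier K" for x using \<phi>.hom_closed by simp
  have \<phi>m: "x \<in> M \<Longrightarrow> x' \<in> M \<Longrightarrow> \<phi> (x \<otimes> x') = \<phi> x \<otimes>\<^bsub>K\<^esub> \<phi> x'" for x x' using \<phi>.hom_mult by simp
  have \<phi>1: "\<phi> \<one> = \<one>\<^bsub>K\<^esub>" using \<phi>.hom_one by simp
  \<comment> \<open>The choice does not matter: the \<open>M\<close>-parts of two decompositions
    differ by an element of \<open>M \<inter> U k\<close>, which \<phi> kills.\<close>
  let ?s = "\<lambda>x. SOME m. m \<in> M \<and> (\<exists>u\<in>U k. x = u \<otimes> m)"
  let ?\<xi> = "\<lambda>x. \<phi> (?s x)"
  have val: "?\<xi> (u \<otimes> m) = \<phi> m" if u: "u \<in> U k" and m: "m \<in> M" for u m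
  proof -
    have "\<exists>m'. m' \<in> M \<and> (\<exists>u'\<in>U k. u \<otimes> m = u' \<otimes> m')" using u m by blast
    then have "?s (u \<otimes> m) \<in> M \<and> (\<exists>u'\<in>U k. u \<otimes> m = u' \<otimes> ?s (u \<otimes> m))" by (rule someI_ex)
    then obtain u' where m': "?s (u \<otimes> m) \<in> M" and u': "u' \<in> U k" "u \<otimes> m = u' \<otimes> ?s (u \<otimes> m)" by blast
    let ?m = "?s (u \<otimes> m)"
    have c: "u \<in> carrier G" "m \<in> carrier G" "u' \<in> carrier G" "?m \<in> carrier G"
      using u m m' u' U_carrier Mc by auto
    have d: "m \<otimes> inv ?m = inv u \<otimes> u'"
    proof -
      have "inv u \<otimes> (u \<otimes> m) = inv u \<otimes> (u' \<otimes> ?m)" using u'(2) by simp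
      then have "m = inv u \<otimes> u' \<otimes> ?m" using c by (simp add: m_assoc[symmetric])
      then have "inv u \<otimes> u' = m \<otimes> inv ?m"
        by (subst inv_solve_right) (use c in auto)
      then show ?thesis by (rule sym)
    qed
    have "inv u \<otimes> u' \<in> U k"
      by (rule subgroup.m_closed[OF U_subgroup subgroup.m_inv_closed[OF U_subgroup u] u'(1)])
    moreover have dM: "m \<otimes> inv ?m \<in> M" by (rule subgroup.m_closed[OF M m subgroup.m_inv_closed[OF M m']])
    ultimately have "\<phi> (m \<otimes> inv ?m) = \<one>\<^bsub>K\<^esub>" using triv d by simp
    then have "\<phi> ((m \<otimes> inv ?m) \<otimes> ?m) = \<phi> ?m" using \<phi>m[OF dM m'] \<phi>c[OF m'] by simp
    then show ?thesis using c by (simp add: m_assoc)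
  qed
  have "?\<xi> \<in> hom (G\<lparr>carrier := over k M\<rparr>) K"
  proof (rule homI)
    fix x assume "x \<in> carrier (G\<lparr>carrier := over k M\<rparr>)"
    then obtain u m where "u \<in> U k" "m \<in> M" "x = u \<otimes> m" by (auto simp: set_mult_def)
    then show "?\<xi> x \<in> carrier K" using val \<phi>c by simp
  next
    fix x x' assume "x \<in> carrier (G\<lparr>carrier := over k M\<rparr>)" "x' \<in> carrier (G\<lparr>carrier := over k M\<rparr>)"
    then obtain u m u' m' where x: "u \<in> U k" "m \<in> M" "x = u \<otimes> m" "u' \<in> U k" "m' \<in> M" "x' = u' \<otimes> m'"
      by (auto simp: set_mult_def)
    have c: "u \<in> carrier G" "m \<in> carrier G" "u' \<in> carrier G" "m' \<in> carrier G"
      using x U_carrier Mc by auto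
    have mu: "m \<otimes> u' \<otimes> inv m \<in> U k" by (rule U_conj[OF c(2) x(4)])
    have "inv m \<otimes> (m \<otimes> m') = m'" using c by (simp add: m_assoc[symmetric])
    then have "x \<otimes> x' = (u \<otimes> (m \<otimes> u' \<otimes> inv m)) \<otimes> (m \<otimes> m')"
      using x c by (simp add: m_assoc)
    then have "?\<xi> (x \<otimes> x') = \<phi> (m \<otimes> m')"
      using val[OF subgroup.m_closed[OF U_subgroup x(1) mu] subgroup.m_closed[OF M x(2,5)]] by simp
    then show "?\<xi> (x \<otimes>\<^bsub>G\<lparr>carrier := over k M\<rparr>\<^esub> x') = ?\<xi> x \<otimes>\<^bsub>K\<^esub> ?\<xi> x'"
      using x val \<phi>m by simp
  qed
  moreover have "?\<xi> x = \<phi> x" if "x \<in> M" for x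
    using val[OF subgroup.one_closed[OF U_subgroup] that] Mc[OF that] by simp
  moreover have "?\<xi> x = \<one>\<^bsub>K\<^esub>" if "x \<in> U k" for x
    using val[OF that subgroup.one_closed[OF M]] U_carrier[OF that] \<phi>1 by simp
  ultimately show ?thesis using that by blast
qed

lemma diamond_minimal:
  fixes z :: "'i \<Rightarrow> 'a" and K :: "('k, 'km) monoid_scheme" and H :: "('h, 'hm) monoid_scheme"
  assumes free: "free_on G U I z" "finite I" "card I \<ge> 2"
    and M: "subgroup M G" "closed M" "infinite (rcosets M)"
    and N: "M1 \<lhd> G" "M2 \<lhd> G" "M1 \<inter> M2 \<subseteq> M" "\<not> M1 \<subseteq> M" "\<not> M2 \<subseteq> M"
    and ep: "embedding_problem (G\<lparr>carrier := M\<rparr>) (\<lambda>i. U i \<inter> M) K H \<phi> \<alpha>"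
    and A: "{a \<in> carrier H. \<alpha> a = \<one>\<^bsub>K\<^esub>} \<noteq> {\<one>\<^bsub>H\<^esub>}"
      "\<And>B. B \<lhd> H \<Longrightarrow> B \<subseteq> {a \<in> carrier H. \<alpha> a = \<one>\<^bsub>K\<^esub>} \<Longrightarrow> B = {\<one>\<^bsub>H\<^esub>} \<or> B = {a \<in> carrier H. \<alpha> a = \<one>\<^bsub>K\<^esub>}"
  shows "solves (G\<lparr>carrier := M\<rparr>) (\<lambda>i. U i \<inter> M) K H \<phi> \<alpha>"
proof -
  let ?A = "{a \<in> carrier H. \<alpha> a = \<one>\<^bsub>K\<^esub>}"
  have K: "group K" "finite (carrier K)" and H: "group H" "finite (carrier H)"
    and \<phi>: "\<phi> \<in> chom (G\<lparr>carrier := M\<rparr>) (\<lambda>i. U i \<inter> M) K" "\<phi> ` M = carrier K"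
    and \<alpha>: "\<alpha> \<in> hom H K" "\<alpha> ` carrier H = carrier K"
    using ep by (auto simp: embedding_problem_def)
  obtain d where d: "\<And>x. x \<in> M \<inter> U d \<Longrightarrow> \<phi> x = \<one>\<^bsub>K\<^esub>" using \<phi>(1) by (auto simp: chom_def)
  \<comment> \<open>91 is 89 + 2, which covers both rank bounds of
    \<open>exists_lift_onto_kernel\<close> at once.\<close>
  let ?r = "card (carrier H) + card ?A + 91"
  obtain N1 N2 F i where N12: "N1 \<lhd> G" "N2 \<lhd> G" "N1 \<inter> N2 \<subseteq> M \<inter> U d"
    and F: "subgroup F G" "U i \<subseteq> F" "M \<subseteq> F" "?r \<le> card (rcosets F)"
    and N1F: "\<not> N1 \<inter> F \<subseteq> M" and N2F: "infinite_over M (N2 \<inter> F)"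
    using large_overgroup[OF M N, of d ?r] by blast
  have Fc: "x \<in> F \<Longrightarrow> x \<in> carrier G" and Mc: "x \<in> M \<Longrightarrow> x \<in> carrier G" for x
    using subgroup.mem_carrier[OF F(1)] subgroup.mem_carrier[OF M(1)] by blast+
  let ?GF = "G\<lparr>carrier := F\<rparr>" and ?UF = "\<lambda>i. U i \<inter> F"
  obtain I' :: "('a set \<times> 'i) set" and z' where I': "free_on ?GF ?UF I' z'" "finite I'"
    "card I' + card (rcosets F) = card (rcosets F) * card I + 1"
    using nielsen_schreier[OF F(1,2) free(1,2)] by blast
  \<comment> \<open>The rank is the index times \<open>card I - 1\<close>, plus 1, so with
    \<open>card I \<ge> 2\<close> it exceeds the index; this is where the rank bound on the ambient
    group enters.\<close>
  have "card (rcosets F) * 2 \<le> card (rcosets F) * card I" using free(3) by (rule mult_le_mono2)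
  then have rank: "?r \<le> card I'" using I'(3) F(4) by linarith
  obtain x0 where x0: "x0 \<in> N1" "x0 \<in> F" "x0 \<notin> M" using N1F by blast
  have "N2 \<inter> F \<subseteq> carrier G" using Fc by blast
  from infinite_over_separated[OF M(1) this N2F, of 32] obtain Y where Y: "Y \<subseteq> N2 \<inter> F" "finite Y" "card Y = 32"
    "\<And>y y'. y \<in> Y \<Longrightarrow> y' \<in> Y \<Longrightarrow> y \<noteq> y' \<Longrightarrow> y \<otimes> inv y' \<notin> M" by blast
  have Yc: "y \<in> Y \<Longrightarrow> y \<in> carrier G" for y using Y(1) Fc by blast
  \<comment> \<open>\<open>?E\<close> must avoid \<open>x0\<close>, so as not to contain
    \<open>N1 \<inter> F\<close>, and the quotients of the 32 elements of \<open>Y\<close>, so that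
    these stay in different cosets. Below, \<open>k \<ge> d\<close> makes \<phi> trivial on
    \<open>M \<inter> U k\<close>, and \<open>k \<ge> i\<close> keeps \<open>?E\<close> inside
    \<open>F\<close>.\<close>
  let ?X = "insert x0 ((\<lambda>(y, y'). y \<otimes> inv y') ` {(y, y') \<in> Y \<times> Y. y \<noteq> y'})"
  have "finite {(y, y') \<in> Y \<times> Y. y \<noteq> y'}" by (rule finite_subset[of _ "Y \<times> Y"]) (use Y(2) in auto)
  then have "finite ?X" by simp
  moreover have "?X \<subseteq> carrier G" using Yc Fc[OF x0(2)] by auto
  moreover have "?X \<inter> M = {}" using x0(3) Y(4) by auto
  ultimately obtain k where k: "k \<ge> max d i" "?X \<inter> over k M = {}"
    using closed_separate[OF M(2), of ?X "max d i"] by blast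
  let ?E = "over k M"
  have E: "subgroup ?E G" "U k \<subseteq> ?E" "M \<subseteq> ?E"
    using subgroup_over[OF M(1)] U_over[OF M(1)] M_over[OF M(1)] by auto
  have UkF: "U k \<subseteq> F" using U_anti[of i k] k(1) F(2) by auto
  have EF: "?E \<subseteq> F" by (rule over_least[OF F(1) UkF F(3)])
  have "\<phi> x = \<one>\<^bsub>K\<^esub>" if "x \<in> M \<inter> U k" for x
    using d[of x] that U_anti[of d k] k(1) by auto
  from extend_over[OF M(1) K(1) chom_hom[OF \<phi>(1)] this] obtain \<xi>
    where \<xi>: "\<xi> \<in> hom (G\<lparr>carrier := ?E\<rparr>) K" "\<And>x. x \<in> M \<Longrightarrow> \<xi> x = \<phi> x" "\<And>x. x \<in> U k \<Longrightarrow> \<xi> x = \<one>\<^bsub>K\<^esub>"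
    by blast
  interpret GF: chain_group ?GF ?UF by (rule chain_group_subgroup[OF F(1)])
  have EGF: "subgroup ?E ?GF" by (rule subgroup_incl[OF E(1) F(1) EF])
  have chiE: "\<xi> ` ?E = carrier K"
  proof
    show "\<xi> ` ?E \<subseteq> carrier K" using hom_in_carrier[OF \<xi>(1)] by auto
    show "carrier K \<subseteq> \<xi> ` ?E"
    proof
      fix a assume "a \<in> carrier K"
      then obtain m where "m \<in> M" "a = \<phi> m" using \<phi>(2) by blast
      then show "a \<in> \<xi> ` ?E" using \<xi>(2) E(3) by (intro image_eqI[of _ _ m]) auto
    qed
  qed
  interpret L: lifting_problem ?GF ?UF I' z' ?E k K H \<xi> \<alpha>
  proof (intro lifting_problem.intro lifting_problem_axioms.intro)
    have "\<forall>x\<in>?UF k \<inter> ?E. \<xi> x = \<one>\<^bsub>K\<^esub>" using \<xi>(3) by simp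
    then have "\<exists>j. \<forall>x\<in>?UF j \<inter> ?E. \<xi> x = \<one>\<^bsub>K\<^esub>" by (rule exI)
    then show "\<xi> \<in> chom (?GF\<lparr>carrier := ?E\<rparr>) (\<lambda>j. ?UF j \<inter> ?E) K" using \<xi>(1) by (simp add: chom_def)
    show "?UF k \<subseteq> ?E" using E(2) by blast
  qed (fact GF.chain_group_axioms I' EGF K H chiE \<alpha>)+
  have A_eq: "L.A = ?A" by (rule L.A_def)
  have normF: "N \<inter> F \<lhd> ?GF" if "N \<lhd> G" for N
  proof -
    have "second_isomorphism_grp N G F"
      using that F(1) by (simp add: second_isomorphism_grp_def second_isomorphism_grp_axioms_def)
    from second_isomorphism_grp.normal_subgrp_intersection_normal[OF this]
    show ?thesis by (simp add: Int_commute)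
  qed
  have RM: "x \<in> M \<and> x \<in> U d" if "x \<in> (N1 \<inter> F) \<inter> (N2 \<inter> F)" for x using that N12(3) by blast
  have c32: "32 \<le> card ((\<lambda>x. ?E #>\<^bsub>?GF\<^esub> x) ` (N2 \<inter> F))"
  proof -
    have sep: "y \<otimes> inv y' \<notin> ?E" if "y \<in> Y" "y' \<in> Y" "y \<noteq> y'" for y y' using k(2) that by auto
    have "Y \<subseteq> carrier G" using Yc by blast
    from card_rcos_image[OF E(1) this sep] have "card ((\<lambda>y. ?E #> y) ` Y) = 32"
      using Y(3) by simp
    moreover have "finite ((\<lambda>x. ?E #> x) ` (N2 \<inter> F))"
      by (rule finite_subset[OF _ finite_rcosets[OF E(1,2)]]) (use rcosetsI[OF subgroup.subset[OF E(1)]] Fc in auto)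
    then have "card ((\<lambda>y. ?E #> y) ` Y) \<le> card ((\<lambda>x. ?E #> x) ` (N2 \<inter> F))"
      by (rule card_mono) (use Y(1) in blast)
    ultimately show ?thesis by simp
  qed
  obtain l where l: "l \<in> chom (?GF\<lparr>carrier := ?E\<rparr>) (\<lambda>j. ?UF j \<inter> ?E) H"
    "\<And>x. x \<in> ?E \<Longrightarrow> \<alpha> (l x) = \<xi> x" "l ` ((N1 \<inter> F) \<inter> (N2 \<inter> F)) = L.A"
  proof (rule L.exists_lift_onto_kernel[OF normF[OF N12(1)] normF[OF N12(2)]])
    show "(N1 \<inter> F) \<inter> (N2 \<inter> F) \<subseteq> ?E" using RM E(3) by blast
    show "\<xi> x = \<one>\<^bsub>K\<^esub>" if "x \<in> (N1 \<inter> F) \<inter> (N2 \<inter> F)" for x using RM[OF that] \<xi>(2) d by simp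
    show "\<not> N1 \<inter> F \<subseteq> ?E" using x0 k(2) by blast
    show "card (carrier H) + card L.A + 2 \<le> card I'" "89 \<le> card I'" using rank A_eq by auto
  qed (use c32 A A_eq in auto)
  have lE: "l \<in> hom (G\<lparr>carrier := ?E\<rparr>) H" using chom_hom[OF l(1)] by simp
  have l_mult: "l (x \<otimes> x') = l x \<otimes>\<^bsub>H\<^esub> l x'" if "x \<in> ?E" "x' \<in> ?E" for x x'
    using hom_mult[OF lE] that by simp
  have l_closed: "l x \<in> carrier H" if "x \<in> ?E" for x using hom_in_carrier[OF lE] that by simp
  have "l \<in> chom (G\<lparr>carrier := M\<rparr>) (\<lambda>i. U i \<inter> M) H"
  proof -
    have "l \<in> hom (G\<lparr>carrier := M\<rparr>) H"
      by (rule homI) (use l_mult l_closed E(3) in auto)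
    moreover obtain j where j: "\<And>x. x \<in> U j \<inter> F \<inter> ?E \<Longrightarrow> l x = \<one>\<^bsub>H\<^esub>" using l(1) by (auto simp: chom_def)
    then have "\<forall>x\<in>U j \<inter> M. l x = \<one>\<^bsub>H\<^esub>" using E(3) F(3) by blast
    ultimately show ?thesis unfolding chom_def by blast
  qed
  \<comment> \<open>An element of \<open>M\<close> with the right image in \<open>K\<close> is
    corrected by an element of \<open>N1 \<inter> N2 \<inter> F\<close>. That group lies in
    \<open>M\<close> and \<open>l\<close> maps it onto the whole kernel of \<alpha>.\<close>
  moreover have "l ` M = carrier H"
  proof
    show "l ` M \<subseteq> carrier H" using l_closed E(3) by blast
    show "carrier H \<subseteq> l ` M"
    proof
      fix h assume h: "h \<in> carrier H"
      then have "\<alpha> h \<in> \<phi> ` M" using \<alpha>(2) \<phi>(2) by blast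
      then obtain m where m: "m \<in> M" "\<phi> m = \<alpha> h" by force
      have mE: "m \<in> ?E" using m(1) E(3) by blast
      have am: "\<alpha> (l m) = \<alpha> h" using l(2)[OF mE] \<xi>(2)[OF m(1)] m(2) by simp
      have "inv\<^bsub>H\<^esub> l m \<otimes>\<^bsub>H\<^esub> h \<in> ?A" using l_closed[OF mE] h am by simp
      then have "inv\<^bsub>H\<^esub> l m \<otimes>\<^bsub>H\<^esub> h \<in> l ` ((N1 \<inter> F) \<inter> (N2 \<inter> F))" using l(3) A_eq by simp
      then obtain x where x: "x \<in> (N1 \<inter> F) \<inter> (N2 \<inter> F)" "l x = inv\<^bsub>H\<^esub> l m \<otimes>\<^bsub>H\<^esub> h" by force
      have xM: "x \<in> M" using RM[OF x(1)] by simp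
      have "l (m \<otimes> x) = l m \<otimes>\<^bsub>H\<^esub> (inv\<^bsub>H\<^esub> l m \<otimes>\<^bsub>H\<^esub> h)" using l_mult[OF mE] xM E(3) x(2) by auto
      also have "\<dots> = h" using l_closed[OF mE] h by (simp add: L.H.m_assoc[symmetric])
      finally show "h \<in> l ` M" using subgroup.m_closed[OF M(1) m(1) xM] by (metis imageI)
    qed
  qed
  moreover have "\<alpha> (l x) = \<phi> x" if "x \<in> M" for x using l(2)[of x] \<xi>(2)[OF that] E(3) that by auto
  ultimately show ?thesis unfolding solves_def by simp blast
qed

theorem diamond_embeddings_solvable:
  fixes z :: "'i \<Rightarrow> 'a"
  assumes "free_on G U I z" "finite I" "card I \<ge> 2"
    and M: "subgroup M G" "closed M" "infinite (rcosets M)"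
    and "M1 \<lhd> G" "M2 \<lhd> G" "M1 \<inter> M2 \<subseteq> M" "\<not> M1 \<subseteq> M" "\<not> M2 \<subseteq> M"
  shows "embeddings_solvable (G\<lparr>carrier := M\<rparr>) (\<lambda>i. U i \<inter> M)"
  by (rule embeddings_solvable_if_minimal[OF subgroup.subgroup_is_group[OF M(1) is_group]])
    (rule diamond_minimal[OF assms])

end

section \<open>Uniqueness by back and forth\<close>

text \<open>The generators converge to 1, so \<phi> kills all but finitely many of them. Those few
  are lifted arbitrarily, and some of the killed ones are sent onto the kernel of \<alpha>, which
  makes the lift surjective.\<close>

lemma (in chain_group) free_embeddings_solvable:
  fixes z :: "nat \<Rightarrow> 'a"
  assumes free: "free_on G U UNIV z" and conv: "\<And>i. finite {n. z n \<notin> U i}"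
  shows "embeddings_solvable G U"
  unfolding embeddings_solvable_def
proof (intro allI impI)
  fix K H :: "nat monoid" and \<phi> \<alpha> assume ep: "embedding_problem G U K H \<phi> \<alpha>"
  then have K: "group K" and H: "group H" "finite (carrier H)"
    and \<phi>: "\<phi> \<in> chom G U K" "\<phi> ` carrier G = carrier K"
    and \<alpha>: "\<alpha> \<in> hom H K" "\<alpha> ` carrier H = carrier K"
    by (auto simp: embedding_problem_def)
  interpret \<alpha>: group_hom H K \<alpha> by (rule group_homI[OF H(1) K \<alpha>(1)])
  interpret \<phi>: group_hom G K \<phi> by (rule group_homI[OF is_group K chom_hom[OF \<phi>(1)]])
  have zc: "z n \<in> carrier G" for n by (rule free_on_carrier[OF free UNIV_I])
  obtain i where i: "\<And>x. x \<in> U i \<Longrightarrow> \<phi> x = \<one>\<^bsub>K\<^esub>" using \<phi>(1) by (auto simp: chom_def)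
  obtain m where m: "\<And>n. z n \<notin> U i \<Longrightarrow> n < m"
    using conv[of i] by (auto simp: finite_nat_set_iff_bounded)
  have \<phi>z: "\<phi> (z n) = \<one>\<^bsub>K\<^esub>" if "n \<ge> m" for n using i m[of n] that by force
  let ?A = "{a \<in> carrier H. \<alpha> a = \<one>\<^bsub>K\<^esub>}"
  have "finite ?A" using H(2) by simp
  then obtain as where as: "set as = ?A" using finite_list by blast
  define q where "q n = (if n < m then SOME b. b \<in> carrier H \<and> \<alpha> b = \<phi> (z n)
      else if n < m + length as then as ! (n - m) else \<one>\<^bsub>H\<^esub>)" for n
  have q: "q n \<in> carrier H \<and> \<alpha> (q n) = \<phi> (z n)" for n
  proof -
    have "\<phi> (z n) \<in> \<alpha> ` carrier H" using \<alpha>(2) zc by simp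
    then have ex: "\<exists>b. b \<in> carrier H \<and> \<alpha> b = \<phi> (z n)" by auto
    have "as ! (n - m) \<in> ?A" if "\<not> n < m" "n < m + length as"
      using as nth_mem[of "n - m" as] that by auto
    then show ?thesis using someI_ex[OF ex] \<phi>z by (auto simp: q_def)
  qed
  have "{n \<in> UNIV. q n \<noteq> \<one>\<^bsub>H\<^esub>} \<subseteq> {..< m + length as}" by (auto simp: q_def not_less)
  then have "finite {n \<in> UNIV. q n \<noteq> \<one>\<^bsub>H\<^esub>}" by (rule finite_subset) simp
  then obtain f where f: "f \<in> chom G U H" "\<And>n. f (z n) = q n"
    using free_on_chom[OF free is_group H, of q] q by auto
  interpret f: group_hom G H f by (rule group_homI[OF is_group H(1) chom_hom[OF f(1)]])
  have lift: "\<alpha> (f x) = \<phi> x" if x: "x \<in> carrier G" for x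
  proof (rule chom_eqI[OF _ \<phi>(1) K free_on_dense[OF free] _ _ x])
    show "(\<lambda>x. \<alpha> (f x)) \<in> chom G U K" by (rule chom_compose[OF f(1) \<alpha>(1) H(1) K])
    show "range z \<subseteq> carrier G" using zc by auto
    show "\<alpha> (f y) = \<phi> y" if "y \<in> range z" for y using that f(2) q by auto
  qed
  have A: "a \<in> f ` carrier G" if a: "a \<in> ?A" for a
  proof -
    obtain j where j: "j < length as" "as ! j = a" using a as by (metis in_set_conv_nth)
    then have "f (z (m + j)) = a" by (simp add: f(2) q_def)
    then show ?thesis using zc by blast
  qed
  have "f ` carrier G = carrier H"
  proof
    show "carrier H \<subseteq> f ` carrier G"
    proof
      fix h assume h: "h \<in> carrier H"
      then have "\<alpha> h \<in> \<phi> ` carrier G" using \<phi>(2) by simp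
      then obtain x where x: "x \<in> carrier G" "\<phi> x = \<alpha> h" by force
      have "inv\<^bsub>H\<^esub> f x \<otimes>\<^bsub>H\<^esub> h \<in> ?A" using x h lift[OF x(1)] by simp
      then have "inv\<^bsub>H\<^esub> f x \<otimes>\<^bsub>H\<^esub> h \<in> f ` carrier G" by (rule A)
      then obtain y where y: "inv\<^bsub>H\<^esub> f x \<otimes>\<^bsub>H\<^esub> h = f y" "y \<in> carrier G" by (rule imageE)
      have "f (x \<otimes> y) = h" using x y(2) h by (simp add: y(1)[symmetric] \<alpha>.G.m_assoc[symmetric])
      then show "h \<in> f ` carrier G" using x(1) y(2) by (metis imageI m_closed)
    qed
  qed auto
  then show "solves G U K H \<phi> \<alpha>" unfolding solves_def using f(1) lift by blast
qed

text \<open>The two conditions express that the group is the inverse limit of its quotients by the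
  \<open>U i\<close>: points are separated, and a sequence that is Cauchy with the given modulus
  converges at the same rate.\<close>

locale complete_chain_group = chain_group +
  assumes separated: "\<And>x. (\<And>i. x \<in> U i) \<Longrightarrow> x = \<one>"
    and complete: "\<And>a. (\<And>i. a i \<in> carrier G) \<Longrightarrow> (\<And>i. a (Suc i) \<otimes> inv a i \<in> U i) \<Longrightarrow>
      \<exists>x\<in>carrier G. \<forall>i. x \<otimes> inv a i \<in> U i"

text \<open>Both groups are the inverse limit of the same tower \<open>Q\<close>. The index shift in
  \<open>ker_\<psi>\<close> and \<open>ker_\<theta>\<close> leaves \<open>Q 0\<close> unconstrained,
  so a tower can start with the trivial group.\<close>

locale common_tower = G: complete_chain_group G U + F: complete_chain_group F V
  for G :: "('a, 'm) monoid_scheme" (structure) and U :: "nat \<Rightarrow> 'a set"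
    and F :: "('b, 'n) monoid_scheme" and V :: "nat \<Rightarrow> 'b set" +
  fixes Q :: "nat \<Rightarrow> nat monoid" and \<psi> :: "nat \<Rightarrow> 'a \<Rightarrow> nat" and \<theta> :: "nat \<Rightarrow> 'b \<Rightarrow> nat" and \<pi> :: "nat \<Rightarrow> nat \<Rightarrow> nat"
  assumes Q: "group (Q n)"
    and \<psi>: "\<psi> n \<in> chom G U (Q n)" "\<psi> n ` carrier G = carrier (Q n)"
    and \<theta>: "\<theta> n \<in> chom F V (Q n)" "\<theta> n ` carrier F = carrier (Q n)"
    and \<pi>_\<psi>: "x \<in> carrier G \<Longrightarrow> \<pi> n (\<psi> (Suc n) x) = \<psi> n x"
    and \<pi>_\<theta>: "y \<in> carrier F \<Longrightarrow> \<pi> n (\<theta> (Suc n) y) = \<theta> n y"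
    and ker_\<psi>: "x \<in> carrier G \<Longrightarrow> \<psi> (Suc n) x = \<one>\<^bsub>Q (Suc n)\<^esub> \<Longrightarrow> x \<in> U n"
    and ker_\<theta>: "y \<in> carrier F \<Longrightarrow> \<theta> (Suc n) y = \<one>\<^bsub>Q (Suc n)\<^esub> \<Longrightarrow> y \<in> V n"
begin

lemma flip: "common_tower F V G U Q \<theta> \<psi> \<pi>"
  by (intro common_tower.intro common_tower_axioms.intro)
    (fact F.complete_chain_group_axioms G.complete_chain_group_axioms Q \<psi> \<theta> \<pi>_\<psi> \<pi>_\<theta> ker_\<psi> ker_\<theta>)+

definition match :: "'a \<Rightarrow> 'b \<Rightarrow> bool" where "match x y \<longleftrightarrow> (\<forall>n. \<psi> n x = \<theta> n y)"

lemma \<psi>_group_hom: "group_hom G (Q n) (\<psi> n)"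
  by (rule group_homI[OF G.is_group Q chom_hom[OF \<psi>(1)]])

lemma \<theta>_group_hom: "group_hom F (Q n) (\<theta> n)"
  by (rule group_homI[OF F.is_group Q chom_hom[OF \<theta>(1)]])

lemma match_down:
  assumes "x \<in> carrier G" "y \<in> carrier F" "n \<le> m" "\<psi> m x = \<theta> m y"
  shows "\<psi> n x = \<theta> n y"
  using assms(3,4)
proof (induction m rule: dec_induct)
  case (step m)
  have "\<pi> m (\<psi> (Suc m) x) = \<pi> m (\<theta> (Suc m) y)" using step.prems by simp
  then show ?case using step.IH \<pi>_\<psi>[OF assms(1)] \<pi>_\<theta>[OF assms(2)] by simp
qed simp

text \<open>Preimages \<open>b n\<close> of the images of \<open>x\<close> in the tower form a
  Cauchy sequence, and its limit matches \<open>x\<close>. The sequence is used from index 1 on,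
  since it is the kernel of \<open>\<theta> (Suc i)\<close> that lies in \<open>V i\<close>.\<close>

lemma match_exists:
  assumes x: "x \<in> carrier G"
  shows "\<exists>y\<in>carrier F. match x y"
proof -
  have "\<exists>y. y \<in> carrier F \<and> \<psi> n x = \<theta> n y" for n
  proof -
    have "\<psi> n x \<in> \<theta> n ` carrier F" using \<psi>(2)[of n] \<theta>(2)[of n] x by blast
    then show ?thesis by auto
  qed
  then obtain b where b: "\<And>n. b n \<in> carrier F" "\<And>n. \<psi> n x = \<theta> n (b n)" by metis
  have "b (Suc (Suc i)) \<otimes>\<^bsub>F\<^esub> inv\<^bsub>F\<^esub> b (Suc i) \<in> V i" for i
  proof (rule ker_\<theta>)
    interpret t: group_hom F "Q (Suc i)" "\<theta> (Suc i)" by (rule \<theta>_group_hom)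
    have "\<theta> (Suc i) (b (Suc (Suc i))) = \<theta> (Suc i) (b (Suc i))"
      using match_down[OF x b(1) _ b(2), of "Suc i" "Suc (Suc i)"] b(2)[of "Suc i"] by simp
    then show "\<theta> (Suc i) (b (Suc (Suc i)) \<otimes>\<^bsub>F\<^esub> inv\<^bsub>F\<^esub> b (Suc i)) = \<one>\<^bsub>Q (Suc i)\<^esub>"
      using b(1) by simp
    show "b (Suc (Suc i)) \<otimes>\<^bsub>F\<^esub> inv\<^bsub>F\<^esub> b (Suc i) \<in> carrier F" using b(1) by simp
  qed
  then obtain y where y: "y \<in> carrier F" "\<And>i. y \<otimes>\<^bsub>F\<^esub> inv\<^bsub>F\<^esub> b (Suc i) \<in> V i"
    using F.complete[of "\<lambda>i. b (Suc i)"] b(1) by blast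
  have "\<psi> n x = \<theta> n y" for n
  proof -
    interpret t: group_hom F "Q n" "\<theta> n" by (rule \<theta>_group_hom)
    obtain j where j: "\<And>v. v \<in> V j \<Longrightarrow> \<theta> n v = \<one>\<^bsub>Q n\<^esub>" using \<theta>(1)[of n] by (auto simp: chom_def)
    let ?j = "max j n"
    have "y \<otimes>\<^bsub>F\<^esub> inv\<^bsub>F\<^esub> b (Suc ?j) \<in> V j" using y(2)[of ?j] F.U_anti[of j ?j] by auto
    then have "\<theta> n (y \<otimes>\<^bsub>F\<^esub> inv\<^bsub>F\<^esub> b (Suc ?j)) = \<one>\<^bsub>Q n\<^esub>" by (rule j)
    then have "\<theta> n ((y \<otimes>\<^bsub>F\<^esub> inv\<^bsub>F\<^esub> b (Suc ?j)) \<otimes>\<^bsub>F\<^esub> b (Suc ?j)) = \<theta> n (b (Suc ?j))"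
      using y(1) b(1) by (subst t.hom_mult) auto
    then have "\<theta> n y = \<theta> n (b (Suc ?j))" using y(1) b(1) by (simp add: F.m_assoc)
    also have "\<dots> = \<psi> n x" using match_down[OF x b(1) _ b(2), of n "Suc ?j"] by simp
    finally show ?thesis by simp
  qed
  then show ?thesis using y(1) unfolding match_def by blast
qed

lemma match_unique:
  assumes "y \<in> carrier F" "y' \<in> carrier F" "match x y" "match x y'"
  shows "y = y'"
proof -
  have "y \<otimes>\<^bsub>F\<^esub> inv\<^bsub>F\<^esub> y' \<in> V i" for i
  proof (rule ker_\<theta>)
    interpret t: group_hom F "Q (Suc i)" "\<theta> (Suc i)" by (rule \<theta>_group_hom)
    have "\<theta> (Suc i) y = \<theta> (Suc i) y'" using assms(3,4) unfolding match_def by metis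
    then show "\<theta> (Suc i) (y \<otimes>\<^bsub>F\<^esub> inv\<^bsub>F\<^esub> y') = \<one>\<^bsub>Q (Suc i)\<^esub>" using assms(1,2) by simp
  qed (use assms in simp)
  then have "y \<otimes>\<^bsub>F\<^esub> inv\<^bsub>F\<^esub> y' = \<one>\<^bsub>F\<^esub>" by (rule F.separated)
  then have "y = inv\<^bsub>F\<^esub> (inv\<^bsub>F\<^esub> y')" using assms(1,2) by (metis F.inv_equality F.inv_closed)
  then show ?thesis using assms(2) by simp
qed

text \<open>Matching is a bijection, since existence and uniqueness also hold with the sides
  exchanged, by \<open>flip\<close>. The last two clauses are continuity of \<open>h\<close> and of
  its inverse.\<close>

lemma tower_iso:
  obtains h where "h \<in> iso G F" "\<And>i. \<exists>j. \<forall>x\<in>U j. h x \<in> V i"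
    "\<And>i. \<exists>j. \<forall>x\<in>carrier G. h x \<in> V j \<longrightarrow> x \<in> U i"
proof -
  interpret fl: common_tower F V G U Q \<theta> \<psi> \<pi> by (rule flip)
  have match_flip: "fl.match y x \<longleftrightarrow> match x y" for x y by (auto simp: fl.match_def match_def)
  obtain h where h: "\<And>x. x \<in> carrier G \<Longrightarrow> h x \<in> carrier F \<and> match x (h x)"
    using match_exists by metis
  have h_eq: "h x = y" if "x \<in> carrier G" "y \<in> carrier F" "match x y" for x y
    using match_unique[of "h x" y x] h[OF that(1)] that by simp
  have "h \<in> hom G F"
  proof (rule homI)
    fix x x' assume x: "x \<in> carrier G" "x' \<in> carrier G"
    have "\<psi> n (x \<otimes> x') = \<theta> n (h x \<otimes>\<^bsub>F\<^esub> h x')" for n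
    proof -
      interpret s: group_hom G "Q n" "\<psi> n" by (rule \<psi>_group_hom)
      interpret t: group_hom F "Q n" "\<theta> n" by (rule \<theta>_group_hom)
      show ?thesis using h[OF x(1)] h[OF x(2)] x by (simp add: match_def)
    qed
    then show "h (x \<otimes> x') = h x \<otimes>\<^bsub>F\<^esub> h x'"
      using x h by (intro h_eq) (auto simp: match_def)
  qed (use h in simp)
  moreover have "bij_betw h (carrier G) (carrier F)"
    unfolding bij_betw_def
  proof
    show "inj_on h (carrier G)"
    proof (rule inj_onI)
      fix x x' assume x: "x \<in> carrier G" "x' \<in> carrier G" "h x = h x'"
      show "x = x'"
        by (rule fl.match_unique[OF x(1,2), of "h x"]) (use h[OF x(1)] h[OF x(2)] x(3) match_flip in auto)
    qed
    show "h ` carrier G = carrier F"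
    proof
      show "carrier F \<subseteq> h ` carrier G"
      proof
        fix y assume y: "y \<in> carrier F"
        then obtain x where "x \<in> carrier G" "match x y" using fl.match_exists[OF y] match_flip by blast
        then show "y \<in> h ` carrier G" using h_eq[of x y] y by blast
      qed
    qed (use h in auto)
  qed
  moreover have "\<exists>j. \<forall>x\<in>U j. h x \<in> V i" for i
  proof -
    obtain j where j: "\<And>x. x \<in> U j \<Longrightarrow> \<psi> (Suc i) x = \<one>\<^bsub>Q (Suc i)\<^esub>" using \<psi>(1)[of "Suc i"] by (auto simp: chom_def)
    have "h x \<in> V i" if x: "x \<in> U j" for x
      by (rule ker_\<theta>) (use h[OF G.U_carrier[OF x]] j[OF x] in \<open>auto simp: match_def\<close>)
    then show ?thesis by blast
  qed
  moreover have "\<exists>j. \<forall>x\<in>carrier G. h x \<in> V j \<longrightarrow> x \<in> U i" for i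
  proof -
    obtain j where j: "\<And>y. y \<in> V j \<Longrightarrow> \<theta> (Suc i) y = \<one>\<^bsub>Q (Suc i)\<^esub>" using \<theta>(1)[of "Suc i"] by (auto simp: chom_def)
    have "x \<in> U i" if x: "x \<in> carrier G" "h x \<in> V j" for x
      by (rule ker_\<psi>[OF x(1)]) (use h[OF x(1)] j[OF x(2)] in \<open>auto simp: match_def\<close>)
    then show ?thesis by blast
  qed
  ultimately show ?thesis using that by (simp add: iso_def)
qed

end

definition common_quotient :: "('a, 'm) monoid_scheme \<Rightarrow> (nat \<Rightarrow> 'a set) \<Rightarrow> ('b, 'n) monoid_scheme \<Rightarrow> (nat \<Rightarrow> 'b set) \<Rightarrow>
    nat monoid \<Rightarrow> ('a \<Rightarrow> nat) \<Rightarrow> ('b \<Rightarrow> nat) \<Rightarrow> bool" where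
  "common_quotient G U F V Q \<psi> \<theta> \<longleftrightarrow> group Q \<and> finite (carrier Q) \<and> \<psi> \<in> chom G U Q \<and> \<psi> ` carrier G = carrier Q \<and>
     \<theta> \<in> chom F V Q \<and> \<theta> ` carrier F = carrier Q"

lemma common_quotient_flip: "common_quotient G U F V Q \<psi> \<theta> \<Longrightarrow> common_quotient F V G U Q \<theta> \<psi>"
  by (simp add: common_quotient_def)

text \<open>\<open>Q'\<close> is \<open>G\<close> modulo the intersection of
  \<open>ker \<psi>\<close> with \<open>U n\<close>. On the side of \<open>F\<close>, a map onto
  \<open>Q'\<close> over \<theta> is a solution of the embedding problem given by \<theta> and
  \<open>Q' \<rightarrow> Q\<close>.\<close>

lemma refine_common_quotient:
  assumes G: "chain_group G U" and F: "group F" "embeddings_solvable F V"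
    and cq: "common_quotient G U F V Q \<psi> \<theta>"
  shows "\<exists>Q' \<psi>' \<theta>' \<pi>. common_quotient G U F V Q' \<psi>' \<theta>' \<and> (\<forall>x\<in>carrier G. \<psi>' x = \<one>\<^bsub>Q'\<^esub> \<longrightarrow> x \<in> U n) \<and>
      \<pi> \<in> hom Q' Q \<and> (\<forall>x\<in>carrier G. \<pi> (\<psi>' x) = \<psi> x) \<and> (\<forall>y\<in>carrier F. \<pi> (\<theta>' y) = \<theta> y)"
proof -
  interpret G: chain_group G U by fact
  have Q: "group Q" "finite (carrier Q)" and \<psi>: "\<psi> \<in> chom G U Q" "\<psi> ` carrier G = carrier Q"
    and \<theta>: "\<theta> \<in> chom F V Q" "\<theta> ` carrier F = carrier Q"
    using cq by (auto simp: common_quotient_def)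
  interpret \<psi>: group_hom G Q \<psi> by (rule group_homI[OF G.is_group Q(1) chom_hom[OF \<psi>(1)]])
  let ?N = "kernel G Q \<psi> \<inter> U n"
  have N: "?N \<lhd> G" by (rule G.normal_subgroup_intersect[OF \<psi>.normal_kernel G.U_normal])
  obtain i where i: "\<And>x. x \<in> U i \<Longrightarrow> \<psi> x = \<one>\<^bsub>Q\<^esub>" using \<psi>(1) by (auto simp: chom_def)
  have sub: "U (max i n) \<subseteq> ?N"
    using G.U_anti[of i "max i n"] G.U_anti[of n "max i n"] i G.U_carrier by (auto simp: kernel_def)
  have finN: "finite (rcosets\<^bsub>G\<^esub> ?N)" by (rule G.finite_rcosets[OF normal_imp_subgroup[OF N] sub])
  obtain Q' :: "nat monoid" and h where Q': "group Q'" "finite (carrier Q')"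
    and h: "h \<in> hom G Q'" "h ` carrier G = carrier Q'" "\<And>x. x \<in> carrier G \<Longrightarrow> h x = \<one>\<^bsub>Q'\<^esub> \<longleftrightarrow> x \<in> ?N"
    using quotient_nat_copy[OF G.is_group N finN] by metis
  have "\<psi> x = \<one>\<^bsub>Q\<^esub>" if "x \<in> carrier G" "h x = \<one>\<^bsub>Q'\<^esub>" for x
    using h(3) that by (auto simp: kernel_def)
  then obtain \<pi> where \<pi>: "\<pi> \<in> hom Q' Q" "\<And>x. x \<in> carrier G \<Longrightarrow> \<pi> (h x) = \<psi> x"
    using factor_hom[OF G.is_group Q'(1) Q(1) h(1,2) chom_hom[OF \<psi>(1)]] by metis
  have hc: "h \<in> chom G U Q'"
    using h(1,3) sub G.U_carrier unfolding chom_def by blast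
  have "\<pi> ` carrier Q' = carrier Q"
  proof -
    have "\<pi> ` carrier Q' = (\<lambda>x. \<pi> (h x)) ` carrier G" by (simp only: h(2)[symmetric] image_image)
    also have "\<dots> = \<psi> ` carrier G" by (rule image_cong) (simp_all add: \<pi>(2))
    finally show ?thesis using \<psi>(2) by simp
  qed
  then have "embedding_problem F V Q Q' \<theta> \<pi>"
    using Q Q' \<theta> \<pi>(1) by (simp add: embedding_problem_def)
  then have "solves F V Q Q' \<theta> \<pi>" using F(2) unfolding embeddings_solvable_def by blast
  then obtain \<theta>' where \<theta>': "\<theta>' \<in> chom F V Q'" "\<theta>' ` carrier F = carrier Q'" "\<forall>y\<in>carrier F. \<pi> (\<theta>' y) = \<theta> y"
    unfolding solves_def by blast
  have "common_quotient G U F V Q' h \<theta>'"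
    using Q' hc h(2) \<theta>' by (simp add: common_quotient_def)
  moreover have "\<forall>x\<in>carrier G. h x = \<one>\<^bsub>Q'\<^esub> \<longrightarrow> x \<in> U n" using h(3) by blast
  moreover have "\<forall>x\<in>carrier G. \<pi> (h x) = \<psi> x" using \<pi>(2) by blast
  ultimately show ?thesis using \<pi>(1) \<theta>'(3) by blast
qed

text \<open>One refinement in each direction. The second one does not spoil the first, because
  \<open>\<psi>1\<close> factors through \<open>\<psi>2\<close>.\<close>

lemma refine_both:
  assumes G: "chain_group G U" "embeddings_solvable G U" and F: "chain_group F V" "embeddings_solvable F V"
    and cq: "common_quotient G U F V Q \<psi> \<theta>"
  shows "\<exists>Q' \<psi>' \<theta>'. common_quotient G U F V Q' \<psi>' \<theta>' \<and> (\<forall>x\<in>carrier G. \<psi>' x = \<one>\<^bsub>Q'\<^esub> \<longrightarrow> x \<in> U n) \<and>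
      (\<forall>y\<in>carrier F. \<theta>' y = \<one>\<^bsub>Q'\<^esub> \<longrightarrow> y \<in> V n) \<and>
      (\<exists>\<pi>. (\<forall>x\<in>carrier G. \<pi> (\<psi>' x) = \<psi> x) \<and> (\<forall>y\<in>carrier F. \<pi> (\<theta>' y) = \<theta> y))"
proof -
  have gG: "group G" and gF: "group F" using G(1) F(1) by (auto simp: chain_group_def)
  obtain Q1 \<psi>1 \<theta>1 \<pi>1 where 1: "common_quotient G U F V Q1 \<psi>1 \<theta>1" "\<forall>x\<in>carrier G. \<psi>1 x = \<one>\<^bsub>Q1\<^esub> \<longrightarrow> x \<in> U n"
      "\<forall>x\<in>carrier G. \<pi>1 (\<psi>1 x) = \<psi> x" "\<forall>y\<in>carrier F. \<pi>1 (\<theta>1 y) = \<theta> y"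
    using refine_common_quotient[OF G(1) gF F(2) cq, of n] by blast
  obtain Q2 \<psi>2 \<theta>2 \<pi>2 where 2: "common_quotient F V G U Q2 \<theta>2 \<psi>2" "\<forall>y\<in>carrier F. \<theta>2 y = \<one>\<^bsub>Q2\<^esub> \<longrightarrow> y \<in> V n"
      "\<pi>2 \<in> hom Q2 Q1" "\<forall>y\<in>carrier F. \<pi>2 (\<theta>2 y) = \<theta>1 y" "\<forall>x\<in>carrier G. \<pi>2 (\<psi>2 x) = \<psi>1 x"
    using refine_common_quotient[OF F(1) gG G(2) common_quotient_flip[OF 1(1)], of n] by blast
  have "\<pi>2 \<one>\<^bsub>Q2\<^esub> = \<one>\<^bsub>Q1\<^esub>"
    using hom_one[OF 2(3)] 1(1) 2(1) by (simp add: common_quotient_def)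
  then have "\<forall>x\<in>carrier G. \<psi>2 x = \<one>\<^bsub>Q2\<^esub> \<longrightarrow> x \<in> U n" using 1(2) 2(5) by metis
  moreover have "\<forall>x\<in>carrier G. (\<pi>1 \<circ> \<pi>2) (\<psi>2 x) = \<psi> x" using 1(3) 2(5) by simp
  moreover have "\<forall>y\<in>carrier F. (\<pi>1 \<circ> \<pi>2) (\<theta>2 y) = \<theta> y" using 1(4) 2(4) by simp
  ultimately show ?thesis using common_quotient_flip[OF 2(1)] 2(2) by blast
qed

theorem iwasawa_uniqueness:
  fixes G :: "('a, 'm) monoid_scheme" and F :: "('c, 'n) monoid_scheme"
  assumes G: "complete_chain_group G U" "embeddings_solvable G U"
    and F: "complete_chain_group F V" "embeddings_solvable F V"
  obtains h where "h \<in> iso G F" "\<And>i. \<exists>j. \<forall>x\<in>U j. h x \<in> V i"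
    "\<And>i. \<exists>j. \<forall>x\<in>carrier G. h x \<in> V j \<longrightarrow> x \<in> U i"
proof -
  interpret G: complete_chain_group G U by fact
  interpret F: complete_chain_group F V by fact
  define good where "good s \<longleftrightarrow> common_quotient G U F V (fst s) (fst (snd s)) (snd (snd s))"
    for s :: "nat monoid \<times> ('a \<Rightarrow> nat) \<times> ('c \<Rightarrow> nat)"
  define ref where "ref n s s' \<longleftrightarrow>
      (\<forall>x\<in>carrier G. fst (snd s') x = \<one>\<^bsub>fst s'\<^esub> \<longrightarrow> x \<in> U n) \<and>
      (\<forall>y\<in>carrier F. snd (snd s') y = \<one>\<^bsub>fst s'\<^esub> \<longrightarrow> y \<in> V n) \<and>
      (\<exists>\<pi>. (\<forall>x\<in>carrier G. \<pi> (fst (snd s') x) = fst (snd s) x) \<and> (\<forall>y\<in>carrier F. \<pi> (snd (snd s') y) = snd (snd s) y))"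
    for n and s s' :: "nat monoid \<times> ('a \<Rightarrow> nat) \<times> ('c \<Rightarrow> nat)"
  have "\<exists>f. \<forall>n. good (f n) \<and> ref n (f n) (f (Suc n))"
  proof (rule dependent_nat_choice)
    let ?one = "\<lparr>carrier = {0}, mult = (\<lambda>_ _. 0), one = 0\<rparr> :: nat monoid"
    have "group ?one" by (rule groupI) auto
    moreover have "(\<lambda>_. 0) \<in> chom G U ?one" "(\<lambda>_. 0) ` carrier G = carrier ?one"
      using G.one_closed by (auto simp: chom_def hom_def)
    moreover have "(\<lambda>_. 0) \<in> chom F V ?one" "(\<lambda>_. 0) ` carrier F = carrier ?one"
      using F.one_closed by (auto simp: chom_def hom_def)
    ultimately have "good (?one, \<lambda>_. 0, \<lambda>_. 0)" by (simp add: common_quotient_def good_def)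
    then show "\<exists>x. good x" by (rule exI)
  next
    fix s n assume "good s"
    from refine_both[OF G.chain_group_axioms G(2) F.chain_group_axioms F(2) this[unfolded good_def], of n]
    obtain Q' \<psi>' \<theta>' where "good (Q', \<psi>', \<theta>') \<and> ref n s (Q', \<psi>', \<theta>')"
      unfolding good_def ref_def fst_conv snd_conv by blast
    then show "\<exists>s'. good s' \<and> ref n s s'" by (rule exI)
  qed
  then obtain f where f: "\<forall>n. good (f n) \<and> ref n (f n) (f (Suc n))" ..
  define Q where "Q n = fst (f n)" for n
  define \<psi> where "\<psi> n = fst (snd (f n))" for n
  define \<theta> where "\<theta> n = snd (snd (f n))" for n
  have cq: "common_quotient G U F V (Q n) (\<psi> n) (\<theta> n)" for n
    using f unfolding good_def Q_def \<psi>_def \<theta>_def by blast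
  have ref: "(\<forall>x\<in>carrier G. \<psi> (Suc n) x = \<one>\<^bsub>Q (Suc n)\<^esub> \<longrightarrow> x \<in> U n) \<and>
      (\<forall>y\<in>carrier F. \<theta> (Suc n) y = \<one>\<^bsub>Q (Suc n)\<^esub> \<longrightarrow> y \<in> V n) \<and>
      (\<exists>\<pi>. (\<forall>x\<in>carrier G. \<pi> (\<psi> (Suc n) x) = \<psi> n x) \<and> (\<forall>y\<in>carrier F. \<pi> (\<theta> (Suc n) y) = \<theta> n y))" for n
    using f unfolding ref_def Q_def \<psi>_def \<theta>_def by blast
  then have "\<forall>n. \<exists>\<pi>. (\<forall>x\<in>carrier G. \<pi> (\<psi> (Suc n) x) = \<psi> n x) \<and> (\<forall>y\<in>carrier F. \<pi> (\<theta> (Suc n) y) = \<theta> n y)"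
    by blast
  from choice[OF this] obtain \<pi> where \<pi>: "\<And>n x. x \<in> carrier G \<Longrightarrow> \<pi> n (\<psi> (Suc n) x) = \<psi> n x"
    "\<And>n y. y \<in> carrier F \<Longrightarrow> \<pi> n (\<theta> (Suc n) y) = \<theta> n y" by blast
  interpret common_tower G U F V Q \<psi> \<theta> \<pi>
  proof (intro common_tower.intro common_tower_axioms.intro)
    show "x \<in> U n" if "x \<in> carrier G" "\<psi> (Suc n) x = \<one>\<^bsub>Q (Suc n)\<^esub>" for x n using ref that by blast
    show "y \<in> V n" if "y \<in> carrier F" "\<theta> (Suc n) y = \<one>\<^bsub>Q (Suc n)\<^esub>" for y n using ref that by blast
  qed (use cq G(1) F(1) \<pi> in \<open>simp_all add: common_quotient_def\<close>)
  show ?thesis using tower_iso that by blast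
qed

lemma (in group) finite_rcosets_if_finite_image:
  assumes N: "subgroup N G" and fin: "finite (f ` carrier G)"
    and sep: "\<And>x y. x \<in> carrier G \<Longrightarrow> y \<in> carrier G \<Longrightarrow> f x = f y \<Longrightarrow> x \<otimes> inv y \<in> N"
  shows "finite (rcosets N)"
proof -
  let ?s = "inv_into (carrier G) f"
  have "rcosets N \<subseteq> (\<lambda>v. N #> ?s v) ` f ` carrier G"
  proof
    fix t assume "t \<in> rcosets N"
    then obtain x where x: "x \<in> carrier G" "t = N #> x" by (auto simp: RCOSETS_def)
    have s: "?s (f x) \<in> carrier G" "f (?s (f x)) = f x"
      using x(1) by (auto intro: inv_into_into f_inv_into_f)
    have "t = N #> ?s (f x)"
      using sep[OF x(1) s(1) s(2)[symmetric]] rcos_eq_iff[OF N x(1) s(1)] x(2) by simp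
    then show "t \<in> (\<lambda>v. N #> ?s v) ` f ` carrier G" using x(1) by blast
  qed
  then show ?thesis by (rule finite_subset) (simp add: fin)
qed

section \<open>Words\<close>

lemma carrier_free_group: "w \<in> carrier (free_group X) \<longleftrightarrow> reduced w \<and> snd ` set w \<subseteq> X"
  by (simp add: free_group_def)

lemma mult_free_group: "u \<otimes>\<^bsub>free_group X\<^esub> v = foldr push u v"
  by (simp add: free_group_def)

lemma one_free_group: "\<one>\<^bsub>free_group X\<^esub> = []"
  by (simp add: free_group_def)

lemma letter_mem: "snd a \<in> X \<Longrightarrow> [a] \<in> carrier (free_group X)"
  by (simp add: carrier_free_group reduced_def)

lemma letter_mult: "a # w \<in> carrier (free_group X) \<Longrightarrow> [a] \<otimes>\<^bsub>free_group X\<^esub> w = a # w"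
  by (auto simp: carrier_free_group mult_free_group push_def reduced_Cons)

lemma letter_inverse: "[inv_letter a] \<otimes>\<^bsub>free_group X\<^esub> [a] = \<one>\<^bsub>free_group X\<^esub>"
  by (simp add: mult_free_group one_free_group push_def)

lemma Cons_carrier_free_group:
  "a # w \<in> carrier (free_group X) \<Longrightarrow> w \<in> carrier (free_group X) \<and> snd a \<in> X"
  by (auto simp: carrier_free_group reduced_Cons)

lemma free_group_induct [consumes 1, case_names Nil letter]:
  assumes "w \<in> carrier (free_group X)" "P []"
    and step: "\<And>a w. snd a \<in> X \<Longrightarrow> w \<in> carrier (free_group X) \<Longrightarrow> P w \<Longrightarrow> P ([a] \<otimes>\<^bsub>free_group X\<^esub> w)"
  shows "P w"
  using assms(1)
proof (induction w)
  case (Cons a w)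
  then show ?case using step[of a w] Cons_carrier_free_group[OF Cons.prems] letter_mult[OF Cons.prems] by simp
qed (rule assms(2))

text \<open>Free reduction does not change the action of a word if a letter and its inverse act by
  mutually inverse maps.\<close>

lemma foldr_letters_push:
  assumes assoc: "\<And>b. g a (g (inv_letter a) b) = b" "\<And>b. g (inv_letter a) (g a b) = b"
  shows "foldr g (push a w) e = g a (foldr g w e)"
  using assoc by (cases w) (auto simp: push_def)

section \<open>Universal property of the abstract free group\<close>

definition letter_value :: "('b, 'm) monoid_scheme \<Rightarrow> ('x \<Rightarrow> 'b) \<Rightarrow> bool \<times> 'x \<Rightarrow> 'b" where
  "letter_value H q a = (if fst a then q (snd a) else inv\<^bsub>H\<^esub> q (snd a))"

definition word_value :: "('b, 'm) monoid_scheme \<Rightarrow> ('x \<Rightarrow> 'b) \<Rightarrow> (bool \<times> 'x) list \<Rightarrow> 'b" where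
  "word_value H q w = foldr (\<lambda>a b. letter_value H q a \<otimes>\<^bsub>H\<^esub> b) w \<one>\<^bsub>H\<^esub>"

context
  fixes H :: "('b, 'm) monoid_scheme" (structure) and q :: "'x \<Rightarrow> 'b" and X :: "'x set"
  assumes H: "group H" and q: "q ` X \<subseteq> carrier H"
begin

interpretation group H by (rule H)

lemma letter_value_closed: "snd a \<in> X \<Longrightarrow> letter_value H q a \<in> carrier H"
  using q by (auto simp: letter_value_def)

lemma word_value_closed: "snd ` set w \<subseteq> X \<Longrightarrow> word_value H q w \<in> carrier H"
  by (induction w) (auto simp: word_value_def letter_value_closed)

lemma word_value_push:
  assumes "snd a \<in> X" "snd ` set w \<subseteq> X"
  shows "word_value H q (push a w) = letter_value H q a \<otimes> word_value H q w"
proof (cases "w \<noteq> [] \<and> hd w = inv_letter a")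
  case True
  then obtain w' where w': "w = inv_letter a # w'" by (cases w) auto
  have "letter_value H q a \<otimes> letter_value H q (inv_letter a) = \<one>"
    using assms(1) q by (auto simp: letter_value_def inv_letter_def)
  moreover have "word_value H q w' \<in> carrier H" using assms(2) w' by (intro word_value_closed) auto
  moreover have "letter_value H q (inv_letter a) \<in> carrier H"
    using assms(1) by (intro letter_value_closed) (simp add: inv_letter_def)
  ultimately show ?thesis
    using letter_value_closed[OF assms(1)] w' by (simp add: push_def word_value_def m_assoc[symmetric])
next
  case False
  then have "push a w = a # w" by (auto simp: push_def)
  then show ?thesis by (simp add: word_value_def)
qed

lemma word_value_hom: "word_value H q \<in> hom (free_group X) H"
proof (rule homI)
  fix u v assume "u \<in> carrier (free_group X)" "v \<in> carrier (free_group X)"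
  then have u: "snd ` set u \<subseteq> X" and v: "snd ` set v \<subseteq> X" by (auto simp: carrier_free_group)
  have "word_value H q (foldr push u v) = word_value H q u \<otimes> word_value H q v"
    using u
  proof (induction u)
    case Nil
    show ?case using word_value_closed[OF v] by (simp add: word_value_def)
  next
    case (Cons a u)
    have uv: "snd ` set (foldr push u v) \<subseteq> X" using order_trans[OF snd_set_foldr_push[of u v]] Cons.prems v by simp
    have "word_value H q (foldr push (a # u) v) = letter_value H q a \<otimes> word_value H q (foldr push u v)"
      using word_value_push[OF _ uv, of a] Cons.prems by simp
    also have "\<dots> = letter_value H q a \<otimes> (word_value H q u \<otimes> word_value H q v)"
      using Cons by simp
    also have "\<dots> = word_value H q (a # u) \<otimes> word_value H q v"
      using letter_value_closed[of a] word_value_closed[of u] word_value_closed[OF v] Cons.prems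
      by (simp add: word_value_def m_assoc)
    finally show ?case .
  qed
  then show "word_value H q (u \<otimes>\<^bsub>free_group X\<^esub> v) = word_value H q u \<otimes> word_value H q v"
    by (simp add: mult_free_group)
qed (simp add: word_value_closed carrier_free_group)

lemma word_value_letter: "x \<in> X \<Longrightarrow> word_value H q [(True, x)] = q x"
  using q by (auto simp: word_value_def letter_value_def)

end

section \<open>A cofinal sequence of levels\<close>

text \<open>Every level contains the words that act trivially in all permutation representations of
  sufficiently large degree \<open>i\<close> in which the generators \<open>x \<ge> i\<close> act trivially.\<close>

definition perm_reps :: "nat \<Rightarrow> (bool \<times> nat \<Rightarrow> nat \<Rightarrow> nat) set" where
  "perm_reps i = {s. (\<forall>a. s a permutes {..<i}) \<and> (\<forall>a. i \<le> snd a \<longrightarrow> s a = id)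
     \<and> (\<forall>a. s (inv_letter a) \<circ> s a = id)}"

definition run :: "(bool \<times> nat \<Rightarrow> nat \<Rightarrow> nat) \<Rightarrow> (bool \<times> nat) list \<Rightarrow> nat \<Rightarrow> nat" where
  "run s w = foldr (\<lambda>a p. s a \<circ> p) w id"

definition level :: "nat set \<Rightarrow> nat \<Rightarrow> (bool \<times> nat) list set" where
  "level X i = {w \<in> carrier (free_group X). \<forall>s\<in>perm_reps i. run s w = id}"

lemma finite_perm_reps: "finite (perm_reps i)"
proof -
  have "finite {s :: bool \<times> nat \<Rightarrow> nat \<Rightarrow> nat.
      \<forall>a. (a \<in> UNIV \<times> {..<i} \<longrightarrow> s a \<in> {p. p permutes {..<i}}) \<and> (a \<notin> UNIV \<times> {..<i} \<longrightarrow> s a = id)}"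
    by (rule finite_set_of_finite_funs) (auto simp: finite_permutations)
  then show ?thesis by (rule rev_finite_subset) (auto simp: perm_reps_def)
qed

lemma run_push:
  assumes "s \<in> perm_reps i"
  shows "run s (push a w) = s a \<circ> run s w"
proof -
  have 1: "s (inv_letter b) \<circ> s b = id" for b using assms unfolding perm_reps_def by blast
  have 2: "s b \<circ> s (inv_letter b) = id" for b using 1[of "inv_letter b"] by simp
  have "s (inv_letter a) \<circ> (s a \<circ> p) = p" "s a \<circ> (s (inv_letter a) \<circ> p) = p" for p
    using 1[of a] 2[of a] by (simp_all add: o_assoc)
  then show ?thesis unfolding run_def by (intro foldr_letters_push) auto
qed

lemma run_mult:
  assumes "s \<in> perm_reps i"
  shows "run s (u \<otimes>\<^bsub>free_group X\<^esub> v) = run s u \<circ> run s v"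
  by (induction u) (simp_all add: mult_free_group run_push[OF assms], simp_all add: run_def o_assoc)

lemma run_one: "run s \<one>\<^bsub>free_group X\<^esub> = id"
  by (simp add: one_free_group run_def)

lemma run_permutes: "s \<in> perm_reps i \<Longrightarrow> run s w permutes {..<i}"
  by (induction w) (auto simp: run_def perm_reps_def permutes_id intro: permutes_compose)

lemma perm_reps_Suc: "perm_reps i \<subseteq> perm_reps (Suc i)"
proof
  fix s assume "s \<in> perm_reps i"
  then have s: "s a permutes {..<i}" "i \<le> snd a \<Longrightarrow> s a = id" "s (inv_letter a) \<circ> s a = id" for a
    unfolding perm_reps_def by blast+
  have "s a permutes {..<Suc i}" for a by (rule permutes_subset[OF s(1)]) auto
  moreover have "s a = id" if "Suc i \<le> snd a" for a by (rule s(2)) (use that in simp)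
  ultimately show "s \<in> perm_reps (Suc i)" using s(3) unfolding perm_reps_def by blast
qed

lemma level_Suc: "level X (Suc i) \<subseteq> level X i"
  using perm_reps_Suc[of i] by (auto simp: level_def)

lemma level_normal: "level X i \<lhd> free_group X"
proof -
  interpret FG: group "free_group X" by (rule group_free_group)
  have inv: "run s (inv\<^bsub>free_group X\<^esub> w) \<circ> run s w = id" if "s \<in> perm_reps i" "w \<in> carrier (free_group X)" for s w
    using run_mult[OF that(1), of X "inv\<^bsub>free_group X\<^esub> w" w] that(2) run_one[of s X] by simp
  have "subgroup (level X i) (free_group X)"
  proof (rule FG.subgroupI)
    show "level X i \<noteq> {}" using FG.one_closed run_one by (auto simp: level_def)
  next
    fix w assume w: "w \<in> level X i"
    have "run s (inv\<^bsub>free_group X\<^esub> w) = id" if "s \<in> perm_reps i" for s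
      using inv[OF that, of w] w that by (simp add: level_def)
    then show "inv\<^bsub>free_group X\<^esub> w \<in> level X i" using w by (simp add: level_def)
  qed (auto simp: level_def run_mult)
  moreover have "x \<otimes>\<^bsub>free_group X\<^esub> w \<otimes>\<^bsub>free_group X\<^esub> inv\<^bsub>free_group X\<^esub> x \<in> level X i"
    if x: "x \<in> carrier (free_group X)" and w: "w \<in> level X i" for x w
  proof -
    have "run s (x \<otimes>\<^bsub>free_group X\<^esub> w \<otimes>\<^bsub>free_group X\<^esub> inv\<^bsub>free_group X\<^esub> x) = id" if s: "s \<in> perm_reps i" for s
      using run_mult[OF s, of X x "inv\<^bsub>free_group X\<^esub> x"] w s x run_one[of s X] by (simp add: run_mult[OF s] level_def)
    then show ?thesis using x w by (simp add: level_def)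
  qed
  ultimately show ?thesis unfolding FG.normal_inv_iff by blast
qed

text \<open>Modulo \<open>level X i\<close> a word is determined by its permutations in the finitely
  many members of \<open>perm_reps i\<close>, and the generators from \<open>i\<close> on lie in the
  level.\<close>

lemma level_mem: "level X i \<in> free_levels X"
proof -
  interpret FG: group "free_group X" by (rule group_free_group)
  have sub: "subgroup (level X i) (free_group X)" by (rule normal_imp_subgroup[OF level_normal])
  let ?f = "\<lambda>w. \<lambda>s\<in>perm_reps i. run s w"
  have "?f ` carrier (free_group X) \<subseteq> (\<Pi>\<^sub>E s\<in>perm_reps i. {p. p permutes {..<i}})"
    using run_permutes by auto
  moreover have "finite (\<Pi>\<^sub>E s\<in>perm_reps i. {p. p permutes {..<i}})"
    by (intro finite_PiE finite_perm_reps finite_permutations) simp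
  ultimately have fin: "finite (?f ` carrier (free_group X))" by (rule finite_subset)
  have "finite (rcosets\<^bsub>free_group X\<^esub> level X i)"
  proof (rule FG.finite_rcosets_if_finite_image[OF sub fin])
    fix u v assume u: "u \<in> carrier (free_group X)" and v: "v \<in> carrier (free_group X)" and eq: "?f u = ?f v"
    have "run s (u \<otimes>\<^bsub>free_group X\<^esub> inv\<^bsub>free_group X\<^esub> v) = id" if s: "s \<in> perm_reps i" for s
    proof -
      have "run s u = run s v" using fun_cong[OF eq, of s] s by simp
      then show ?thesis
        using run_mult[OF s, of X v "inv\<^bsub>free_group X\<^esub> v"] v run_one[of s X] by (simp add: run_mult[OF s])
    qed
    then show "u \<otimes>\<^bsub>free_group X\<^esub> inv\<^bsub>free_group X\<^esub> v \<in> level X i" using u v by (simp add: level_def)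
  qed
  moreover have "{x \<in> X. [(True, x)] \<notin> level X i} \<subseteq> {..<i}"
    by (auto simp: level_def run_def perm_reps_def letter_mem not_less[symmetric])
  then have "finite {x \<in> X. [(True, x)] \<notin> level X i}" by (rule finite_subset) simp
  ultimately show ?thesis using level_normal by (simp add: free_levels_def)
qed

text \<open>Left multiplication on the cosets of \<open>N\<close>, numbered by \<open>{..<k}\<close>
  and extended by the identity, belongs to \<open>perm_reps i\<close>: generators from
  \<open>m\<close> on lie in \<open>N\<close> and act trivially by normality. A word that acts
  trivially fixes the coset \<open>N\<close>, so it lies in \<open>N\<close>.\<close>

lemma level_cofinal:
  assumes N: "N \<in> free_levels X"
  obtains i where "level X i \<subseteq> N"
proof -
  let ?G = "free_group X"
  interpret FG: group ?G by (rule group_free_group)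
  have Nn: "N \<lhd> ?G" and fin: "finite (rcosets\<^bsub>?G\<^esub> N)" and finX: "finite {x \<in> X. [(True, x)] \<notin> N}"
    using N by (auto simp: free_levels_def)
  have Ns: "subgroup N ?G" by (rule normal_imp_subgroup[OF Nn])
  have NG: "N \<subseteq> carrier ?G" by (rule subgroup.subset[OF Ns])
  define k where "k = card (rcosets\<^bsub>?G\<^esub> N)"
  obtain b where b: "bij_betw b (rcosets\<^bsub>?G\<^esub> N) {0..<k}" using ex_bij_betw_finite_nat[OF fin] k_def by blast
  obtain m where m: "\<And>x. x \<in> X \<Longrightarrow> [(True, x)] \<notin> N \<Longrightarrow> x < m"
    using finX by (auto simp: finite_nat_set_iff_bounded)
  define i where "i = max k m"
  let ?c = "inv_into (rcosets\<^bsub>?G\<^esub> N) b"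
  have c_mem: "?c j \<in> rcosets\<^bsub>?G\<^esub> N" and b_c: "b (?c j) = j" if "j < k" for j
    using b that by (auto simp: bij_betw_def inv_into_into f_inv_into_f)
  have c_b: "?c (b t) = t" and b_less: "b t < k" if "t \<in> rcosets\<^bsub>?G\<^esub> N" for t
    using b that by (auto simp: bij_betw_def)
  define s where "s a j = (if snd a \<in> X \<and> j < k then b ((N #>\<^bsub>?G\<^esub> [a]) <#>\<^bsub>?G\<^esub> ?c j) else j)" for a j
  have sum: "(N #>\<^bsub>?G\<^esub> [a]) <#>\<^bsub>?G\<^esub> (N #>\<^bsub>?G\<^esub> w) = N #>\<^bsub>?G\<^esub> ([a] \<otimes>\<^bsub>?G\<^esub> w)" if "snd a \<in> X" "w \<in> carrier ?G" for a w
    by (rule normal.rcos_sum[OF Nn letter_mem[OF that(1)] that(2)])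
  have s_b: "s a (b (N #>\<^bsub>?G\<^esub> w)) = b (N #>\<^bsub>?G\<^esub> ([a] \<otimes>\<^bsub>?G\<^esub> w))" if "snd a \<in> X" "w \<in> carrier ?G" for a w
  proof -
    have "N #>\<^bsub>?G\<^esub> w \<in> rcosets\<^bsub>?G\<^esub> N" by (rule FG.rcosetsI[OF NG that(2)])
    then show ?thesis using c_b b_less that(1) sum[OF that] by (simp add: s_def)
  qed
  have s_inv: "s (inv_letter a) (s a j) = j" for a j
  proof (cases "snd a \<in> X \<and> j < k")
    case True
    then obtain w where w: "w \<in> carrier ?G" "?c j = N #>\<^bsub>?G\<^esub> w" using c_mem[of j] by (auto simp: RCOSETS_def)
    have a: "snd a \<in> X" "snd (inv_letter a) \<in> X" using True by (auto simp: inv_letter_def)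
    have j: "j = b (N #>\<^bsub>?G\<^esub> w)" using b_c[of j] True w(2) by simp
    have "[inv_letter a] \<otimes>\<^bsub>?G\<^esub> ([a] \<otimes>\<^bsub>?G\<^esub> w) = w"
      using letter_mem[OF a(1)] letter_mem[OF a(2)] w(1) letter_inverse[of X a] by (simp add: FG.m_assoc[symmetric])
    then show ?thesis
      using s_b[OF a(1) w(1)] s_b[OF a(2), of "[a] \<otimes>\<^bsub>?G\<^esub> w"] letter_mem[OF a(1)] w(1) j by simp
  next
    case False
    then show ?thesis by (auto simp: s_def inv_letter_def)
  qed
  have "s \<in> perm_reps i"
    unfolding perm_reps_def
  proof (intro CollectI conjI allI impI)
    fix a
    show "s (inv_letter a) \<circ> s a = id" by (rule ext) (simp only: comp_apply s_inv id_apply)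
    have "s a (s (inv_letter a) j) = j" for j using s_inv[of "inv_letter a" j] by simp
    then have "\<exists>!j. s a j = j'" for j' using s_inv[of a] by metis
    moreover have "s a j = j" if "j \<notin> {..<i}" for j using that by (auto simp: s_def i_def)
    ultimately show "s a permutes {..<i}" by (simp add: permutes_def)
    assume ai: "i \<le> snd a"
    show "s a = id"
    proof
      fix j
      show "s a j = id j"
      proof (cases "snd a \<in> X \<and> j < k")
        case True
        have T: "[(True, snd a)] \<in> N" using m[of "snd a"] ai True by (auto simp: i_def)
        have Tc: "[(True, snd a)] \<in> carrier ?G" using True by (intro letter_mem) simp
        have "[a] \<in> N"
        proof (cases "fst a")
          case True
          then show ?thesis using T by (cases a) simp
        next
          case False
          then have "a = inv_letter (True, snd a)" by (cases a) (simp add: inv_letter_def)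
          then have "[a] \<otimes>\<^bsub>?G\<^esub> [(True, snd a)] = \<one>\<^bsub>?G\<^esub>" using letter_inverse[of X "(True, snd a)"] by simp
          then have "[a] = inv\<^bsub>?G\<^esub> [(True, snd a)]"
            using FG.inv_equality[OF _ Tc letter_mem[of a X]] True by simp
          then show ?thesis using subgroup.m_inv_closed[OF Ns T] by simp
        qed
        then have "N #>\<^bsub>?G\<^esub> [a] = N" using FG.coset_join2[OF letter_mem[of a X] Ns] True by blast
        moreover have "N <#>\<^bsub>?G\<^esub> ?c j = ?c j"
          using normal.rcosets_mult_eq[OF Nn c_mem] True by blast
        ultimately show ?thesis using b_c True by (simp add: s_def)
      next
        case False
        then show ?thesis by (auto simp: s_def)
      qed
    qed
  qed
  have run_b: "run s w (b N) = b (N #>\<^bsub>?G\<^esub> w)" if "w \<in> carrier ?G" for w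
    using that
  proof (induction w rule: free_group_induct)
    case Nil
    then show ?case using FG.coset_mult_one[OF NG] by (simp add: run_def one_free_group)
  next
    case (letter a w)
    then show ?case
      using run_mult[OF \<open>s \<in> perm_reps i\<close>, of X "[a]" w] s_b by (simp add: run_def)
  qed
  have "level X i \<subseteq> N"
  proof
    fix w assume w: "w \<in> level X i"
    then have wc: "w \<in> carrier ?G" "run s w = id" using \<open>s \<in> perm_reps i\<close> by (auto simp: level_def)
    then have "b (N #>\<^bsub>?G\<^esub> w) = b N" using run_b[OF wc(1)] wc(2) by simp
    moreover have "N #>\<^bsub>?G\<^esub> w \<in> rcosets\<^bsub>?G\<^esub> N" "N \<in> rcosets\<^bsub>?G\<^esub> N"
      using FG.rcosetsI[OF NG wc(1)] FG.rcosets_self[OF Ns] by auto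
    ultimately have "N #>\<^bsub>?G\<^esub> w = N" using b by (meson bij_betw_def inj_on_eq_iff)
    then show "w \<in> N" by (rule FG.coset_join1[OF _ wc(1) Ns])
  qed
  then show ?thesis by (rule that)
qed

section \<open>The free profinite group\<close>

text \<open>The kernel of the projection to the quotient by \<open>level X i\<close>, in which the
  level itself is the neutral element.\<close>

definition nbhd :: "nat set \<Rightarrow> nat \<Rightarrow> ((bool \<times> nat) list set \<Rightarrow> (bool \<times> nat) list set) set" where
  "nbhd X i = {f \<in> carrier (free_profinite_group X). f (level X i) = level X i}"

definition word_image :: "nat set \<Rightarrow> (bool \<times> nat) list \<Rightarrow> (bool \<times> nat) list set \<Rightarrow> (bool \<times> nat) list set" where
  "word_image X w = (\<lambda>N\<in>free_levels X. N #>\<^bsub>free_group X\<^esub> w)"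

definition gen :: "nat set \<Rightarrow> nat \<Rightarrow> (bool \<times> nat) list set \<Rightarrow> (bool \<times> nat) list set" where
  "gen X x = word_image X [(True, x)]"

context
  fixes X :: "nat set"
begin

interpretation FG: group "free_group X" by (rule group_free_group)
interpretation P: group "free_profinite_group X" by (rule group_free_profinite_group)

private abbreviation (input) "G \<equiv> free_group X"
private abbreviation (input) "P \<equiv> free_profinite_group X"
private abbreviation (input) "L \<equiv> free_levels X"

lemma free_levels_normal: "N \<in> L \<Longrightarrow> N \<lhd> G"
  by (simp add: free_levels_def)

lemma free_levels_subgroup: "N \<in> L \<Longrightarrow> subgroup N G"
  by (rule normal_imp_subgroup[OF free_levels_normal])

lemma group_level_quotient: "N \<in> L \<Longrightarrow> group (G Mod N)"
  by (rule normal.factorgroup_is_group[OF free_levels_normal])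

lemma carrier_free_profinite_group:
  "f \<in> carrier P \<longleftrightarrow> f \<in> (\<Pi>\<^sub>E N\<in>L. carrier (G Mod N)) \<and> (\<forall>N\<in>L. \<forall>N'\<in>L. N \<subseteq> N' \<longrightarrow> f N \<subseteq> f N')"
  by (simp add: free_profinite_group_def Let_def)

lemma profinite_PiE: "f \<in> carrier P \<Longrightarrow> f \<in> (\<Pi>\<^sub>E N\<in>L. carrier (G Mod N))"
  unfolding carrier_free_profinite_group by (rule conjunct1)

lemma profinite_component: "f \<in> carrier P \<Longrightarrow> N \<in> L \<Longrightarrow> f N \<in> carrier (G Mod N)"
  unfolding carrier_free_profinite_group by (blast intro: PiE_mem)

lemma profinite_compatible: "f \<in> carrier P \<Longrightarrow> N \<in> L \<Longrightarrow> N' \<in> L \<Longrightarrow> N \<subseteq> N' \<Longrightarrow> f N \<subseteq> f N'"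
  unfolding carrier_free_profinite_group by blast

lemma profinite_mult: "N \<in> L \<Longrightarrow> (f \<otimes>\<^bsub>P\<^esub> g) N = f N \<otimes>\<^bsub>G Mod N\<^esub> g N"
  by (simp add: free_profinite_group_def Let_def)

lemma component_hom: "N \<in> L \<Longrightarrow> (\<lambda>f. f N) \<in> hom P (G Mod N)"
  by (rule homI) (simp_all only: profinite_component profinite_mult)

lemma component_group_hom: "N \<in> L \<Longrightarrow> group_hom P (G Mod N) (\<lambda>f. f N)"
  by (rule group_homI[OF P.is_group group_level_quotient component_hom])

lemma profinite_eqI: "f \<in> carrier P \<Longrightarrow> g \<in> carrier P \<Longrightarrow> (\<And>N. N \<in> L \<Longrightarrow> f N = g N) \<Longrightarrow> f = g"
  by (rule PiE_ext[OF profinite_PiE profinite_PiE])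

lemma component_rep:
  assumes "f \<in> carrier P" "N \<in> L"
  obtains w where "w \<in> carrier G" "f N = N #>\<^bsub>G\<^esub> w"
  using profinite_component[OF assms] by (auto simp: carrier_FactGroup)

text \<open>A word in the common coset at \<open>N\<close> lies, by compatibility, in both cosets at
  \<open>N'\<close>, and cosets of \<open>N'\<close> with a common element coincide.\<close>

lemma component_coarser:
  assumes f: "f \<in> carrier P" and g: "g \<in> carrier P" and N: "N \<in> L" "N' \<in> L" "N \<subseteq> N'" and eq: "f N = g N"
  shows "f N' = g N'"
proof -
  obtain w where w: "w \<in> carrier G" "f N = N #>\<^bsub>G\<^esub> w" by (rule component_rep[OF f N(1)])
  have wN: "w \<in> f N" using FG.rcos_self[OF w(1) free_levels_subgroup[OF N(1)]] w(2) by simp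
  have "h N' = N' #>\<^bsub>G\<^esub> w" if h: "h \<in> carrier P" "w \<in> h N" for h
  proof -
    have "h N' \<in> rcosets\<^bsub>G\<^esub> N'" using profinite_component[OF h(1) N(2)] by (simp add: FactGroup_def)
    moreover have "w \<in> h N'" using profinite_compatible[OF h(1) N] h(2) by blast
    ultimately show ?thesis using FG.rcosets_mem_eq(1)[OF free_levels_subgroup[OF N(2)]] by blast
  qed
  from this[OF f wN] this[OF g] show ?thesis using wN eq by simp
qed

lemma mem_nbhd_diff:
  assumes "f \<in> carrier P" "g \<in> carrier P"
  shows "f \<otimes>\<^bsub>P\<^esub> inv\<^bsub>P\<^esub> g \<in> nbhd X i \<longleftrightarrow> f (level X i) = g (level X i)"
proof -
  let ?N = "level X i"
  interpret c: group_hom P "G Mod ?N" "\<lambda>f. f ?N" by (rule component_group_hom[OF level_mem])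
  have "f \<otimes>\<^bsub>P\<^esub> inv\<^bsub>P\<^esub> g \<in> nbhd X i \<longleftrightarrow> (f \<otimes>\<^bsub>P\<^esub> inv\<^bsub>P\<^esub> g) ?N = \<one>\<^bsub>G Mod ?N\<^esub>"
    using assms by (simp add: nbhd_def)
  also have "\<dots> \<longleftrightarrow> f ?N \<otimes>\<^bsub>G Mod ?N\<^esub> inv\<^bsub>G Mod ?N\<^esub> g ?N = \<one>\<^bsub>G Mod ?N\<^esub>"
    using c.hom_mult[OF assms(1) P.inv_closed[OF assms(2)]] c.hom_inv[OF assms(2)] by (simp only:)
  also have "\<dots> \<longleftrightarrow> f ?N = g ?N"
    using c.hom_closed[OF assms(1)] c.hom_closed[OF assms(2)]
    by (metis c.H.inv_equality c.H.inv_inv c.H.inv_closed c.H.r_inv)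
  finally show ?thesis .
qed

lemma nbhd_kernel: "nbhd X i = kernel P (G Mod level X i) (\<lambda>f. f (level X i))"
  by (simp add: nbhd_def kernel_def)

lemma nbhd_Suc: "nbhd X (Suc i) \<subseteq> nbhd X i"
proof
  fix f assume f: "f \<in> nbhd X (Suc i)"
  then have fP: "f \<in> carrier P" by (simp add: nbhd_def)
  have one: "\<one>\<^bsub>P\<^esub> N = N" if "N \<in> L" for N
    using group_hom.hom_one[OF component_group_hom[OF that]] by simp
  have "f (level X (Suc i)) = \<one>\<^bsub>P\<^esub> (level X (Suc i))" using f one[OF level_mem] by (simp add: nbhd_def)
  then have "f (level X i) = \<one>\<^bsub>P\<^esub> (level X i)"
    by (rule component_coarser[OF fP P.one_closed level_mem level_mem level_Suc])
  then show "f \<in> nbhd X i" using fP one[OF level_mem] by (simp add: nbhd_def)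
qed

lemma profinite_chain_group: "chain_group P (nbhd X)"
proof (intro chain_group.intro chain_group_axioms.intro P.is_group nbhd_Suc)
  fix i
  interpret c: group_hom P "G Mod level X i" "\<lambda>f. f (level X i)" by (rule component_group_hom[OF level_mem])
  show n: "nbhd X i \<lhd> P" unfolding nbhd_kernel by (rule c.normal_kernel)
  have "finite (carrier (G Mod level X i))" using level_mem by (simp add: free_levels_def FactGroup_def)
  then have "finite ((\<lambda>f. f (level X i)) ` carrier P)"
    by (rule rev_finite_subset) (use c.hom_closed in blast)
  then show "finite (rcosets\<^bsub>P\<^esub> nbhd X i)"
    by (rule P.finite_rcosets_if_finite_image[OF normal_imp_subgroup[OF n]]) (simp add: mem_nbhd_diff)
qed

interpretation P: chain_group P "nbhd X" by (rule profinite_chain_group)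

lemma level_anti: "i \<le> j \<Longrightarrow> level X j \<subseteq> level X i"
  by (induction rule: dec_induct) (use level_Suc in blast)+

lemma profinite_complete_chain_group: "complete_chain_group P (nbhd X)"
proof (intro complete_chain_group.intro complete_chain_group_axioms.intro P.chain_group_axioms)
  fix f assume f: "\<And>i. f \<in> nbhd X i"
  then have fP: "f \<in> carrier P" by (simp add: nbhd_def)
  show "f = \<one>\<^bsub>P\<^esub>"
  proof (rule profinite_eqI[OF fP P.one_closed])
    fix N assume N: "N \<in> L"
    obtain i where i: "level X i \<subseteq> N" by (rule level_cofinal[OF N])
    have "f \<otimes>\<^bsub>P\<^esub> inv\<^bsub>P\<^esub> \<one>\<^bsub>P\<^esub> \<in> nbhd X i" using f fP by simp
    then have "f (level X i) = \<one>\<^bsub>P\<^esub> (level X i)" using mem_nbhd_diff[OF fP P.one_closed] by blast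
    then show "f N = \<one>\<^bsub>P\<^esub> N" by (rule component_coarser[OF fP P.one_closed level_mem N i])
  qed
next
  fix a assume a: "\<And>i. a i \<in> carrier P" "\<And>i. a (Suc i) \<otimes>\<^bsub>P\<^esub> inv\<^bsub>P\<^esub> a i \<in> nbhd X i"
  have ex: "\<exists>i. level X i \<subseteq> N" if "N \<in> L" for N using level_cofinal[OF that] by blast
  \<comment> \<open>The component of the limit at \<open>N\<close> is read off at the first index
    whose level lies in \<open>N\<close>; from there on the components of the sequence at
    \<open>N\<close> are constant.\<close>
  define j where "j N = (LEAST i. level X i \<subseteq> N)" for N
  have j: "level X (j N) \<subseteq> N" if "N \<in> L" for N unfolding j_def using ex[OF that] by (rule LeastI_ex)
  have j_le: "j N \<le> i" if "level X i \<subseteq> N" for N i unfolding j_def using that by (rule Least_le)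
  have stable: "a i N = a (j N) N" if N: "N \<in> L" and i: "j N \<le> i" for N i
    using i
  proof (induction i rule: dec_induct)
    case (step i)
    have "a (Suc i) (level X i) = a i (level X i)" using mem_nbhd_diff[OF a(1) a(1)] a(2) by blast
    then have "a (Suc i) N = a i N"
      by (rule component_coarser[OF a(1) a(1) level_mem N order_trans[OF level_anti[OF step.hyps(1)] j[OF N]]])
    then show ?case using step.IH by simp
  qed simp
  define f where "f = (\<lambda>N\<in>L. a (j N) N)"
  have f: "f N = a i N" if "N \<in> L" "j N \<le> i" for N i using stable[OF that] that(1) by (simp add: f_def)
  have fP: "f \<in> carrier P"
    unfolding carrier_free_profinite_group
  proof (intro conjI ballI impI)
    show "f \<in> (\<Pi>\<^sub>E N\<in>L. carrier (G Mod N))" using profinite_component[OF a(1)] by (auto simp: f_def)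
    fix N N' assume N: "N \<in> L" "N' \<in> L" "N \<subseteq> N'"
    show "f N \<subseteq> f N'"
      using f[OF N(1), of "max (j N) (j N')"] f[OF N(2), of "max (j N) (j N')"] profinite_compatible[OF a(1) N] by simp
  qed
  have "f \<otimes>\<^bsub>P\<^esub> inv\<^bsub>P\<^esub> a i \<in> nbhd X i" for i
  proof -
    have "f (level X i) = a i (level X i)" by (rule f[of "level X i" i]) (simp_all add: level_mem j_le)
    then show ?thesis using mem_nbhd_diff[OF fP a(1)[of i], of i] by blast
  qed
  then show "\<exists>f\<in>carrier P. \<forall>i. f \<otimes>\<^bsub>P\<^esub> inv\<^bsub>P\<^esub> a i \<in> nbhd X i" using fP by blast
qed

lemma word_image_carrier:
  assumes "w \<in> carrier G"
  shows "word_image X w \<in> carrier P"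
  unfolding carrier_free_profinite_group
proof (intro conjI ballI impI)
  show "word_image X w \<in> (\<Pi>\<^sub>E N\<in>L. carrier (G Mod N))"
    using assms by (auto simp: word_image_def carrier_FactGroup)
  fix N N' assume "N \<in> L" "N' \<in> L" "N \<subseteq> N'"
  then show "word_image X w N \<subseteq> word_image X w N'" by (auto simp: word_image_def r_coset_def)
qed

lemma word_image_mult:
  assumes "u \<in> carrier G" "v \<in> carrier G"
  shows "word_image X (u \<otimes>\<^bsub>G\<^esub> v) = word_image X u \<otimes>\<^bsub>P\<^esub> word_image X v"
proof (rule profinite_eqI)
  fix N assume N: "N \<in> L"
  show "word_image X (u \<otimes>\<^bsub>G\<^esub> v) N = (word_image X u \<otimes>\<^bsub>P\<^esub> word_image X v) N"
    using N normal.rcos_sum[OF free_levels_normal[OF N] assms] by (simp add: profinite_mult word_image_def)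
qed (use assms word_image_carrier in auto)

lemma word_image_group_hom: "group_hom G P (word_image X)"
  by (rule group_homI[OF FG.is_group P.is_group homI]) (simp_all add: word_image_carrier word_image_mult)

lemma gen_carrier: "x \<in> X \<Longrightarrow> gen X x \<in> carrier P"
  unfolding gen_def by (intro word_image_carrier letter_mem) simp

lemma word_image_in_subgroup:
  assumes S: "subgroup S P" "gen X ` X \<subseteq> S" and w: "w \<in> carrier G"
  shows "word_image X w \<in> S"
proof -
  interpret \<iota>: group_hom G P "word_image X" by (rule word_image_group_hom)
  show ?thesis using w
  proof (induction w rule: free_group_induct)
    case Nil
    have "word_image X [] = \<one>\<^bsub>P\<^esub>" using \<iota>.hom_one by (simp add: one_free_group)
    then show ?case using subgroup.one_closed[OF S(1)] by simp
  next
    case (letter a w)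
    have T: "[(True, snd a)] \<in> carrier G" using letter(1) by (intro letter_mem) simp
    have gS: "word_image X [(True, snd a)] \<in> S" using letter(1) S(2) by (auto simp: gen_def)
    have "word_image X [a] \<in> S"
    proof (cases "fst a")
      case True
      then show ?thesis using gS by (cases a) simp
    next
      case False
      then have "a = inv_letter (True, snd a)" by (cases a) (simp add: inv_letter_def)
      then have "[a] \<otimes>\<^bsub>G\<^esub> [(True, snd a)] = \<one>\<^bsub>G\<^esub>" using letter_inverse[of X "(True, snd a)"] by simp
      from FG.inv_equality[OF this T letter_mem[OF letter(1)]] have "[a] = inv\<^bsub>G\<^esub> [(True, snd a)]" by simp
      then show ?thesis using \<iota>.hom_inv[OF T] subgroup.m_inv_closed[OF S(1) gS] by simp
    qed
    then show ?case
      using \<iota>.hom_mult[OF letter_mem[OF letter(1)] letter(2)] subgroup.m_closed[OF S(1) _ letter(3)] by simp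
  qed
qed

text \<open>Density: at level \<open>i\<close> each element agrees with the image of a word.
  Universality: the kernel of the evaluation of words in \<open>H\<close> belongs to
  \<open>free_levels\<close>, as \<open>q\<close> is trivial on almost all generators, so evaluation
  factors through the projection to that quotient.\<close>

lemma profinite_free_on: "free_on P (nbhd X) X (gen X)"
  unfolding free_on_def
proof (intro conjI allI impI)
  show "gen X ` X \<subseteq> carrier P" using gen_carrier by blast
  show "dense_in P (nbhd X) (gen X ` X)"
    unfolding dense_in_def
  proof (intro allI impI subsetI)
    fix i S f assume S: "subgroup S P \<and> nbhd X i \<subseteq> S \<and> gen X ` X \<subseteq> S" and f: "f \<in> carrier P"
    obtain w where w: "w \<in> carrier G" "f (level X i) = level X i #>\<^bsub>G\<^esub> w" by (rule component_rep[OF f level_mem])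
    have wS: "word_image X w \<in> S" using word_image_in_subgroup S w(1) by blast
    have wP: "word_image X w \<in> carrier P" by (rule word_image_carrier[OF w(1)])
    have "f (level X i) = word_image X w (level X i)" using w(2) level_mem by (simp add: word_image_def)
    then have "f \<otimes>\<^bsub>P\<^esub> inv\<^bsub>P\<^esub> word_image X w \<in> S" using mem_nbhd_diff[OF f wP] S by blast
    then have "f \<otimes>\<^bsub>P\<^esub> inv\<^bsub>P\<^esub> word_image X w \<otimes>\<^bsub>P\<^esub> word_image X w \<in> S"
      using S wS by (blast intro: subgroup.m_closed)
    then show "f \<in> S" using f wP by (simp add: P.m_assoc)
  qed
next
  fix H :: "nat monoid" and q
  assume "group H \<and> finite (carrier H) \<and> q ` X \<subseteq> carrier H \<and> finite {x \<in> X. q x \<noteq> \<one>\<^bsub>H\<^esub>}"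
  then have H: "group H" "finite (carrier H)" and q: "q ` X \<subseteq> carrier H" "finite {x \<in> X. q x \<noteq> \<one>\<^bsub>H\<^esub>}" by auto
  let ?ev = "word_value H q"
  interpret ev: group_hom G H ?ev by (rule group_homI[OF FG.is_group H(1) word_value_hom[OF H(1) q(1)]])
  let ?N = "kernel G H ?ev"
  have ev_eq: "?ev u = ?ev v" if "u \<in> ?N #>\<^bsub>G\<^esub> v" "v \<in> carrier G" for u v
    using that by (auto simp: r_coset_def kernel_def)
  have "finite (?ev ` carrier G)" by (rule finite_subset[OF _ H(2)]) auto
  then have "finite (rcosets\<^bsub>G\<^esub> ?N)"
    by (rule FG.finite_rcosets_if_finite_image[OF normal_imp_subgroup[OF ev.normal_kernel]]) (simp add: kernel_def)
  moreover have "finite {x \<in> X. [(True, x)] \<notin> ?N}"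
    by (rule finite_subset[OF _ q(2)])
      (use letter_mem[of "(True, _)" X] word_value_letter[OF H(1) q(1)] in \<open>auto simp: kernel_def\<close>)
  ultimately have N: "?N \<in> L" using ev.normal_kernel by (simp add: free_levels_def)
  define f where "f F = ?ev (SOME w. w \<in> F ?N)" for F :: "(bool \<times> nat) list set \<Rightarrow> (bool \<times> nat) list set"
  have f: "f F = ?ev w" if F: "F \<in> carrier P" and w: "w \<in> F ?N" for F w
  proof -
    obtain v where v: "v \<in> carrier G" "F ?N = ?N #>\<^bsub>G\<^esub> v" by (rule component_rep[OF F N])
    have "(SOME w. w \<in> F ?N) \<in> F ?N" by (rule someI[of _ w]) (rule w)
    then show ?thesis using ev_eq[OF _ v(1)] w v(2) by (simp add: f_def)
  qed
  have "f \<in> hom P H"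
  proof (rule homI)
    fix F assume F: "F \<in> carrier P"
    obtain v where v: "v \<in> carrier G" "F ?N = ?N #>\<^bsub>G\<^esub> v" by (rule component_rep[OF F N])
    then have "f F = ?ev v" using f[OF F] FG.rcos_self[OF v(1) free_levels_subgroup[OF N]] by simp
    then show "f F \<in> carrier H" using v(1) by simp
    fix F' assume F': "F' \<in> carrier P"
    obtain v' where v': "v' \<in> carrier G" "F' ?N = ?N #>\<^bsub>G\<^esub> v'" by (rule component_rep[OF F' N])
    then have "f F' = ?ev v'" using f[OF F'] FG.rcos_self[OF v'(1) free_levels_subgroup[OF N]] by simp
    moreover have "(F \<otimes>\<^bsub>P\<^esub> F') ?N = ?N #>\<^bsub>G\<^esub> (v \<otimes>\<^bsub>G\<^esub> v')"
      using normal.rcos_sum[OF free_levels_normal[OF N] v(1) v'(1)] v(2) v'(2) by (simp add: profinite_mult[OF N])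
    then have "f (F \<otimes>\<^bsub>P\<^esub> F') = ?ev (v \<otimes>\<^bsub>G\<^esub> v')"
      using f[OF P.m_closed[OF F F']] FG.rcos_self[OF FG.m_closed[OF v(1) v'(1)] free_levels_subgroup[OF N]] by simp
    ultimately show "f (F \<otimes>\<^bsub>P\<^esub> F') = f F \<otimes>\<^bsub>H\<^esub> f F'" using \<open>f F = ?ev v\<close> v(1) v'(1) by simp
  qed
  moreover obtain i where i: "level X i \<subseteq> ?N" by (rule level_cofinal[OF N])
  have "f F = \<one>\<^bsub>H\<^esub>" if F: "F \<in> nbhd X i" for F
  proof -
    have FP: "F \<in> carrier P" "F (level X i) = level X i" using F by (auto simp: nbhd_def)
    have "[] \<in> level X i" using subgroup.one_closed[OF free_levels_subgroup[OF level_mem]] by (simp add: one_free_group)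
    then have "[] \<in> F ?N" using profinite_compatible[OF FP(1) level_mem N i] FP(2) by blast
    then show ?thesis using f[OF FP(1)] by (simp add: word_value_def)
  qed
  ultimately have "f \<in> chom P (nbhd X) H" unfolding chom_def by blast
  moreover have "f (gen X x) = q x" if x: "x \<in> X" for x
  proof -
    have l: "[(True, x)] \<in> carrier G" using x by (intro letter_mem) simp
    have "[(True, x)] \<in> gen X x ?N"
      using FG.rcos_self[OF l free_levels_subgroup[OF N]] N by (simp add: gen_def word_image_def)
    then have "f (gen X x) = ?ev [(True, x)]" by (rule f[OF gen_carrier[OF x]])
    then show ?thesis using word_value_letter[OF H(1) q(1) x] by simp
  qed
  ultimately show "\<exists>f\<in>chom P (nbhd X) H. \<forall>x\<in>X. f (gen X x) = q x" by blast
qed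

lemma gen_convergent: "finite {x \<in> X. gen X x \<notin> nbhd X i}"
proof (rule finite_subset)
  show "{x \<in> X. gen X x \<notin> nbhd X i} \<subseteq> {x \<in> X. [(True, x)] \<notin> level X i}"
  proof clarify
    fix x assume x: "x \<in> X" "gen X x \<notin> nbhd X i" "[(True, x)] \<in> level X i"
    have "[(True, x)] \<in> carrier G" using x(1) by (intro letter_mem) simp
    then have "level X i #>\<^bsub>G\<^esub> [(True, x)] = level X i"
      using FG.coset_join2 free_levels_subgroup[OF level_mem] x(3) by blast
    then have "gen X x \<in> nbhd X i"
      using gen_carrier[OF x(1)] level_mem by (simp add: nbhd_def gen_def word_image_def)
    with x(2) show False by blast
  qed
  show "finite {x \<in> X. [(True, x)] \<notin> level X i}" using level_mem[of X i] by (simp add: free_levels_def)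
qed

section \<open>Topology\<close>

lemma topspace_free_profinite: "topspace (free_profinite_topology X) = carrier P"
proof -
  have "carrier P \<subseteq> (\<Pi>\<^sub>E N\<in>L. carrier (G Mod N))" using profinite_PiE by blast
  then show ?thesis by (auto simp: free_profinite_topology_def)
qed

lemma openin_component: "N \<in> L \<Longrightarrow> openin (free_profinite_topology X) {f \<in> carrier P. f N = c}"
proof -
  assume N: "N \<in> L"
  let ?D = "\<lambda>N. discrete_topology (carrier (G Mod N))"
  have "continuous_map (product_topology ?D L) (?D N) (\<lambda>f. f N)"
    by (rule continuous_map_product_projection[OF N])
  then have "continuous_map (free_profinite_topology X) (?D N) (\<lambda>f. f N)"
    unfolding free_profinite_topology_def by (rule continuous_map_from_subtopology)
  moreover have "openin (?D N) ({c} \<inter> carrier (G Mod N))" by simp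
  ultimately have "openin (free_profinite_topology X) {f \<in> topspace (free_profinite_topology X). f N \<in> {c} \<inter> carrier (G Mod N)}"
    by (rule openin_continuous_map_preimage)
  moreover have "{f \<in> topspace (free_profinite_topology X). f N \<in> {c} \<inter> carrier (G Mod N)} = {f \<in> carrier P. f N = c}"
    using profinite_component[OF _ N] by (auto simp: topspace_free_profinite)
  ultimately show ?thesis by simp
qed

text \<open>A basic open set restricts only finitely many components, and by cofinality all of these
  are determined by the component at one deep level \<open>k\<close>.\<close>

lemma closedin_imp_closed:
  assumes M: "closedin (free_profinite_topology X) M"
  shows "P.closed M"
  unfolding P.closed_def
proof (intro ballI impI)
  fix f assume f: "f \<in> carrier P" "f \<notin> M"
  let ?D = "\<lambda>N. discrete_topology (carrier (G Mod N))"
  have MP: "M \<subseteq> carrier P" using closedin_subset[OF M] topspace_free_profinite by simp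
  have "openin (free_profinite_topology X) (carrier P - M)"
    using M topspace_free_profinite by (simp add: closedin_def)
  then obtain W where W: "openin (product_topology ?D L) W" "carrier P - M = W \<inter> carrier P"
    unfolding free_profinite_topology_def openin_subtopology by blast
  have "f \<in> W" using W(2) f by blast
  with W(1) have "\<exists>B. finite {N \<in> L. B N \<noteq> topspace (?D N)} \<and> (\<forall>N\<in>L. openin (?D N) (B N)) \<and>
      f \<in> Pi\<^sub>E L B \<and> Pi\<^sub>E L B \<subseteq> W"
    unfolding openin_product_topology_alt by (rule bspec)
  then obtain B where B0: "finite {N \<in> L. B N \<noteq> topspace (?D N)} \<and> (\<forall>N\<in>L. openin (?D N) (B N)) \<and>
      f \<in> Pi\<^sub>E L B \<and> Pi\<^sub>E L B \<subseteq> W" ..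
  note B = B0[THEN conjunct1] B0[THEN conjunct2, THEN conjunct2, THEN conjunct1]
    B0[THEN conjunct2, THEN conjunct2, THEN conjunct2]
  let ?J = "{N \<in> L. B N \<noteq> topspace (?D N)}"
  have "\<exists>k. \<forall>N\<in>J. level X k \<subseteq> N" if "finite J" "J \<subseteq> L" for J
    using that
  proof (induction J rule: finite_induct)
    case (insert N J)
    then obtain k where k: "\<forall>N\<in>J. level X k \<subseteq> N" by blast
    obtain l where l: "level X l \<subseteq> N" using level_cofinal[of N X] insert.prems by blast
    have "\<forall>N\<in>insert N J. level X (max k l) \<subseteq> N"
      using k l level_anti[of k "max k l"] level_anti[of l "max k l"] by auto
    then show ?case by blast
  qed simp
  then obtain k where k: "\<forall>N\<in>?J. level X k \<subseteq> N" using B(1) by blast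
  have "f \<notin> P.over k M"
  proof
    assume "f \<in> P.over k M"
    then obtain u g where ug: "u \<in> nbhd X k" "g \<in> M" "f = u \<otimes>\<^bsub>P\<^esub> g" by (auto simp: set_mult_def)
    have c: "u \<in> carrier P" "g \<in> carrier P" using P.U_carrier[OF ug(1)] ug(2) MP by auto
    have "f \<otimes>\<^bsub>P\<^esub> inv\<^bsub>P\<^esub> g = u" using ug(3) c by (simp add: P.m_assoc)
    then have eq: "f (level X k) = g (level X k)" using mem_nbhd_diff[OF f(1) c(2)] ug(1) by simp
    have "g \<in> Pi\<^sub>E L B"
    proof (rule PiE_I)
      fix N assume N: "N \<in> L"
      show "g N \<in> B N"
      proof (cases "N \<in> ?J")
        case True
        have "f N = g N" by (rule component_coarser[OF f(1) c(2) level_mem N _ eq]) (use k True in blast)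
        then show ?thesis using B(2) N by (metis PiE_mem)
      next
        case False
        then show ?thesis using profinite_component[OF c(2) N] N by simp
      qed
    next
      fix N assume "N \<notin> L"
      then show "g N = undefined" using c(2) unfolding carrier_free_profinite_group by (blast intro: PiE_arb)
    qed
    then have "g \<in> carrier P - M" using W(2) B(3) c(2) by blast
    then show False using ug(2) by blast
  qed
  then show "\<exists>k. f \<notin> P.over k M" by blast
qed

end

text \<open>Continuity into a product is tested on components, and the component at \<open>N\<close>
  depends only on that at some level below \<open>N\<close>. Maps controlled along the levels, such
  as an isomorphism from \<open>iwasawa_uniqueness\<close> and its inverse, are thus
  continuous.\<close>

lemma profinite_continuous_map:
  assumes S: "S \<subseteq> carrier (free_profinite_group X)" and T: "T \<subseteq> carrier (free_profinite_group Y)" "h ` S \<subseteq> T"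
    and unif: "\<And>i. \<exists>j. \<forall>f\<in>S. \<forall>g\<in>S. f (level X j) = g (level X j) \<longrightarrow> h f (level Y i) = h g (level Y i)"
  shows "continuous_map (subtopology (free_profinite_topology X) S) (subtopology (free_profinite_topology Y) T) h"
proof -
  let ?S = "subtopology (free_profinite_topology X) S"
  let ?D = "\<lambda>N. discrete_topology (carrier (free_group Y Mod N))"
  have tS: "topspace ?S = S" using S by (simp add: topspace_free_profinite Int_absorb1)
  have hP: "h f \<in> carrier (free_profinite_group Y)" if "f \<in> S" for f using that T by blast
  have "continuous_map ?S (product_topology ?D (free_levels Y)) h"
    unfolding continuous_map_componentwise
  proof (intro conjI ballI)
    show "h ` topspace ?S \<subseteq> extensional (free_levels Y)"
      using profinite_PiE[OF hP] unfolding tS by (auto simp: PiE_def)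
    fix N assume N: "N \<in> free_levels Y"
    show "continuous_map ?S (?D N) (\<lambda>f. h f N)"
      unfolding continuous_map_def
    proof (intro conjI allI impI)
      show "(\<lambda>f. h f N) \<in> topspace ?S \<rightarrow> topspace (?D N)"
        using profinite_component[OF hP N] tS by auto
      fix V assume "openin (?D N) V"
      obtain i where i: "level Y i \<subseteq> N" by (rule level_cofinal[OF N])
      obtain j where j: "\<forall>f\<in>S. \<forall>g\<in>S. f (level X j) = g (level X j) \<longrightarrow> h f (level Y i) = h g (level Y i)"
        using unif by blast
      show "openin ?S {f \<in> topspace ?S. h f N \<in> V}"
      proof (subst openin_subopen, intro ballI)
        fix f assume "f \<in> {f \<in> topspace ?S. h f N \<in> V}"
        then have f: "f \<in> S" "h f N \<in> V" using tS by auto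
        let ?W = "{g \<in> carrier (free_profinite_group X). g (level X j) = f (level X j)} \<inter> S"
        have "openin ?S ?W"
          unfolding openin_subtopology using openin_component[OF level_mem, of X j] by blast
        moreover have "f \<in> ?W" using f(1) S by auto
        moreover have "?W \<subseteq> {f \<in> topspace ?S. h f N \<in> V}"
        proof
          fix g assume g: "g \<in> ?W"
          then have gS: "g \<in> S" "g (level X j) = f (level X j)" by auto
          have "h g (level Y i) = h f (level Y i)" using bspec[OF bspec[OF j gS(1)] f(1)] gS(2) by simp
          then have "h g N = h f N"
            using component_coarser[OF hP hP level_mem N i] g f(1) by blast
          then show "g \<in> {f \<in> topspace ?S. h f N \<in> V}" using g f(2) tS by simp
        qed
        ultimately show "\<exists>W. openin ?S W \<and> f \<in> W \<and> W \<subseteq> {f \<in> topspace ?S. h f N \<in> V}" by blast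
      qed
    qed
  qed
  moreover have "h \<in> topspace ?S \<rightarrow> T" "h \<in> topspace ?S \<rightarrow> carrier (free_profinite_group Y)"
    using T tS by auto
  ultimately show ?thesis
    unfolding free_profinite_topology_def[of Y] by (simp add: continuous_map_in_subtopology)
qed

section \<open>Closed subgroups\<close>

text \<open>The limit taken in the whole group lies in \<open>over i M\<close> for every
  \<open>i\<close>, hence in \<open>M\<close> by closedness.\<close>

lemma (in complete_chain_group) complete_closed_subgroup:
  assumes M: "subgroup M G" "closed M"
  shows "complete_chain_group (G\<lparr>carrier := M\<rparr>) (\<lambda>i. U i \<inter> M)"
proof (intro complete_chain_group.intro complete_chain_group_axioms.intro chain_group_subgroup[OF M(1)])
  fix x assume "\<And>i. x \<in> U i \<inter> M"
  then show "x = \<one>\<^bsub>G\<lparr>carrier := M\<rparr>\<^esub>" using separated[of x] by simp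
next
  fix a assume a: "\<And>i. a i \<in> carrier (G\<lparr>carrier := M\<rparr>)"
    "\<And>i. a (Suc i) \<otimes>\<^bsub>G\<lparr>carrier := M\<rparr>\<^esub> inv\<^bsub>G\<lparr>carrier := M\<rparr>\<^esub> a i \<in> U i \<inter> M"
  have aM: "a i \<in> M" for i using a(1) by simp
  have ac: "a i \<in> carrier G" for i by (rule subgroup.mem_carrier[OF M(1) aM])
  have inv: "inv\<^bsub>G\<lparr>carrier := M\<rparr>\<^esub> a i = inv a i" for i by (rule m_inv_consistent[OF M(1) aM])
  have "a (Suc i) \<otimes> inv a i \<in> U i" for i using a(2)[of i] by (simp add: inv)
  then obtain x where x: "x \<in> carrier G" "\<And>i. x \<otimes> inv a i \<in> U i" using complete[of a] ac by blast
  have "x \<in> over i M" for i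
  proof -
    have "x = (x \<otimes> inv a i) \<otimes> a i" using x(1) ac by (simp add: m_assoc)
    then show ?thesis using x(2)[of i] aM[of i] unfolding set_mult_def by blast
  qed
  then have xM: "x \<in> M" using M(2) x(1) unfolding closed_def by blast
  have "x \<otimes> inv a i \<in> M" for i by (rule subgroup.m_closed[OF M(1) xM subgroup.m_inv_closed[OF M(1) aM]])
  then have "\<forall>i. x \<otimes>\<^bsub>G\<lparr>carrier := M\<rparr>\<^esub> inv\<^bsub>G\<lparr>carrier := M\<rparr>\<^esub> a i \<in> U i \<inter> M" using x(2) by (simp add: inv)
  then show "\<exists>x\<in>carrier (G\<lparr>carrier := M\<rparr>). \<forall>i. x \<otimes>\<^bsub>G\<lparr>carrier := M\<rparr>\<^esub> inv\<^bsub>G\<lparr>carrier := M\<rparr>\<^esub> a i \<in> U i \<inter> M"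
    using xM by auto
qed

text \<open>Both groups are complete and solve their embedding problems, so
  \<open>iwasawa_uniqueness\<close> gives the isomorphism; the rest turns its control along the two
  chains into continuity in the product topologies.\<close>

lemma closed_subgroup_iso_free_profinite:
  assumes M: "subgroup M (free_profinite_group X)" "closedin (free_profinite_topology X) M"
    and ep: "embeddings_solvable ((free_profinite_group X)\<lparr>carrier := M\<rparr>) (\<lambda>i. nbhd X i \<inter> M)"
  shows "top_group_iso ((free_profinite_group X)\<lparr>carrier := M\<rparr>) (subtopology (free_profinite_topology X) M)
    Fhat_omega Fhat_omega_top"
proof -
  let ?P = "free_profinite_group X" and ?Y = "UNIV :: nat set"
  let ?PM = "?P\<lparr>carrier := M\<rparr>" and ?V = "nbhd ?Y" and ?U = "\<lambda>i. nbhd X i \<inter> M"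
  interpret P: complete_chain_group ?P "nbhd X" by (rule profinite_complete_chain_group)
  interpret F: complete_chain_group Fhat_omega ?V by (rule profinite_complete_chain_group)
  have MP: "M \<subseteq> carrier ?P" by (rule subgroup.subset[OF M(1)])
  have cM: "complete_chain_group ?PM ?U"
    by (rule P.complete_closed_subgroup[OF M(1) closedin_imp_closed[OF M(2)]])
  have "finite {n. gen ?Y n \<notin> ?V i}" for i using gen_convergent[of ?Y i] by simp
  then have "embeddings_solvable Fhat_omega ?V"
    by (rule F.free_embeddings_solvable[OF profinite_free_on])
  from iwasawa_uniqueness[OF cM ep F.complete_chain_group_axioms this] obtain h
    where h: "h \<in> iso ?PM Fhat_omega" "\<And>i. \<exists>j. \<forall>x\<in>?U j. h x \<in> ?V i"
      "\<And>i. \<exists>j. \<forall>x\<in>carrier ?PM. h x \<in> ?V j \<longrightarrow> x \<in> ?U i" by blast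
  have hom: "h \<in> hom ?PM Fhat_omega" and bij: "bij_betw h M (carrier Fhat_omega)"
    using h(1) by (auto simp: iso_def)
  have gPM: "group ?PM" by (rule subgroup.subgroup_is_group[OF M(1) P.is_group])
  interpret h: group_hom ?PM Fhat_omega h by (rule group_homI[OF gPM F.is_group hom])
  have h_diff: "h (x \<otimes>\<^bsub>?P\<^esub> inv\<^bsub>?P\<^esub> x') = h x \<otimes>\<^bsub>Fhat_omega\<^esub> inv\<^bsub>Fhat_omega\<^esub> h x'"
    if "x \<in> M" "x' \<in> M" for x x'
  proof -
    have i: "inv\<^bsub>?PM\<^esub> x' = inv\<^bsub>?P\<^esub> x'" by (rule P.m_inv_consistent[OF M(1) that(2)])
    have "inv\<^bsub>?P\<^esub> x' \<in> M" by (rule subgroup.m_inv_closed[OF M(1) that(2)])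
    then show ?thesis using h.hom_mult[of x "inv\<^bsub>?P\<^esub> x'"] h.hom_inv[of x'] that by (simp add: i)
  qed
  have hF: "h x \<in> carrier Fhat_omega" if "x \<in> M" for x using bij that by (auto simp: bij_betw_def)
  have diffM: "x \<otimes>\<^bsub>?P\<^esub> inv\<^bsub>?P\<^esub> x' \<in> M" if "x \<in> M" "x' \<in> M" for x x'
    by (rule subgroup.m_closed[OF M(1) that(1) subgroup.m_inv_closed[OF M(1) that(2)]])
  let ?k = "inv_into M h"
  have k: "?k y \<in> M" "h (?k y) = y" if "y \<in> carrier Fhat_omega" for y
    using bij that by (auto simp: bij_betw_def inv_into_into f_inv_into_f)
  have unif1: "\<exists>j. \<forall>f\<in>M. \<forall>g\<in>M. f (level X j) = g (level X j) \<longrightarrow> h f (level ?Y i) = h g (level ?Y i)" for i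
  proof -
    obtain j where j: "\<forall>x\<in>?U j. h x \<in> ?V i" using h(2) by blast
    have "h f (level ?Y i) = h g (level ?Y i)" if fg: "f \<in> M" "g \<in> M" "f (level X j) = g (level X j)" for f g
    proof -
      have "f \<otimes>\<^bsub>?P\<^esub> inv\<^bsub>?P\<^esub> g \<in> ?U j"
        using mem_nbhd_diff[OF subsetD[OF MP fg(1)] subsetD[OF MP fg(2)]] fg(3) diffM[OF fg(1,2)] by blast
      then have "h f \<otimes>\<^bsub>Fhat_omega\<^esub> inv\<^bsub>Fhat_omega\<^esub> h g \<in> ?V i" using j h_diff[OF fg(1,2)] by force
      then show ?thesis using mem_nbhd_diff[OF hF[OF fg(1)] hF[OF fg(2)]] by blast
    qed
    then show ?thesis by blast
  qed
  have unif2: "\<exists>j. \<forall>f\<in>carrier Fhat_omega. \<forall>g\<in>carrier Fhat_omega. f (level ?Y j) = g (level ?Y j) \<longrightarrow>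
      ?k f (level X i) = ?k g (level X i)" for i
  proof -
    obtain j where j: "\<forall>x\<in>M. h x \<in> ?V j \<longrightarrow> x \<in> ?U i" using h(3)[of i] by auto
    have "?k f (level X i) = ?k g (level X i)"
      if fg: "f \<in> carrier Fhat_omega" "g \<in> carrier Fhat_omega" "f (level ?Y j) = g (level ?Y j)" for f g
    proof -
      have kM: "?k f \<in> M" "?k g \<in> M" using k fg by auto
      have "f \<otimes>\<^bsub>Fhat_omega\<^esub> inv\<^bsub>Fhat_omega\<^esub> g \<in> ?V j" using mem_nbhd_diff[OF fg(1,2)] fg(3) by blast
      then have "h (?k f \<otimes>\<^bsub>?P\<^esub> inv\<^bsub>?P\<^esub> ?k g) \<in> ?V j" using h_diff[OF kM] k(2) fg by simp
      then have "?k f \<otimes>\<^bsub>?P\<^esub> inv\<^bsub>?P\<^esub> ?k g \<in> nbhd X i" using j diffM[OF kM] by blast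
      then show ?thesis using mem_nbhd_diff[OF subsetD[OF MP kM(1)] subsetD[OF MP kM(2)]] by blast
    qed
    then show ?thesis by blast
  qed
  have topF: "subtopology Fhat_omega_top (carrier Fhat_omega) = Fhat_omega_top"
    using subtopology_topspace[of Fhat_omega_top] by (simp add: topspace_free_profinite)
  have c1: "continuous_map (subtopology (free_profinite_topology X) M) Fhat_omega_top h"
    using profinite_continuous_map[where X = X and Y = ?Y and S = M and T = "carrier Fhat_omega" and h = h,
        OF MP order_refl _ unif1] hF by (simp add: topF image_subset_iff)
  have c2: "continuous_map Fhat_omega_top (subtopology (free_profinite_topology X) M) ?k"
    using profinite_continuous_map[where X = ?Y and Y = X and S = "carrier Fhat_omega" and T = M and h = ?k,
        OF order_refl MP _ unif2] k(1) by (simp add: topF image_subset_iff)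
  have "homeomorphic_maps (subtopology (free_profinite_topology X) M) Fhat_omega_top h ?k"
    unfolding homeomorphic_maps_def
    using c1 c2 k(2) MP bij by (auto simp: topspace_free_profinite bij_betw_def)
  then have "homeomorphic_map (subtopology (free_profinite_topology X) M) Fhat_omega_top h"
    using homeomorphic_map_maps by blast
  then show ?thesis using h(1) unfolding top_group_iso_def by blast
qed

theorem theorem2p7:
  fixes e :: nat
    and M1 M2 M :: "((bool \<times> nat) list set \<Rightarrow> (bool \<times> nat) list set) set"
  assumes "e \<ge> 2"
    and "M1 \<lhd> Fhat e" and "closedin (Fhat_top e) M1"
    and "M2 \<lhd> Fhat e" and "closedin (Fhat_top e) M2"
    and "subgroup M (Fhat e)" and "closedin (Fhat_top e) M"
    and "infinite (rcosets\<^bsub>Fhat e\<^esub> M)"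
    and "M1 \<inter> M2 \<subseteq> M"
    and "\<not> M1 \<subseteq> M" and "\<not> M2 \<subseteq> M"
  shows "top_group_iso ((Fhat e)\<lparr>carrier := M\<rparr>) (subtopology (Fhat_top e) M)
           Fhat_omega Fhat_omega_top"
proof -
  interpret P: chain_group "Fhat e" "nbhd {..<e}" by (rule profinite_chain_group)
  have "embeddings_solvable ((Fhat e)\<lparr>carrier := M\<rparr>) (\<lambda>i. nbhd {..<e} i \<inter> M)"
    by (rule P.diamond_embeddings_solvable[OF profinite_free_on _ _ assms(6) closedin_imp_closed[OF assms(7)]
          assms(8,2,4,9-11)]) (use assms(1) in simp_all)
  then show ?thesis by (rule closed_subgroup_iso_free_profinite[OF assms(6,7)])
qed


end
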